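(* Let $G$ be a heptagraph. If $\delta(G)\ge 3$, then $G$ is bipartite, or $G$ admits a $P_3$-cutset, or $G$ admits a parity star-cutset.
   Context: All graphs are finite and simple; $\delta(G)$ is the minimum degree of $G$. A hole is an induced cycle of length at least $4$. A heptagraph is a graph that has no cycles of length less than $7$ and has no holes of odd length at least $9$. A cutset of $G$ is a set $X\subseteq V(G)$ such that $G-X$ is disconnected. A $P_3$-cutset of $G$ is an induced path $P$ on three vertices such that $V(P)$ is a cutset. A parity star-cutset is a cutset $X\subseteq V(G)$ such that $X$ contains a vertex $x$ adjacent to every other vertex in $X$, and $G-X$ has a component $A$ such that every two vertices in $X\setminus\{x\}$ are joined by an induced path of even length in $G$ with all interior vertices in $V(A)$. *)

theory Defs
  imports "Graph_Theory.Graph_Theory"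
begin

text \<open>
  A finite simple graph is a digraph satisfying the AFP predicate \<^const>\<open>graph\<close>: finite,
  loop-free, without parallel arcs, and symmetric.  So an edge \<open>uv\<close> is a pair of opposite arcs,
  \<^const>\<open>out_degree\<close> counts neighbours, and strongly connected components are components.
  Paths and cycles are lists of arcs, hence \<^const>\<open>length\<close> is the number of edges.
\<close>

definition min_degree :: "('a,'b) pre_digraph \<Rightarrow> nat" where
  "min_degree G = Min (out_degree G ` verts G)"

definition bipartite :: "('a,'b) pre_digraph \<Rightarrow> bool" where
  "bipartite G \<longleftrightarrow> (\<exists>U V. verts G = U \<union> V \<and> U \<inter> V = {} \<and>
     (\<forall>e \<in> arcs G. tail G e \<in> U \<and> head G e \<in> V \<or> tail G e \<in> V \<and> head G e \<in> U))"

text \<open>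
  Every edge of \<open>G\<close> joining two vertices of the walk \<open>p\<close> is traversed by \<open>p\<close> in one of the two
  directions, i.e. \<open>p\<close> has no chord.
\<close>
definition chordless :: "('a,'b) pre_digraph \<Rightarrow> 'b awalk \<Rightarrow> bool" where
  "chordless G p \<longleftrightarrow>
     (let W = tail G ` set p \<union> head G ` set p in
      \<forall>e \<in> arcs G. tail G e \<in> W \<and> head G e \<in> W \<longrightarrow>
        (\<exists>f \<in> set p. {tail G f, head G f} = {tail G e, head G e}))"

text \<open>
  The AFP notion \<^const>\<open>pre_digraph.cycle\<close> also admits the closed walk of length 2 that goes
  back and forth along one edge; this is not a cycle of an undirected graph.
\<close>
definition is_cycle :: "('a,'b) pre_digraph \<Rightarrow> 'b awalk \<Rightarrow> bool" where
  "is_cycle G p \<longleftrightarrow> pre_digraph.cycle G p \<and> 3 \<le> length p"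

definition hole :: "('a,'b) pre_digraph \<Rightarrow> 'b awalk \<Rightarrow> bool" where
  "hole G p \<longleftrightarrow> is_cycle G p \<and> chordless G p \<and> 4 \<le> length p"

definition induced_path :: "('a,'b) pre_digraph \<Rightarrow> 'a \<Rightarrow> 'b awalk \<Rightarrow> 'a \<Rightarrow> bool" where
  "induced_path G u p v \<longleftrightarrow> pre_digraph.apath G u p v \<and> chordless G p"

definition heptagraph :: "('a,'b) pre_digraph \<Rightarrow> bool" where
  "heptagraph G \<longleftrightarrow> graph G \<and>
     \<not> (\<exists>p. is_cycle G p \<and> length p < 7) \<and>
     \<not> (\<exists>p. hole G p \<and> odd (length p) \<and> 9 \<le> length p)"

definition delete_verts :: "('a,'b) pre_digraph \<Rightarrow> 'a set \<Rightarrow> ('a,'b) pre_digraph" where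
  "delete_verts G X = G \<restriction> (verts G - X)"

text \<open>
  The null graph is not \<^const>\<open>Digraph_Component.connected\<close>, but it is not disconnected either;
  so \<open>X = verts G\<close> is not a cutset.
\<close>
definition cutset :: "('a,'b) pre_digraph \<Rightarrow> 'a set \<Rightarrow> bool" where
  "cutset G X \<longleftrightarrow> X \<subseteq> verts G \<and> verts (delete_verts G X) \<noteq> {} \<and>
     \<not> Digraph_Component.connected (delete_verts G X)"

definition has_P3_cutset :: "('a,'b) pre_digraph \<Rightarrow> bool" where
  "has_P3_cutset G \<longleftrightarrow> (\<exists>u p v. induced_path G u p v \<and> length p = 2 \<and>
     cutset G (set (pre_digraph.awalk_verts G u p)))"

definition parity_star_cutset :: "('a,'b) pre_digraph \<Rightarrow> 'a set \<Rightarrow> bool" where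
  "parity_star_cutset G X \<longleftrightarrow> cutset G X \<and>
     (\<exists>x \<in> X. (\<forall>y \<in> X - {x}. x \<rightarrow>\<^bsub>G\<^esub> y) \<and>
       (\<exists>A \<in> pre_digraph.sccs (delete_verts G X).
          \<forall>y \<in> X - {x}. \<forall>z \<in> X - {x}. y \<noteq> z \<longrightarrow>
            (\<exists>p. induced_path G y p z \<and> even (length p) \<and>
                 set (pre_digraph.inner_verts G p) \<subseteq> verts A)))"

end

theory Submission
  imports Defs
begin

text \<open>
  Suppose that a heptagraph \<open>G\<close> of minimum degree at least 3 has no \<open>P\<^sub>3\<close>-cutset and no parity
  star-cutset.  Then \<open>G\<close> is connected, and if it is not bipartite, a shortest odd closed walk is an
  induced heptagon \<open>C\<close>.  A component of \<open>G - C\<close> cannot be attached to a path on three vertices of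
  \<open>C\<close> only, so that it contains an ear of \<open>C\<close> between two vertices at distance 3.  Together with
  each of several paths of \<open>C\<close> such an ear forms a hole, which is even or has length 7; this leaves
  few possibilities.

  An ear between vertices at distance 3 or 2 without further contacts with \<open>C\<close> would yield an
  induced theta graph with paths of lengths 3, 4, 4 or 2, 5, 5.  Both are excluded by looking at a
  component attached to the middle of a path on three vertices: either it reaches the rest of the
  theta graph by an ear, which creates an inadmissible hole, another pure ear or a slightly larger
  configuration for which a \<open>P\<^sub>3\<close>-cutset exists, or it is cut off by a star.  The leaves of this
  star lie on short paths from its centre \<open>w\<close> to a common vertex \<open>s\<close>, and these paths contain
  induced detours of even length between any two leaves, whence the parity of the star.

  Consequently every component of \<open>G - C\<close> is attached to a path on four vertices of
  \<open>C\<close> only, by an ear that touches the two middle ones.  For one such component take the vertex of \<open>C\<close>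
  opposite to it and a second component attached there.  The parities of the two ears are
  determined, and together they form an odd hole of length at least 9.
\<close>

subsection \<open>Induced paths and holes\<close>

text \<open>The only admissible odd hole length is 7. So if a pure ear has two completions of
  opposite parity, one of the two holes is a heptagon, and this fixes the length of the ear. The
  arcs of the heptagon between the feet have lengths 3 and 4, or 2 and 5; hence the thetas 3, 4, 4
  and 2, 5, 5. Beyond 7 only parities matter. Whether an ear of arbitrary length can join two given
  vertices of a fixed configuration is therefore a finite test on the induced paths of that
  configuration, and most of the case analysis is a computation.

  The obstacle is that parity does not exclude every ear. In the theta 3, 4, 4 an ear with three
  vertices from 4 to 1, or from 6 to 2, survives all tests. The first vertices of all such ears are
  deleted in advance and become the leaves of a star. There are two such stars, centred at 4 and at
  6. The component below 5 cannot reach both sides, so one of the two stars cuts it off. The minimum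
  degree enters through the third neighbour of a vertex that has degree 2 in the configuration: it
  provides the component to look at.\<close>

text \<open>\<open>ip E xs\<close>: the list \<open>xs\<close> is an induced path of the graph with adjacency \<open>E\<close>.\<close>
fun ip :: "('b \<Rightarrow> 'b \<Rightarrow> bool) \<Rightarrow> 'b list \<Rightarrow> bool" where
  "ip E [] = True"
| "ip E (x # xs) = (x \<notin> set xs \<and>
     (case xs of [] \<Rightarrow> True | y # ys \<Rightarrow> E x y \<and> (\<forall>z \<in> set ys. \<not> E x z)) \<and> ip E xs)"

lemma ip_nth:
  assumes "\<And>x y. E x y \<Longrightarrow> E y x"
  shows "ip E xs \<longleftrightarrow> distinct xs \<and>
    (\<forall>i < length xs. \<forall>j < length xs. i < j \<longrightarrow> (E (xs ! i) (xs ! j) \<longleftrightarrow> j = Suc i))"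
proof (induction xs)
  case (Cons x xs)
  show ?case
  proof (cases xs)
    case (Cons y ys)
    have *: "(\<forall>i < length (x # xs). \<forall>j < length (x # xs). i < j \<longrightarrow>
        (E ((x # xs) ! i) ((x # xs) ! j) \<longleftrightarrow> j = Suc i)) \<longleftrightarrow>
      (\<forall>j < length xs. E x (xs ! j) \<longleftrightarrow> j = 0) \<and>
      (\<forall>i < length xs. \<forall>j < length xs. i < j \<longrightarrow> (E (xs ! i) (xs ! j) \<longleftrightarrow> j = Suc i))"
      by (simp add: All_less_Suc2) 
    have "(\<forall>j < length xs. E x (xs ! j) \<longleftrightarrow> j = 0) \<longleftrightarrow> E x y \<and> (\<forall>z \<in> set ys. \<not> E x z)"
      unfolding Cons by (simp add: All_less_Suc2 all_set_conv_all_nth)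
    then show ?thesis
      using Cons.IH * Cons by auto
  qed simp
qed simp

lemma ip_distinct: "ip E xs \<Longrightarrow> distinct xs"
  by (induction xs) auto

lemma ip_tl: "ip E (x # xs) \<Longrightarrow> ip E xs"
  by simp

lemma ip_append:
  assumes s: "\<And>x y. E x y \<Longrightarrow> E y x"
    and "ip E xs" "ip E ys" "xs \<noteq> []" "ys \<noteq> []" "set xs \<inter> set ys = {}"
    and "\<And>x y. x \<in> set xs \<Longrightarrow> y \<in> set ys \<Longrightarrow> E x y \<longleftrightarrow> x = last xs \<and> y = hd ys"
  shows "ip E (xs @ ys)"
  using assms(2-)
proof (induction xs)
  case (Cons x xs)
  show ?case
  proof (cases xs)
    case Nil
    with Cons.prems show ?thesis
      by (cases ys) auto
  next
    case (Cons z zs)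
    have d: "x \<notin> set xs" using Cons.prems(1) by simp
    have "ip E (xs @ ys)"
    proof (rule Cons.IH)
      show "E u y = (u = last xs \<and> y = hd ys)" if "u \<in> set xs" "y \<in> set ys" for u y
        using Cons.prems(6)[of u y] that Cons by auto
    qed (use Cons.prems Cons in auto)
    moreover have "\<not> E x y" if "y \<in> set ys" for y
      using Cons.prems(6)[of x y] that Cons d by (metis last_ConsR last_in_set list.set_intros(1) list.simps(3))
    ultimately show ?thesis
      using Cons.prems Cons by auto
  qed
qed simp

lemma ip_rev:
  assumes s: "\<And>x y. E x y \<Longrightarrow> E y x" and "ip E xs"
  shows "ip E (rev xs)"
proof -
  have d: "distinct xs" and *: "\<And>i j. i < length xs \<Longrightarrow> j < length xs \<Longrightarrow> i < j \<Longrightarrow> E (xs ! i) (xs ! j) \<longleftrightarrow> j = Suc i"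
    using assms(2) by (auto simp: ip_nth[OF s])
  have "E (rev xs ! i) (rev xs ! j) \<longleftrightarrow> j = Suc i" if "i < length xs" "j < length xs" "i < j" for i j
  proof -
    let ?n = "length xs"
    have "E (xs ! (?n - Suc i)) (xs ! (?n - Suc j)) \<longleftrightarrow> E (xs ! (?n - Suc j)) (xs ! (?n - Suc i))"
      using s by blast
    also have "\<dots> \<longleftrightarrow> ?n - Suc i = Suc (?n - Suc j)"
      using that by (intro *) auto
    finally show ?thesis using that by (auto simp: rev_nth)
  qed
  then show ?thesis using d by (simp add: ip_nth[OF s])
qed

lemma ip_take: "ip E xs \<Longrightarrow> ip E (take n xs)"
proof (induction xs arbitrary: n)
  case (Cons x xs)
  show ?case
  proof (cases n)
    case (Suc m)
    then show ?thesis using Cons.prems Cons.IH[of m]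
      by (cases xs; cases m) (auto dest: in_set_takeD)
  qed simp
qed simp

lemma ip_drop: "ip E xs \<Longrightarrow> ip E (drop n xs)"
proof (induction xs arbitrary: n)
  case (Cons x xs)
  then show ?case by (cases n) auto
qed simp

lemma ip_map:
  assumes "ip T is" "inj_on f (set is)"
    and "\<And>i j. i \<in> set is \<Longrightarrow> j \<in> set is \<Longrightarrow> E (f i) (f j) \<longleftrightarrow> T i j"
  shows "ip E (map f is)"
  using assms
proof (induction "is")
  case (Cons i "is")
  have "ip E (map f is)" using Cons by (auto intro!: Cons.IH)
  moreover have "f i \<notin> f ` set is" using Cons.prems(1,2) by auto
  ultimately show ?case using Cons.prems
    by (cases "is") auto
qed simp

definition seg :: "nat \<Rightarrow> nat \<Rightarrow> 'b list \<Rightarrow> 'b list" where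
  "seg a b P = take (Suc (b - a)) (drop a P)"

lemma seg:
  assumes "a \<le> b" "b < length P"
  shows "length (seg a b P) = Suc (b - a)" "hd (seg a b P) = P ! a" "last (seg a b P) = P ! b"
    "set (seg a b P) = (!) P ` {a..b}"
proof -
  show l: "length (seg a b P) = Suc (b - a)" using assms by (simp add: seg_def)
  have n: "seg a b P ! i = P ! (a + i)" if "i \<le> b - a" for i using that assms by (simp add: seg_def)
  have "seg a b P \<noteq> []" using l by auto
  then show "hd (seg a b P) = P ! a" "last (seg a b P) = P ! b"
    using l n[of 0] n[of "b - a"] assms by (simp_all add: hd_conv_nth last_conv_nth)
  show "set (seg a b P) = (!) P ` {a..b}"
  proof -
    have "{..b - a} = {..<length (seg a b P)}" using l by auto
    then have "set (seg a b P) = (!) (seg a b P) ` {..b - a}"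
      using nth_image[of "length (seg a b P)" "seg a b P"] by (simp add: atLeast0LessThan)
    also have "\<dots> = (\<lambda>i. P ! (a + i)) ` {..b - a}" using n by (intro image_cong) auto
    also have "\<dots> = (!) P ` ((+) a ` {0..b - a})" by (simp only: image_image atMost_atLeast0)
    also have "(+) a ` {0..b - a} = {a..b}" using assms(1) by (simp only: image_add_atLeastAtMost) simp
    finally show ?thesis .
  qed
qed

lemma ip_seg: "ip E P \<Longrightarrow> ip E (seg a b P)"
  unfolding seg_def by (intro ip_take ip_drop)

section \<open>Graphs of girth at least 7 whose odd holes are heptagons\<close>

locale heptag =
  fixes V :: "'a set" and E :: "'a \<Rightarrow> 'a \<Rightarrow> bool"
  assumes sym: "E x y \<Longrightarrow> E y x"
    and irr: "\<not> E x x"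
    and inV: "E x y \<Longrightarrow> x \<in> V"
    and girth: "distinct xs \<Longrightarrow> 3 \<le> length xs \<Longrightarrow> successively E xs \<Longrightarrow> E (last xs) (hd xs) \<Longrightarrow> 7 \<le> length xs"
    and odd_hole: "distinct xs \<Longrightarrow> 7 \<le> length xs \<Longrightarrow>
      (\<And>i j. i < length xs \<Longrightarrow> j < length xs \<Longrightarrow>
        E (xs ! i) (xs ! j) \<longleftrightarrow> j = Suc i mod length xs \<or> i = Suc j mod length xs) \<Longrightarrow>
      even (length xs) \<or> length xs = 7"
begin

lemma ip_successively: "ip E xs \<Longrightarrow> successively E xs"
  by (induction xs) (auto simp: successively_Cons split: list.splits)

lemma ip_adj:
  assumes "ip E xs" "i < length xs" "j < length xs"
  shows "E (xs ! i) (xs ! j) \<longleftrightarrow> j = Suc i \<or> i = Suc j"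
proof -
  have *: "E (xs ! i) (xs ! j) \<longleftrightarrow> j = Suc i" if "i < j" "j < length xs" for i j
    using assms(1) that by (auto simp: ip_nth[OF sym])
  show ?thesis
  proof (cases i j rule: linorder_cases)
    case less
    then show ?thesis using *[of i j] assms by auto
  next
    case equal
    then show ?thesis using irr by auto
  next
    case greater
    then have "E (xs ! i) (xs ! j) \<longleftrightarrow> E (xs ! j) (xs ! i)" using sym by blast
    then show ?thesis using *[of j i] greater assms by auto
  qed
qed

text \<open>\<open>P @ R\<close> lists a cycle in cyclic order whose two joints are the only edges
  between the paths, so its adjacencies are those of consecutive indices modulo the length. The
  bound 3 excludes two single vertices, for which both joints would be the same edge.\<close>

lemma hole_length:
  assumes P: "ip E P" and R: "ip E R" and ne: "P \<noteq> []" "R \<noteq> []" and n3: "3 \<le> length P + length R"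
    and dj: "set P \<inter> set R = {}"
    and cr: "\<And>x y. x \<in> set P \<Longrightarrow> y \<in> set R \<Longrightarrow> E x y \<longleftrightarrow> x = last P \<and> y = hd R \<or> x = hd P \<and> y = last R"
  shows "7 \<le> length P + length R" "even (length P + length R) \<or> length P + length R = 7"
proof -
  let ?xs = "P @ R" and ?p = "length P" and ?n = "length P + length R"
  have dP: "distinct P" and dR: "distinct R" using P R by (auto dest: ip_distinct)
  have d: "distinct ?xs" using dP dR dj by simp
  have e1: "E (last P) (hd R)" "E (hd P) (last R)" using cr ne by auto
  have "successively E ?xs"
    using P R e1 ne by (auto simp: successively_append_iff dest: ip_successively)
  moreover have "E (last ?xs) (hd ?xs)" using e1 ne sym by auto
  ultimately show n7: "7 \<le> ?n" using girth[of ?xs] d n3 by simp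
  have pos: "0 < ?p" "0 < length R" using ne by auto
  have hl: "hd P = P ! 0" "hd R = R ! 0" "last P = P ! (?p - 1)" "last R = R ! (length R - 1)"
    using ne by (auto simp: hd_conv_nth last_conv_nth)
  note PP = ip_adj[OF P] and RR = ip_adj[OF R]
  have PR: "E (P ! i) (R ! j) \<longleftrightarrow> Suc i = ?p \<and> j = 0 \<or> i = 0 \<and> Suc j = length R"
    if "i < ?p" "j < length R" for i j
  proof -
    have "E (P ! i) (R ! j) \<longleftrightarrow> P ! i = P ! (?p - 1) \<and> R ! j = R ! 0 \<or> P ! i = P ! 0 \<and> R ! j = R ! (length R - 1)"
      using that cr[of "P ! i" "R ! j"] hl by simp
    then show ?thesis using that dP dR pos
      by (auto simp: nth_eq_iff_index_eq simp del: length_greater_0_conv)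
  qed
  have "E (?xs ! i) (?xs ! j) \<longleftrightarrow> j = Suc i mod ?n \<or> i = Suc j mod ?n" if "i < ?n" "j < ?n" for i j
  proof -
    have S: "Suc k mod ?n = (if Suc k = ?n then 0 else Suc k)" if "k < ?n" for k
      using that by auto
    consider "i < ?p" "j < ?p" | "i < ?p" "?p \<le> j" | "?p \<le> i" "j < ?p" | "?p \<le> i" "?p \<le> j" by linarith
    then show ?thesis
    proof cases
      case 1
      then show ?thesis using pos PP[of i j] by (auto simp: nth_append S simp del: length_greater_0_conv)
    next
      case 2
      then show ?thesis using that pos PR[of i "j - ?p"] n7 by (auto simp: nth_append S simp del: length_greater_0_conv)
    next
      case 3
      have "E (?xs ! i) (?xs ! j) \<longleftrightarrow> E (P ! j) (R ! (i - ?p))" using 3 sym by (auto simp: nth_append)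
      then show ?thesis using 3 that pos PR[of j "i - ?p"] n7 by (auto simp: S simp del: length_greater_0_conv)
    next
      case 4
      then show ?thesis using that pos RR[of "i - ?p" "j - ?p"] by (auto simp: nth_append S simp del: length_greater_0_conv)
    qed
  qed
  then show "even ?n \<or> ?n = 7"
    using odd_hole[of ?xs] d n7 by simp
qed

end

subsection \<open>Parities of ears of a small configuration\<close>

definition adj :: "('b \<times> 'b) list \<Rightarrow> 'b \<Rightarrow> 'b \<Rightarrow> bool" where
  "adj es i j \<longleftrightarrow> (i, j) \<in> set es \<or> (j, i) \<in> set es"

definition nbs :: "('b \<times> 'b) list \<Rightarrow> 'b \<Rightarrow> 'b list" where
  "nbs es i = concat (map (\<lambda>(x, y). (if x = i then [y] else []) @ (if y = i then [x] else [])) es)"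

lemma set_nbs: "set (nbs es i) = {j. adj es i j}"
  by (auto simp: nbs_def adj_def split: if_splits)

text \<open>The induced paths from \<open>u\<close> to \<open>t\<close> on at most \<open>k\<close> vertices that avoid \<open>B\<close> after \<open>u\<close>.\<close>
fun paths :: "nat \<Rightarrow> ('b \<times> 'b) list \<Rightarrow> 'b list \<Rightarrow> 'b \<Rightarrow> 'b \<Rightarrow> 'b list list" where
  "paths 0 es B u t = []"
| "paths (Suc k) es B u t = (if u = t then [[t]] else
     concat (map (\<lambda>v. map ((#) u) (paths k es (u # nbs es u @ B) v t))
       (filter (\<lambda>v. v \<notin> set B) (nbs es u))))"

text \<open>The blocked list collects each visited vertex with all its neighbours, so later vertices
  cannot touch earlier ones. The enumerated paths serve only as witnesses that close an ear to a
  hole or a cycle.\<close>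

lemma paths_sound:
  assumes "\<And>i. \<not> adj es i i" and "R \<in> set (paths k es B u t)"
  shows "ip (adj es) R \<and> R \<noteq> [] \<and> hd R = u \<and> last R = t \<and> set (tl R) \<inter> set B = {}"
  using assms(2)
proof (induction k arbitrary: B u R)
  case (Suc k)
  show ?case
  proof (cases "u = t")
    case False
    then obtain v Q where v: "adj es u v" "v \<notin> set B" and R: "R = u # Q"
      and Q: "Q \<in> set (paths k es (u # nbs es u @ B) v t)"
      using Suc.prems by (auto simp: set_nbs)
    from Suc.IH[OF Q] have *: "ip (adj es) Q" "Q \<noteq> []" "hd Q = v" "last Q = t"
      "set (tl Q) \<inter> set (u # nbs es u @ B) = {}" by blast+
    obtain Q' where Q': "Q = v # Q'" using *(2,3) by (cases Q) auto
    have "u \<noteq> v" using v assms(1) by auto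
    then show ?thesis using * v unfolding R Q' by (auto simp: set_nbs)
  qed (use Suc.prems in auto)
qed simp

text \<open>The lengths that a hole of a heptagraph may have.\<close>
definition okn :: "nat \<Rightarrow> bool" where
  "okn n \<longleftrightarrow> 7 \<le> n \<and> (even n \<or> n = 7)"

text \<open>No number of path vertices \<open>n \<ge> lo\<close> completes all the paths \<open>Rs\<close> to holes of admissible
  length; from \<open>n = 8\<close> on this depends on the parity of \<open>n\<close> only.\<close>
definition bad :: "nat \<Rightarrow> 'b list list \<Rightarrow> bool" where
  "bad lo Rs \<longleftrightarrow> (\<forall>n \<in> set [lo..<lo + 8]. \<exists>R \<in> set Rs. \<not> okn (n + length R))"

lemma badD:
  assumes "bad lo Rs" "2 \<le> lo" "lo \<le> n" "\<And>R. R \<in> set Rs \<Longrightarrow> R \<noteq> []"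
  shows "\<exists>R \<in> set Rs. \<not> okn (n + length R)"
proof (cases "n < lo + 8")
  case True
  then show ?thesis using assms by (auto simp: bad_def)
next
  case False
  \<comment> \<open>The last two tested lengths. As \<open>lo\<close> is at least 2, both are at
    least 8, and they represent the two parities of all longer paths.\<close>
  define n' where "n' = (if even (n - lo) then lo + 6 else lo + 7)"
  have n': "lo \<le> n'" "n' < lo + 8" "8 \<le> n'" "n' \<le> n" "even n' = even n"
    using False assms(2) by (auto simp: n'_def)
  then obtain R where R: "R \<in> set Rs" "\<not> okn (n' + length R)"
    using assms(1) unfolding bad_def by (metis atLeastLessThan_iff set_upt)
  then have "R \<noteq> []" using assms(4) by blast
  then have "length R > 0" by simp
  then have "odd (n' + length R)" using R(2) n' by (auto simp: okn_def)
  then have "\<not> okn (n + length R)" using n' \<open>length R > 0\<close> by (auto simp: okn_def)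
  then show ?thesis using R by blast
qed

text \<open>
  The vertices \<open>ns\<close> form a path with centre \<open>b\<close>.  A path from \<open>z \<in> ns\<close> to \<open>t \<notin> ns\<close> without other
  contacts is excluded by parity unless \<open>(z, t) \<in> A\<close>, or else every path from another \<open>u \<in> ns\<close> to \<open>t\<close>
  whose further contacts are with \<open>z\<close> only is excluded; by the girth it has at least 5 vertices.
\<close>
definition exit_check :: "(nat \<times> nat) list \<Rightarrow> nat \<Rightarrow> nat \<Rightarrow> nat list \<Rightarrow> (nat \<times> nat) list \<Rightarrow> bool" where
  "exit_check es n b ns A \<longleftrightarrow>
     (\<forall>u \<in> set ns. \<forall>z \<in> set ns. u \<noteq> z \<longrightarrow> adj es u z \<or> adj es u b \<and> adj es b z) \<and>
     (\<forall>z \<in> set ns. \<forall>t \<in> set [0..<n]. t \<in> set ns \<or> (z, t) \<in> set A \<or>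
        bad 2 (paths n es [] z t) \<or>
        z \<noteq> b \<and> (\<forall>u \<in> set ns. u \<noteq> z \<longrightarrow> bad 5 (paths n es [z] u t)))"

text \<open>Five vertices mean distance at most 4: an outside vertex adjacent to both
  \<open>i\<close> and \<open>j\<close> would close a cycle of length at most 6.\<close>

definition diam4 :: "(nat \<times> nat) list \<Rightarrow> nat \<Rightarrow> bool" where
  "diam4 es n \<longleftrightarrow> (\<forall>i \<in> set [0..<n]. \<forall>j \<in> set [0..<n]. i = j \<or> paths 5 es [] i j \<noteq> [])"

lemma paths_length: "R \<in> set (paths k es B u t) \<Longrightarrow> length R \<le> k"
  by (induction k arbitrary: B u R) (auto split: if_splits)

text \<open>The heptagon, the theta graphs with paths of lengths 3, 4, 4 and 2, 5, 5 that contain it, and two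
  graphs arising from the former by an ear with two inner vertices.\<close>
definition E7 :: "(nat \<times> nat) list" where
  "E7 = [(0,1),(1,2),(2,3),(3,4),(4,5),(5,6),(6,0)]"
definition "E344 = E7 @ [(0,7),(7,8),(8,9),(9,3)]"
definition "E255 = E7 @ [(0,7),(7,8),(8,9),(9,10),(10,2)]"
definition "E12 = E344 @ [(5,10),(10,11),(11,8)]"
definition "E12b = E344 @ [(4,10),(10,11),(11,7)]"

text \<open>The last list contains the ears that survive the parity tests and need separate
  treatment. For \<open>E12\<close> it is empty, so a component seen from vertex 1 is attached to 0,
  1, 2 only.\<close>

lemma exit_344: "exit_check E344 10 5 [4,5,6] [(4,1),(6,2),(5,8),(4,7),(6,9)]" by code_simp
lemma exit_12: "exit_check E12 12 1 [0,1,2] []" by code_simp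
lemma exit_12b: "exit_check E12b 12 1 [0,1,2] [(0,6),(1,6),(1,10)]" by code_simp
lemma exit_255: "exit_check E255 11 5 [4,5,6] [(6,1),(6,2),(6,10),(5,1),(5,9),(4,1)]" by code_simp
lemma diam4_344: "diam4 E344 10" by code_simp
lemma diam4_12: "diam4 E12 12" by code_simp
lemma diam4_12b: "diam4 E12b 12" by code_simp

subsection \<open>Components and ears\<close>

definition emb :: "('a \<Rightarrow> 'a \<Rightarrow> bool) \<Rightarrow> nat \<Rightarrow> (nat \<Rightarrow> nat \<Rightarrow> bool) \<Rightarrow> (nat \<Rightarrow> 'a) \<Rightarrow> bool" where
  "emb E n T f \<longleftrightarrow> inj_on f {..<n} \<and> (\<forall>i<n. \<forall>j<n. E (f i) (f j) \<longleftrightarrow> T i j)"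

lemma emb_sub:
  assumes "emb E n T f" "distinct is" "set is \<subseteq> {..<n}"
    and "\<forall>i<length is. \<forall>j<length is. T (is ! i) (is ! j) \<longleftrightarrow> T' i j"
  shows "emb E (length is) T' (\<lambda>i. f (is ! i))"
proof -
  have *: "is ! i < n" if "i < length is" for i using assms(3) that nth_mem by blast
  have "inj_on (\<lambda>i. f (is ! i)) {..<length is}"
    using * assms(1,2) by (auto simp: emb_def nth_eq_iff_index_eq intro!: inj_onI dest!: inj_onD)
  then show ?thesis using * assms by (simp add: emb_def)
qed

definition walk :: "('a \<Rightarrow> 'a \<Rightarrow> bool) \<Rightarrow> 'a set \<Rightarrow> 'a list \<Rightarrow> bool" where
  "walk E K xs \<longleftrightarrow> xs \<noteq> [] \<and> set xs \<subseteq> K \<and> successively E xs"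

definition conn :: "('a \<Rightarrow> 'a \<Rightarrow> bool) \<Rightarrow> 'a set \<Rightarrow> bool" where
  "conn E K \<longleftrightarrow> (\<forall>x \<in> K. \<forall>y \<in> K. \<exists>xs. walk E K xs \<and> hd xs = x \<and> last xs = y)"

definition component :: "('a \<Rightarrow> 'a \<Rightarrow> bool) \<Rightarrow> 'a set \<Rightarrow> 'a \<Rightarrow> 'a set" where
  "component E W r = {v. \<exists>xs. walk E W xs \<and> hd xs = r \<and> last xs = v}"

text \<open>An ear from \<open>f i\<close> to \<open>f j\<close>, pure if \<open>F = {}\<close>; contacts with \<open>f ` F\<close> are unrestricted.\<close>
definition ear :: "('a \<Rightarrow> 'a \<Rightarrow> bool) \<Rightarrow> nat \<Rightarrow> (nat \<Rightarrow> 'a) \<Rightarrow> 'a list \<Rightarrow> nat set \<Rightarrow> nat \<Rightarrow> nat \<Rightarrow> bool" where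
  "ear E n f P F i j \<longleftrightarrow> ip E P \<and> P \<noteq> [] \<and> set P \<inter> f ` {..<n} = {} \<and> i < n \<and> j < n \<and>
     E (hd P) (f i) \<and> E (last P) (f j) \<and>
     (\<forall>v \<in> set P. \<forall>l<n. E v (f l) \<longrightarrow> l \<in> F \<or> v = hd P \<and> l = i \<or> v = last P \<and> l = j)"

lemma walk_append:
  "walk E K xs \<Longrightarrow> walk E K ys \<Longrightarrow> E (last xs) (hd ys) \<Longrightarrow> walk E K (xs @ ys)"
  by (auto simp: walk_def successively_append_iff)

lemma walk_join:
  assumes "walk E K xs" "walk E K ys" "last xs = hd ys"
  obtains zs where "walk E K zs" "hd zs = hd xs" "last zs = last ys"
proof (cases "tl ys")
  case Nil
  then have "last ys = hd ys" using assms(2) by (cases ys) (auto simp: walk_def)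
  then show ?thesis using assms that by metis
next
  case (Cons z zs)
  then obtain y where ys: "ys = y # z # zs" using assms(2) by (cases ys) (auto simp: walk_def)
  then have "walk E K (z # zs)" "E (last xs) z" using assms by (auto simp: walk_def)
  then have "walk E K (xs @ z # zs)" using assms walk_append by force
  then show ?thesis using that[of "xs @ z # zs"] assms ys by (auto simp: walk_def)
qed

section \<open>Walks, components and shortest paths\<close>

context heptag
begin

lemma walk_rev: "walk E K xs \<Longrightarrow> walk E K (rev xs)"
  unfolding walk_def by (auto simp: successively_rev intro: sym successively_mono)

lemma component_self: "r \<in> W \<Longrightarrow> r \<in> component E W r"
  unfolding component_def walk_def by (auto intro!: exI[of _ "[r]"])

lemma component_subset: "component E W r \<subseteq> W"
  unfolding component_def walk_def by (auto dest: last_in_set)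

lemma component_step:
  assumes "v \<in> component E W r" "E v u" "u \<in> W"
  shows "u \<in> component E W r"
proof -
  obtain xs where "walk E W xs" "hd xs = r" "last xs = v" using assms(1) by (auto simp: component_def)
  then have "walk E W (xs @ [u])" "hd (xs @ [u]) = r" "last (xs @ [u]) = u"
    using assms walk_append[of E W xs "[u]"] by (auto simp: walk_def)
  then show ?thesis unfolding component_def by blast
qed

lemma conn_component: "conn E (component E W r)"
proof -
  have *: "walk E (component E W r) xs" if "walk E W xs" "hd xs = r" for xs
  proof -
    have "x \<in> component E W r" if x: "x \<in> set xs" for x
    proof -
      obtain ys zs where "xs = ys @ x # zs" using split_list[OF x] by blast
      then have "walk E W (ys @ [x])" "hd (ys @ [x]) = r" "last (ys @ [x]) = x"
        using \<open>walk E W xs\<close> \<open>hd xs = r\<close>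
        by (auto simp: walk_def successively_append_iff hd_append successively_Cons)
      then show ?thesis unfolding component_def by blast
    qed
    then show ?thesis using that by (auto simp: walk_def)
  qed
  show ?thesis unfolding conn_def
  proof (intro ballI)
    fix x y assume "x \<in> component E W r" "y \<in> component E W r"
    then obtain xs ys where x: "walk E W xs" "hd xs = r" "last xs = x"
      and y: "walk E W ys" "hd ys = r" "last ys = y" by (auto simp: component_def)
    have "walk E (component E W r) (rev xs)" "last (rev xs) = hd ys"
      using walk_rev[OF *[OF x(1,2)]] x y by (auto simp: walk_def last_rev)
    from walk_join[OF this(1) *[OF y(1,2)] this(2)]
    obtain zs where "walk E (component E W r) zs" "hd zs = hd (rev xs)" "last zs = last ys" .
    then show "\<exists>xs. walk E (component E W r) xs \<and> hd xs = x \<and> last xs = y"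
      using x y by (auto simp: hd_rev)
  qed
qed

lemma conn_Un:
  assumes "conn E K" "conn E L" "x \<in> K" "y \<in> L" "E x y"
  shows "conn E (K \<union> L)"
proof -
  have mono: "walk E (K \<union> L) xs" if "walk E K xs \<or> walk E L xs" for xs
    using that by (auto simp: walk_def)
  have KL: "\<exists>xs. walk E (K \<union> L) xs \<and> hd xs = u \<and> last xs = v" if uv: "u \<in> K" "v \<in> L" for u v
  proof -
    obtain xs where "walk E K xs" "hd xs = u" "last xs = x"
      using assms(1,3) uv unfolding conn_def by blast
    moreover obtain ys where "walk E L ys" "hd ys = y" "last ys = v"
      using assms(2,4) uv unfolding conn_def by blast
    ultimately have "walk E (K \<union> L) (xs @ ys)" "hd (xs @ ys) = u" "last (xs @ ys) = v"
      using mono[of xs] mono[of ys] assms(5) walk_append[of E "K \<union> L" xs ys]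
      by (auto simp: walk_def)
    then show ?thesis by blast
  qed
  have LK: "\<exists>xs. walk E (K \<union> L) xs \<and> hd xs = v \<and> last xs = u" if uv: "u \<in> K" "v \<in> L" for u v
  proof -
    obtain xs where "walk E (K \<union> L) xs" "hd xs = u" "last xs = v" using KL[OF uv] by blast
    then have "walk E (K \<union> L) (rev xs)" "hd (rev xs) = v" "last (rev xs) = u"
      using walk_rev[of "K \<union> L" xs] by (simp_all add: hd_rev last_rev)
    then show ?thesis by blast
  qed
  have KK: "\<exists>xs. walk E (K \<union> L) xs \<and> hd xs = u \<and> last xs = v" if "u \<in> K" "v \<in> K" for u v
    using assms(1) that mono unfolding conn_def by blast
  have LL: "\<exists>xs. walk E (K \<union> L) xs \<and> hd xs = u \<and> last xs = v" if "u \<in> L" "v \<in> L" for u v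
    using assms(2) that mono unfolding conn_def by blast
  show ?thesis unfolding conn_def
  proof (intro ballI)
    fix x y assume "x \<in> K \<union> L" "y \<in> K \<union> L"
    then show "\<exists>xs. walk E (K \<union> L) xs \<and> hd xs = x \<and> last xs = y"
      using KK[of x y] LL[of x y] KL[of x y] LK[of y x] by blast
  qed
qed

lemma conn_ip: 
  assumes "ip E P" shows "conn E (set P)"
  using assms
proof (induction P)
  case Nil
  then show ?case by (simp add: conn_def)
next
  case (Cons x P)
  have s: "conn E {x}" by (auto simp: conn_def walk_def intro!: exI[of _ "[x]"])
  show ?case
  proof (cases P)
    case (Cons y Q)
    then have "conn E ({x} \<union> set P)"
      using Cons.IH Cons.prems s by (intro conn_Un[of _ _ x y]) auto
    then show ?thesis by simp
  qed (use s in simp)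
qed

text \<open>A shortest walk in \<open>K\<close> between the two kinds of vertices: a repetition, a
  chord, or a second vertex with \<open>A\<close> or \<open>B\<close> would give a shortcut.
  Minimality among all walks is part of the conclusion because \<open>ejump\<close> compares paths
  between different pairs of feet.\<close>

lemma geodesic:
  assumes "conn E K" "x \<in> K" "A x" "y \<in> K" "B y"
  obtains P where "ip E P" "P \<noteq> []" "set P \<subseteq> K" "A (hd P)" "B (last P)"
    "\<And>v. v \<in> set P \<Longrightarrow> A v \<Longrightarrow> v = hd P" "\<And>v. v \<in> set P \<Longrightarrow> B v \<Longrightarrow> v = last P"
    "\<And>Q. walk E K Q \<Longrightarrow> A (hd Q) \<Longrightarrow> B (last Q) \<Longrightarrow> length P \<le> length Q"
proof -
  let ?w = "\<lambda>Q. walk E K Q \<and> A (hd Q) \<and> B (last Q)"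
  have "\<exists>Q. ?w Q" using assms unfolding conn_def by metis
  then obtain P where P: "?w P" and min: "\<And>Q. ?w Q \<Longrightarrow> length P \<le> length Q"
    using arg_min_nat_lemma[of ?w _ length] by blast
  have ne: "P \<noteq> []" "set P \<subseteq> K" "successively E P" using P by (auto simp: walk_def)
  have sub: "walk E K (take i P @ drop j P)"
    if "0 < i" "i < length P" "j < length P" "i \<le> j" "E (P ! (i - 1)) (P ! j)" for i j
  proof -
    have "successively E (take i P)" "successively E (drop j P)"
      using ne(3) append_take_drop_id[of i P] append_take_drop_id[of j P]
      by (metis successively_append_iff)+
    moreover have "last (take i P) = P ! (i - 1)" "hd (drop j P) = P ! j"
      using that ne by (auto simp: last_conv_nth hd_drop_conv_nth)
    ultimately show ?thesis using that ne
      by (auto simp: walk_def successively_append_iff dest: in_set_takeD in_set_dropD)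
  qed
  have short: "\<not> E (P ! i) (P ! j)" if "Suc i < j" "j < length P" for i j
  proof
    assume e: "E (P ! i) (P ! j)"
    have "walk E K (take (Suc i) P @ drop j P)" using sub[of "Suc i" j] that e by simp
    moreover have "hd (take (Suc i) P @ drop j P) = hd P" "last (take (Suc i) P @ drop j P) = last P"
      using that ne by (auto simp: hd_append)
    ultimately have "length P \<le> length (take (Suc i) P @ drop j P)" using min P by metis
    then show False using that by simp
  qed
  have adjc: "E (P ! i) (P ! Suc i)" if "Suc i < length P" for i
    using ne(3) that by (auto simp: successively_conv_nth)
  have tk: "?w (take (Suc i) P)" if "B (P ! i)" "i < length P" for i
  proof -
    have "successively E (take (Suc i) P)"
      using ne(3) append_take_drop_id[of "Suc i" P] by (metis successively_append_iff)
    then show ?thesis using that ne P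
      by (auto simp: walk_def last_conv_nth min_def dest: in_set_takeD)
  qed
  have dr: "?w (drop i P)" if "A (P ! i)" "i < length P" for i
  proof -
    have "successively E (drop i P)"
      using ne(3) append_take_drop_id[of i P] by (metis successively_append_iff)
    then show ?thesis using that ne P
      by (auto simp: walk_def hd_drop_conv_nth dest: in_set_dropD)
  qed
  have dis: "distinct P"
  proof (rule ccontr)
    assume "\<not> distinct P"
    then obtain i j where ij: "i < j" "j < length P" "P ! i = P ! j"
      by (metis distinct_conv_nth linorder_neqE_nat)
    \<comment> \<open>The successor of the second occurrence is adjacent to the first one, which is
      a shortcut. If there is no successor, the first occurrence already satisfies \<open>B\<close>,
      and the walk could have stopped there.\<close>
    show False
    proof (cases "Suc j < length P")
      case True
      then have "E (P ! i) (P ! Suc j)" using adjc[of j] ij by simp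
      then show False using short[of i "Suc j"] ij True by simp
    next
      case False
      then have "B (P ! i)" using P ij ne by (metis Suc_lessI diff_Suc_1 last_conv_nth)
      then show False using min[OF tk[of i]] ij by simp
    qed
  qed
  have "ip E P"
    using dis adjc short by (auto simp: ip_nth[OF sym]) (metis Suc_lessI)
  moreover have "v = hd P" if v: "v \<in> set P" "A v" for v
  proof -
    obtain i where i: "i < length P" "v = P ! i" using v(1) by (metis in_set_conv_nth)
    then have "length P \<le> length P - i" using min[OF dr[of i]] v by simp
    then show ?thesis using i ne by (cases i) (auto simp: hd_conv_nth)
  qed
  moreover have "v = last P" if v: "v \<in> set P" "B v" for v
  proof -
    obtain i where i: "i < length P" "v = P ! i" using v(1) by (metis in_set_conv_nth)
    then have "length P \<le> Suc i" using min[OF tk[of i]] v by simp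
    then have "i = length P - 1" using i by simp
    then show ?thesis using i ne by (simp add: last_conv_nth)
  qed
  ultimately show thesis using that[of P] P ne min by blast
qed

text \<open>Here both paths run between the same two joints, as an ear and its completion do;
  \<open>hole_length\<close> traverses the cycle in one direction, so \<open>R\<close> is
  reversed.\<close>

lemma okn_hole:
  assumes "ip E P" "ip E R" "P \<noteq> []" "R \<noteq> []" "3 \<le> length P + length R" "set P \<inter> set R = {}"
    and "E (hd P) (hd R)" "E (last P) (last R)"
    and "\<And>x y. x \<in> set P \<Longrightarrow> y \<in> set R \<Longrightarrow> E x y \<Longrightarrow> x = hd P \<and> y = hd R \<or> x = last P \<and> y = last R"
  shows "okn (length P + length R)"
proof -
  have "E x y \<longleftrightarrow> x = last P \<and> y = hd (rev R) \<or> x = hd P \<and> y = last (rev R)"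
    if "x \<in> set P" "y \<in> set (rev R)" for x y
    using assms(7-9) that by (auto simp: hd_rev last_rev)
  from hole_length[OF assms(1) ip_rev[OF sym assms(2)] _ _ _ _ this]
  show ?thesis using assms by (simp add: okn_def)
qed

lemma ear_okn:
  assumes e: "emb E n T f" "ear E n f P F i j" and R: "ip T R" "R \<noteq> []" "set R \<subseteq> {..<n}"
    "hd R = i" "last R = j" "set R \<inter> (F - {i, j}) = {}" and "3 \<le> length P + length R"
    and FF: "\<And>v. v \<in> set P \<Longrightarrow> i \<in> F \<Longrightarrow> E v (f i) \<Longrightarrow> v = hd P"
      "\<And>v. v \<in> set P \<Longrightarrow> j \<in> F \<Longrightarrow> E v (f j) \<Longrightarrow> v = last P"
  shows "okn (length P + length R)"
proof -
  have inj: "inj_on f {..<n}" and T: "\<And>i j. i < n \<Longrightarrow> j < n \<Longrightarrow> E (f i) (f j) \<longleftrightarrow> T i j"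
    using e by (auto simp: emb_def)
  have m: "ip E (map f R)"
  proof (rule ip_map[OF R(1) inj_on_subset[OF inj R(3)]])
    show "E (f a) (f b) \<longleftrightarrow> T a b" if "a \<in> set R" "b \<in> set R" for a b
      using T that R(3) by blast
  qed
  have h: "hd (map f R) = f i" "last (map f R) = f j"
    using R by (auto simp: hd_map last_map)
  have "okn (length P + length (map f R))"
  proof (rule okn_hole[OF _ m])
    show "x = hd P \<and> y = hd (map f R) \<or> x = last P \<and> y = last (map f R)"
      if xy: "x \<in> set P" "y \<in> set (map f R)" "E x y" for x y
    proof -
      obtain l where l: "l \<in> set R" "y = f l" using xy(2) by auto
      then have "l \<in> F \<or> x = hd P \<and> l = i \<or> x = last P \<and> l = j"
        using e(2) xy R(3) unfolding ear_def by blast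
      then show ?thesis using l h FF[OF xy(1)] xy(3) R(6) by auto
    qed
  qed (use e(2) R h assms(9) in \<open>auto simp: ear_def\<close>)
  then show ?thesis by simp
qed

end

section \<open>Symmetries and extensions of a configuration\<close>

lemma ear_perm:
  assumes "ear E n f P F i j" "set is = {..<n}" "length is = n" "is ! a = i" "is ! b = j" "a < n" "b < n"
    and "\<And>l. l < n \<Longrightarrow> is ! l \<in> F \<Longrightarrow> l \<in> F'" "distinct is"
  shows "ear E n (\<lambda>i. f (is ! i)) P F' a b"
proof -
  have *: "is ! l < n" if "l < n" for l using assms(2,3) that nth_mem by blast
  have "(\<lambda>i. f (is ! i)) ` {..<n} \<subseteq> f ` {..<n}" using * by auto
  moreover have "l \<in> F' \<or> v = hd P \<and> l = a \<or> v = last P \<and> l = b"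
    if "v \<in> set P" "l < n" "E v (f (is ! l))" for v l
  proof -
    have "is ! l \<in> F \<or> v = hd P \<and> is ! l = i \<or> v = last P \<and> is ! l = j"
      using assms(1) that *[of l] unfolding ear_def by blast
    then show ?thesis using assms that by (auto simp: nth_eq_iff_index_eq)
  qed
  moreover have "ip E P" "P \<noteq> []" "set P \<inter> f ` {..<n} = {}" "E (hd P) (f i)" "E (last P) (f j)"
    using assms(1) unfolding ear_def by blast+
  moreover from calculation have "set P \<inter> (\<lambda>i. f (is ! i)) ` {..<n} = {}" by blast
  ultimately show ?thesis using assms(4-7) unfolding ear_def by (intro conjI ballI allI impI) auto
qed

text \<open>Adjacency of the configuration \<open>es\<close> on \<open>{..<n}\<close> with an ear on the vertices \<open>n, \<dots>, n + k - 1\<close>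
  from \<open>z\<close> to \<open>t\<close>.\<close>
definition ext_adj :: "nat \<Rightarrow> nat \<Rightarrow> nat \<Rightarrow> nat \<Rightarrow> (nat \<times> nat) list \<Rightarrow> nat \<Rightarrow> nat \<Rightarrow> bool" where
  "ext_adj n k z t es i j \<longleftrightarrow>
    (if i < n then if j < n then adj es i j else j = n \<and> i = z \<or> Suc j = n + k \<and> i = t
     else if j < n then i = n \<and> j = z \<or> Suc i = n + k \<and> j = t else j = Suc i \<or> i = Suc j)"

definition ext_check where
  "ext_check n k z t es es' \<longleftrightarrow>
     (\<forall>i \<in> set [0..<n + k]. \<forall>j \<in> set [0..<n + k]. adj es' i j \<longleftrightarrow> ext_adj n k z t es i j)"

text \<open>The dihedral symmetries of the heptagon, as lists of the images of \<open>0, \<dots>, 6\<close>.\<close>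
definition dih :: "nat list list" where
  "dih = map (\<lambda>r. rotate r [0,1,2,3,4,5,6]) [0..<7] @ map (\<lambda>r. rev (rotate r [0,1,2,3,4,5,6])) [0..<7]"

definition near :: "nat \<Rightarrow> nat \<Rightarrow> nat \<Rightarrow> bool" where
  "near d i j \<longleftrightarrow> i < 7 \<and> j < 7 \<and> (j = (i + d) mod 7 \<or> i = (j + d) mod 7)"

text \<open>\<open>near d\<close> is cyclic distance \<open>d\<close>. The dihedral group is
  transitive on the ordered pairs at distance 3 and on those at distance 2, so every ear in question
  can be moved to the feet 0, 3 or 0, 2.\<close>

lemma dih_check:
  "\<forall>is \<in> set dih. length is = 7 \<and> distinct is \<and> set is = set [0..<7] \<and>
    (\<forall>i \<in> set [0..<7]. \<forall>j \<in> set [0..<7]. adj E7 (is ! i) (is ! j) = adj E7 i j)"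
  "\<forall>i \<in> set [0..<7]. \<forall>j \<in> set [0..<7]. near 3 i j \<longrightarrow> (\<exists>is \<in> set dih. is ! 0 = i \<and> is ! 3 = j)"
  "\<forall>i \<in> set [0..<7]. \<forall>j \<in> set [0..<7]. near 2 i j \<longrightarrow> (\<exists>is \<in> set dih. is ! 0 = i \<and> is ! 2 = j)"
  by code_simp+

lemma dih_image:
  assumes "is \<in> set dih" shows "(\<lambda>i. f (is ! i)) ` {..<7} = f ` {..<7}"
proof -
  have "length is = 7" "set is = set [0..<7]" using dih_check(1) assms by blast+
  then have "(!) is ` {..<7} = {..<7}" using nth_image[of 7 "is"] by (simp add: atLeast0LessThan)
  then show ?thesis by (metis image_image)
qed

lemma ext_344: "ext_check 7 3 0 3 E7 E344" by code_simp
lemma ext_255: "ext_check 7 4 0 2 E7 E255" by code_simp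
lemma ext_12: "ext_check 10 2 5 8 E344 E12" by code_simp
lemma ext_12b: "ext_check 10 2 4 7 E344 E12b" by code_simp

definition unique_att :: "('a \<Rightarrow> 'a \<Rightarrow> bool) \<Rightarrow> nat \<Rightarrow> (nat \<Rightarrow> 'a) \<Rightarrow> bool" where
  "unique_att E n f \<longleftrightarrow> (\<forall>v i j. v \<notin> f ` {..<n} \<longrightarrow> i < n \<longrightarrow> j < n \<longrightarrow> E v (f i) \<longrightarrow> E v (f j) \<longrightarrow> i = j)"

lemma unique_attD:
  "unique_att E n f \<Longrightarrow> v \<notin> f ` {..<n} \<Longrightarrow> i < n \<Longrightarrow> j < n \<Longrightarrow> E v (f i) \<Longrightarrow> E v (f j) \<Longrightarrow> i = j"
  by (auto simp: unique_att_def)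

definition wf_es :: "(nat \<times> nat) list \<Rightarrow> nat \<Rightarrow> bool" where
  "wf_es es n \<longleftrightarrow> (\<forall>(x, y) \<in> set es. x < n \<and> y < n \<and> x \<noteq> y)"

lemma wf_irr: "wf_es es n \<Longrightarrow> \<not> adj es i i"
  by (auto simp: wf_es_def adj_def)

lemma wf_E: "wf_es E7 7" "wf_es E344 10" "wf_es E255 11" "wf_es E12 12" "wf_es E12b 12"
  by code_simp+

lemma paths_bdd:
  assumes "wf_es es n" "R \<in> set (paths k es B u t)" "u < n"
  shows "set R \<subseteq> {..<n}"
  using assms(2,3)
proof (induction k arbitrary: B u R)
  case (Suc k)
  show ?case
  proof (cases "u = t")
    case False
    then obtain v Q where v: "adj es u v" and R: "R = u # Q"
      and Q: "Q \<in> set (paths k es (u # nbs es u @ B) v t)"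
      using Suc.prems by (auto simp: set_nbs)
    have "v < n" using v assms(1) by (auto simp: adj_def wf_es_def)
    then show ?thesis using Suc.IH[OF Q] Suc.prems R by auto
  qed (use Suc.prems in auto)
qed simp

context heptag
begin

abbreviation hep :: "(nat \<Rightarrow> 'a) \<Rightarrow> bool" where
  "hep f \<equiv> emb E 7 (adj E7) f"

definition jump3 where "jump3 \<longleftrightarrow> (\<exists>f P. hep f \<and> ear E 7 f P {} 0 3)"
definition jump2 where "jump2 \<longleftrightarrow> (\<exists>f P. hep f \<and> ear E 7 f P {} 0 2)"

lemma hep_dih:
  assumes "hep f" "is \<in> set dih"
  shows "hep (\<lambda>i. f (is ! i))"
proof -
  have *: "length is = 7" "distinct is" "set is = set [0..<7]"
    "\<forall>i \<in> set [0..<7]. \<forall>j \<in> set [0..<7]. adj E7 (is ! i) (is ! j) = adj E7 i j"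
    using dih_check(1) assms(2) by blast+
  show ?thesis
    using emb_sub[OF assms(1) *(2), of "adj E7"] * by (auto simp: atLeast0LessThan)
qed

lemma ear_dih:
  assumes "ear E 7 f P F i j" "is \<in> set dih" "is ! a = i" "is ! b = j" "a < 7" "b < 7"
    "\<And>l. l < 7 \<Longrightarrow> is ! l \<in> F \<Longrightarrow> l \<in> F'"
  shows "ear E 7 (\<lambda>i. f (is ! i)) P F' a b"
proof -
  have *: "length is = 7" "distinct is" "set is = set [0..<7]"
    using dih_check(1) assms(2) by blast+
  show ?thesis using ear_perm[OF assms(1), of "is" a b F'] * assms by (auto simp: atLeast0LessThan)
qed

lemma jump3I:
  assumes "hep f" "ear E 7 f P {} i j" "near 3 i j"
  shows jump3
proof -
  have "i \<in> set [0..<7]" "j \<in> set [0..<7]" using assms(3) by (auto simp: near_def)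
  then obtain "is" where "is \<in> set dih" "is ! 0 = i" "is ! 3 = j"
    using dih_check(2) assms(3) by blast
  then have "hep (\<lambda>i. f (is ! i))" "ear E 7 (\<lambda>i. f (is ! i)) P {} 0 3"
    using hep_dih ear_dih[OF assms(2), of "is" 0 3 "{}"] assms(1) by auto
  then show ?thesis unfolding jump3_def by blast
qed

lemma jump2I:
  assumes "hep f" "ear E 7 f P {} i j" "near 2 i j"
  shows jump2
proof -
  have "i \<in> set [0..<7]" "j \<in> set [0..<7]" using assms(3) by (auto simp: near_def)
  then obtain "is" where "is \<in> set dih" "is ! 0 = i" "is ! 2 = j"
    using dih_check(3) assms(3) by blast
  then have "hep (\<lambda>i. f (is ! i))" "ear E 7 (\<lambda>i. f (is ! i)) P {} 0 2"
    using hep_dih ear_dih[OF assms(2), of "is" 0 2 "{}"] assms(1) by auto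
  then show ?thesis unfolding jump2_def by blast
qed

lemma ear_hole:
  assumes "emb E n T f" "ear E n f P F i j" "ip T R" "R \<noteq> []" "set R \<subseteq> {..<n}"
    "hd R = i" "last R = j" "set R \<inter> F = {}" "3 \<le> length P + length R"
  shows "okn (length P + length R)"
proof (rule ear_okn[OF assms(1-7) _ assms(9)])
  have "i \<notin> F" "j \<notin> F" using assms(4,6-8) hd_in_set last_in_set by blast+
  then show "i \<in> F \<Longrightarrow> E v (f i) \<Longrightarrow> v = hd P" "j \<in> F \<Longrightarrow> E v (f j) \<Longrightarrow> v = last P" for v by auto
qed (use assms in auto)

text \<open>Purity is what keeps the enlarged configuration induced: the new adjacencies are those
  along the ear and the two at its feet, which is what \<open>ext_adj\<close> prescribes.\<close>

lemma emb_ear: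
  assumes "emb E n (adj es) f" "ear E n f P {} z t" "ext_check n (length P) z t es es'"
  shows "emb E (n + length P) (adj es') (\<lambda>i. if i < n then f i else P ! (i - n))"
proof -
  let ?k = "length P" and ?g = "\<lambda>i. if i < n then f i else P ! (i - n)"
  have inj: "inj_on f {..<n}" and T: "\<And>i j. i < n \<Longrightarrow> j < n \<Longrightarrow> E (f i) (f j) \<longleftrightarrow> adj es i j"
    using assms(1) by (auto simp: emb_def)
  have P: "ip E P" "P \<noteq> []" "set P \<inter> f ` {..<n} = {}" and zt: "z < n" "t < n"
    "E (hd P) (f z)" "E (last P) (f t)" and
    att: "\<And>v l. v \<in> set P \<Longrightarrow> l < n \<Longrightarrow> E v (f l) \<Longrightarrow> v = hd P \<and> l = z \<or> v = last P \<and> l = t"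
    using assms(2) unfolding ear_def by blast+
  have d: "distinct P" using P ip_distinct by blast
  have k0: "0 < ?k" using P by simp
  have hl: "hd P = P ! 0" "last P = P ! (?k - 1)" using P by (auto simp: hd_conv_nth last_conv_nth)
  have PF: "E (P ! i) (f l) \<longleftrightarrow> i = 0 \<and> l = z \<or> Suc i = ?k \<and> l = t" if "i < ?k" "l < n" for i l
  proof -
    have "E (P ! i) (f l) \<longleftrightarrow> P ! i = P ! 0 \<and> l = z \<or> P ! i = P ! (?k - 1) \<and> l = t"
      using zt(3,4) att[of "P ! i" l] that hl by auto
    then show ?thesis using that d k0 by (auto simp: nth_eq_iff_index_eq simp del: length_greater_0_conv)
  qed
  have fP: "f i \<noteq> P ! j" if "i < n" "j < ?k" for i j
    using P(3) that by (metis IntI empty_iff image_eqI lessThan_iff nth_mem)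
  have "inj_on ?g {..<n + ?k}"
  proof (rule inj_onI)
    fix x y assume a: "x \<in> {..<n + ?k}" "y \<in> {..<n + ?k}" "?g x = ?g y"
    consider "x < n" "y < n" | "x < n" "n \<le> y" | "n \<le> x" "y < n" | "n \<le> x" "n \<le> y" by linarith
    then show "x = y"
    proof cases
      case 1 then show ?thesis using a inj by (auto dest: inj_onD)
    next
      case 2
      then have "y - n < ?k" using a by auto
      then show ?thesis using a 2 fP[of x "y - n"] by auto
    next
      case 3
      then have "x - n < ?k" using a by auto
      then show ?thesis using a 3 fP[of y "x - n"] by auto
    next
      case 4 then show ?thesis using a d by (auto simp: nth_eq_iff_index_eq)
    qed
  qed
  moreover have "E (?g i) (?g j) \<longleftrightarrow> adj es' i j" if "i < n + ?k" "j < n + ?k" for i j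
  proof -
    have "adj es' i j \<longleftrightarrow> ext_adj n ?k z t es i j" using assms(3) that by (auto simp: ext_check_def)
    moreover have "E (?g i) (?g j) \<longleftrightarrow> ext_adj n ?k z t es i j"
    proof -
      consider "i < n" "j < n" | "i < n" "n \<le> j" | "n \<le> i" "j < n" | "n \<le> i" "n \<le> j" by linarith
      then show ?thesis
      proof cases
        case 1 then show ?thesis using T by (simp add: ext_adj_def)
      next
        case 2
        have "E (f i) (P ! (j - n)) \<longleftrightarrow> E (P ! (j - n)) (f i)" using sym by blast
        then show ?thesis using 2 that PF[of "j - n" i] by (auto simp: ext_adj_def)
      next
        case 3 then show ?thesis using that PF[of "i - n" j] by (auto simp: ext_adj_def)
      next
        case 4 then show ?thesis using that ip_adj[OF P(1), of "i - n" "j - n"] by (auto simp: ext_adj_def)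
      qed
    qed
    ultimately show ?thesis by blast
  qed
  ultimately show ?thesis by (auto simp: emb_def)
qed

lemma diam4_unique_att:
  assumes e: "emb E n (adj es) f" and d: "diam4 es n" and w: "wf_es es n"
  shows "unique_att E n f"
  unfolding unique_att_def
proof (intro allI impI, rule ccontr)
  fix v i j
  assume v: "v \<notin> f ` {..<n}" "i < n" "j < n" "E v (f i)" "E v (f j)" and "i \<noteq> j"
  then obtain R where R: "R \<in> set (paths 5 es [] i j)"
    using d v by (fastforce simp: diam4_def)
  have *: "ip (adj es) R" "R \<noteq> []" "hd R = i" "last R = j" using paths_sound[OF wf_irr[OF w] R] by auto
  have rng: "set R \<subseteq> {..<n}" using paths_bdd[OF w R] v by blast
  have l: "length R \<le> 5" using paths_length[OF R] .
  have inj: "inj_on f (set R)" using e rng by (auto simp: emb_def intro: inj_on_subset)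
  have m: "ip E (map f R)"
    by (rule ip_map[OF *(1) inj]) (use e rng in \<open>auto simp: emb_def\<close>)
  have "length R \<noteq> 1"
    using * \<open>i \<noteq> j\<close> by (cases R) auto
  then have "2 \<le> length R" using *(2) by (cases R) (auto simp: Suc_le_eq)
  moreover have "v \<notin> set (map f R)" using v(1) rng by auto
  ultimately have "7 \<le> length (v # map f R)"
    using m * v ip_successively[OF m] ip_distinct[OF m] sym
    by (intro girth) (auto simp: successively_Cons hd_map last_map)
  then show False using l by simp
qed

text \<open>After the last contact with \<open>ns\<close>, at position \<open>m\<close>, the path is
  a pure ear. If its own completions do not exclude it, one steps back to the last contact
  \<open>l\<close> with a vertex of \<open>ns\<close> other than \<open>z\<close>. Behind
  \<open>l\<close> only \<open>z\<close> is met within \<open>ns\<close>, so completions that avoid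
  \<open>z\<close> still give holes.\<close>

lemma exit_seg:
  assumes e: "emb E n (adj es) f" and w: "wf_es es n" and c: "exit_check es n b ns A"
    and uqa: "unique_att E n f"
    and ns: "b \<in> set ns" "set ns \<subseteq> {..<n}"
    and P: "ip E P" "P \<noteq> []" "set P \<inter> f ` {..<n} = {}" "E (hd P) (f b)"
    and t: "t < n" "t \<notin> set ns" "E (last P) (f t)"
    and B1: "\<And>v t. v \<in> set P \<Longrightarrow> t < n \<Longrightarrow> t \<notin> set ns \<Longrightarrow> E v (f t) \<Longrightarrow> v = last P"
  obtains m z where "(z, t) \<in> set A" "ear E n f (drop m P) {} z t" "z \<in> set ns"
proof -
  note uq = unique_attD[OF uqa]
  let ?k = "length P"
  have inj: "inj_on f {..<n}" and T: "\<And>i j. i < n \<Longrightarrow> j < n \<Longrightarrow> E (f i) (f j) \<longleftrightarrow> adj es i j"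
    using e by (auto simp: emb_def)
  have k0: "0 < ?k" using P by simp
  have hl: "hd P = P ! 0" "last P = P ! (?k - 1)" using P by (auto simp: hd_conv_nth last_conv_nth)
  have out: "P ! i \<notin> f ` {..<n}" if "i < ?k" for i using that P(3) nth_mem by blast
  have dropip: "ip E (drop i P)" for i using ip_drop[OF P(1)] .
  let ?N = "\<lambda>i. i < ?k \<and> (\<exists>z \<in> set ns. E (P ! i) (f z))"
  define m where "m = (GREATEST i. ?N i)"
  have N0: "?N 0" using P(4) ns hl k0 by auto
  have m: "?N m" unfolding m_def by (rule GreatestI_nat[of ?N 0 ?k]) (use N0 in auto)
  have mx: "i \<le> m" if "?N i" for i unfolding m_def by (rule Greatest_le_nat[of ?N _ ?k]) (use that in auto)
  obtain z where z: "z \<in> set ns" "E (P ! m) (f z)" using m by blast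
  have zn: "z < n" using z ns by auto
  \<comment> \<open>The last vertex is attached to \<open>t\<close>, which is outside
    \<open>ns\<close>, and attachments are unique.\<close>
  have "m \<noteq> ?k - 1"
    using uq[OF out[of m], of z t] z zn t hl m by auto
  then have mk: "Suc m < ?k" using m by auto
  have earI: "ear E n f (drop l P) F u t"
    if l: "l \<le> m" "E (P ! l) (f u)" "u \<in> set ns"
      and F: "\<And>i s. l < i \<Longrightarrow> i < ?k \<Longrightarrow> s \<in> set ns \<Longrightarrow> E (P ! i) (f s) \<Longrightarrow> s \<in> F" for l F u
  proof -
    have "s \<in> F \<or> v = hd (drop l P) \<and> s = u \<or> v = last (drop l P) \<and> s = t"
      if v: "v \<in> set (drop l P)" "s < n" "E v (f s)" for v s
    proof -
      obtain i where i: "l \<le> i" "i < ?k" "v = P ! i"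
        using v(1) by (auto simp: in_set_conv_nth) (metis add.commute le_add1 less_diff_conv)
      show ?thesis
      proof (cases "s \<in> set ns")
        case True
        show ?thesis
        proof (cases "i = l")
          case True
          then have "s = u" using uq[OF out[of l], of s u] v i l ns by auto
          then show ?thesis using True i l mk by (auto simp: hd_drop_conv_nth)
        next
          case False
          then show ?thesis using F[of i s] i v True by auto
        qed
      next
        case False
        then have "v = last P" using B1[of v s] v in_set_dropD by metis
        moreover have "s = t" using uq[of v s t] v t out[of i] i calculation by auto
        ultimately show ?thesis using l mk by auto
      qed
    qed
    moreover have "set (drop l P) \<inter> f ` {..<n} = {}" using P(3) set_drop_subset[of l P] by blast
    moreover have "E (hd (drop l P)) (f u)" using l mk by (simp add: hd_drop_conv_nth)
    moreover have "E (last (drop l P)) (f t)" using l mk t by simp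
    moreover have "drop l P \<noteq> []" "u < n" using l mk ns by auto
    ultimately show ?thesis
      unfolding ear_def using dropip t(1) by blast
  qed
  have Q: "ear E n f (drop m P) {} z t"
  proof (rule earI[OF order_refl z(2,1)])
    show "s \<in> {}" if "m < i" "i < ?k" "s \<in> set ns" "E (P ! i) (f s)" for i s
      using mx[of i] that by auto
  qed
  have nb1: "\<not> bad 2 (paths n es [] z t)"
  proof
    assume "bad 2 (paths n es [] z t)"
    from badD[OF this, of "length (drop m P)"] obtain R where
      R: "R \<in> set (paths n es [] z t)" "\<not> okn (length (drop m P) + length R)"
      using mk paths_sound[OF wf_irr[OF w]] by fastforce
    have "ip (adj es) R \<and> R \<noteq> [] \<and> hd R = z \<and> last R = t" "set R \<subseteq> {..<n}"
      using paths_sound[OF wf_irr[OF w] R(1)] paths_bdd[OF w R(1) zn] by blast+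
    moreover have "3 \<le> length (drop m P) + length R" using calculation mk by (cases R) auto
    ultimately have "okn (length (drop m P) + length R)"
      by (intro ear_hole[OF e Q]) auto
    then show False using R by simp
  qed
  have nb2: "(z, t) \<in> set A" if zb: "z \<noteq> b" and bd: "\<And>u. u \<in> set ns \<Longrightarrow> u \<noteq> z \<Longrightarrow> bad 5 (paths n es [z] u t)"
  proof -
    let ?M = "\<lambda>i. i < ?k \<and> (\<exists>u \<in> set ns. u \<noteq> z \<and> E (P ! i) (f u))"
    define l where "l = (GREATEST i. ?M i)"
    have M0: "?M 0" using P(4) ns hl k0 zb by auto
    have l: "?M l" unfolding l_def by (rule GreatestI_nat[of ?M 0 ?k]) (use M0 in auto)
    have lx: "i \<le> l" if "?M i" for i unfolding l_def by (rule Greatest_le_nat[of ?M _ ?k]) (use that in auto)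
    obtain u where u: "u \<in> set ns" "u \<noteq> z" "E (P ! l) (f u)" using l by blast
    have un: "u < n" using u ns by auto
    have "l \<noteq> m" using uq[OF out[of m], of u z] u un z zn m by auto
    moreover have "l \<le> m" using mx[of l] l by auto
    ultimately have lm: "l < m" by simp
    have Q': "ear E n f (drop l P) {z} u t"
    proof (rule earI[OF _ u(3,1)])
      show "s \<in> {z}" if "l < i" "i < ?k" "s \<in> set ns" "E (P ! i) (f s)" for i s
        using lx[of i] that by auto
    qed (use lm in simp)
    let ?S = "take (Suc (m - l)) (drop l P)"
    have S: "ip E ?S" "hd ?S = P ! l" "last ?S = P ! m" "?S \<noteq> []" "length ?S = Suc (m - l)"
      using ip_take[OF dropip] lm mk by (auto simp: hd_drop_conv_nth last_conv_nth min_def)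
    have Sout: "set ?S \<inter> f ` {..<n} = {}"
      using P(3) set_drop_subset[of l P] set_take_subset[of "Suc (m - l)" "drop l P"] by blast
    \<comment> \<open>The piece between the contacts with \<open>u\<close> and \<open>z\<close>
      closes up through at most three vertices of the configuration, so it has at least four
      vertices. At least one more follows on the way to \<open>t\<close>; this is the bound 5 in
      \<open>exit_check\<close>.\<close>
    have cyc: "7 \<le> length (?S @ map f ls)" if "ls = [z, u] \<or> ls = [z, b, u]" "adj es z (ls ! 1)"
      "adj es (ls ! (length ls - 2)) u" "distinct ls" "set ls \<subseteq> {..<n}" for ls
    proof (rule girth)
      show "distinct (?S @ map f ls)"
        using ip_distinct[OF S(1)] that(4,5) Sout inj by (auto simp: distinct_map inj_on_subset)
      show "successively E (?S @ map f ls)"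
        using ip_successively[OF S(1)] that S z T ns zn un by (auto simp: successively_append_iff)
      show "E (last (?S @ map f ls)) (hd (?S @ map f ls))"
        using that S u sym by auto
    qed (use that S in auto)
    have "adj es u z \<or> adj es u b \<and> adj es b z"
      using c u z unfolding exit_check_def by blast
    then have "7 \<le> Suc (m - l) + 3"
    proof
      assume "adj es u z"
      then show ?thesis using cyc[of "[z, u]"] S u zn un by (auto simp: adj_def)
    next
      assume a: "adj es u b \<and> adj es b z"
      then have "u \<noteq> b" using wf_irr[OF w] by auto
      then show ?thesis using a cyc[of "[z, b, u]"] S u zb zn un ns by (auto simp: adj_def)
    qed
    then have len: "5 \<le> length (drop l P)" using lm mk by simp
    from badD[OF bd[OF u(1,2)] _ len] obtain R where
      R: "R \<in> set (paths n es [z] u t)" "\<not> okn (length (drop l P) + length R)"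
      using paths_sound[OF wf_irr[OF w]] by fastforce
    have R': "ip (adj es) R" "R \<noteq> []" "hd R = u" "last R = t" "set (tl R) \<inter> {z} = {}" "set R \<subseteq> {..<n}"
      using paths_sound[OF wf_irr[OF w] R(1)] paths_bdd[OF w R(1) un] by auto
    then have "set R \<inter> {z} = {}" using u(2) by (cases R) auto
    then have "okn (length (drop l P) + length R)"
      using len R' by (intro ear_hole[OF e Q']) auto
    then show ?thesis using R by simp
  qed
  have "(z, t) \<in> set A"
  proof -
    have "t \<in> set [0..<n]" using t by simp
    then have "t \<in> set ns \<or> (z, t) \<in> set A \<or> bad 2 (paths n es [] z t) \<or>
      z \<noteq> b \<and> (\<forall>u \<in> set ns. u \<noteq> z \<longrightarrow> bad 5 (paths n es [z] u t))"
      using c z(1) unfolding exit_check_def by blast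
    then show ?thesis using t(2) nb1 nb2 by blast
  qed
  then show thesis using that[OF _ Q z(1)] by blast
qed

text \<open>Localises the exit on a prescribed path: the segment from the contact with
  \<open>b\<close> at position \<open>i\<close> to the first later contact outside \<open>ns\<close>
  satisfies \<open>exit_seg\<close>. This makes it possible to trace the order of contacts along one
  path.\<close>

lemma exit_from:
  assumes e: "emb E n (adj es) f" and w: "wf_es es n" and c: "exit_check es n b ns A"
    and uqa: "unique_att E n f"
    and ns: "b \<in> set ns" "set ns \<subseteq> {..<n}"
    and P: "ip E P" "set P \<inter> f ` {..<n} = {}"
    and ij: "i < j" "j < length P" "E (P ! i) (f b)" "E (P ! j) (f t)" "t < n" "t \<notin> set ns"
  obtains j' z t' Q where "i < j'" "j' \<le> j" "E (P ! j') (f t')" "t' < n" "t' \<notin> set ns"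
    "(z, t') \<in> set A" "ear E n f Q {} z t'" "z \<in> set ns" "set Q \<subseteq> set P"
proof -
  note uq = unique_attD[OF uqa]
  have out: "P ! i \<notin> f ` {..<n}" if "i < length P" for i using that P(2) nth_mem by blast
  let ?J = "\<lambda>j'. i < j' \<and> (\<exists>t<n. t \<notin> set ns \<and> E (P ! j') (f t))"
  define j' where "j' = (LEAST j'. ?J j')"
  have Jj: "?J j" using ij by blast
  have j': "?J j'" "j' \<le> j" unfolding j'_def by (rule LeastI[of ?J j, OF Jj], rule Least_le[of ?J j, OF Jj])
  have jl: "j' \<le> l" if "?J l" for l unfolding j'_def using that by (rule Least_le)
  obtain t' where t': "t' < n" "t' \<notin> set ns" "E (P ! j') (f t')" using j' by blast
  have bn: "b < n" using ns by auto
  have j'k: "j' < length P" using j'(2) ij by simp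
  have ij': "i \<le> j'" using j' by simp
  define Q where "Q = seg i j' P"
  note Qs = seg[OF ij' j'k, folded Q_def]
  have ne: "Q \<noteq> []" using Qs(1) by auto
  have sQ: "set Q \<subseteq> set P" using Qs(4) j'k by auto
  have ipQ: "ip E Q" unfolding Q_def by (rule ip_seg[OF P(1)])
  obtain m z where mz: "(z, t') \<in> set A" "ear E n f (drop m Q) {} z t'" "z \<in> set ns"
  proof (rule exit_seg[OF e w c uqa ns ipQ ne _ _ t'(1,2)])
    show "set Q \<inter> f ` {..<n} = {}" using sQ P(2) by blast
    show "E (hd Q) (f b)" "E (last Q) (f t')" using Qs(2,3) ij t' by auto
    show "v = last Q" if v: "v \<in> set Q" "s < n" "s \<notin> set ns" "E v (f s)" for v s
    proof -
      obtain l where l: "i \<le> l" "l \<le> j'" "v = P ! l" using v(1) Qs(4) by auto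
      have "l \<noteq> i" using uq[of v s b] out[of l] j'k v l bn ns ij(3) by auto
      then show ?thesis using jl[of l] l v Qs(3) by auto
    qed
  qed (rule that)
  have "set (drop m Q) \<subseteq> set P" using sQ set_drop_subset by fast
  then show thesis using that[OF _ j'(2) t'(3,1,2) mz(1,2,3)] j'(1) by blast
qed

lemma exit_path:
  assumes e: "emb E n (adj es) f" and w: "wf_es es n" and c: "exit_check es n b ns A"
    and uqa: "unique_att E n f"
    and K: "conn E K" "K \<inter> f ` {..<n} = {}" and ns: "b \<in> set ns" "set ns \<subseteq> {..<n}"
    and r: "r \<in> K" "E r (f b)" and x: "x \<in> K" "E x (f t0)" "t0 < n" "t0 \<notin> set ns"
  obtains P z t where "(z, t) \<in> set A" "set P \<subseteq> K" "ear E n f P {} z t" "t < n" "t \<notin> set ns" "z \<in> set ns"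
proof -
  let ?B = "\<lambda>v. \<exists>t<n. t \<notin> set ns \<and> E v (f t)"
  obtain P where P: "ip E P" "P \<noteq> []" "set P \<subseteq> K" "E (hd P) (f b)" "?B (last P)"
    and B1: "\<And>v. v \<in> set P \<Longrightarrow> ?B v \<Longrightarrow> v = last P"
  proof (rule geodesic[OF K(1), of r "\<lambda>v. E v (f b)" x ?B, OF r x(1)])
    show "?B x" using x by blast
  qed (rule that)
  obtain t where t: "t < n" "t \<notin> set ns" "E (last P) (f t)" using P(5) by blast
  obtain m z where "(z, t) \<in> set A" "ear E n f (drop m P) {} z t" "z \<in> set ns"
  proof (rule exit_seg[OF e w c uqa ns P(1,2) _ P(4) t])
    show "set P \<inter> f ` {..<n} = {}" using K(2) P(3) by blast
    show "v = last P" if "v \<in> set P" "s < n" "s \<notin> set ns" "E v (f s)" for v s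
      using B1[of v] that by blast
  qed (rule that)
  moreover have "set (drop m P) \<subseteq> K" using P(3) set_drop_subset[of m P] by blast
  ultimately show thesis using that[of z t "drop m P"] t by blast
qed

end

subsection \<open>Graphs without the two kinds of cutsets\<close>

text \<open>An ear all of whose completions by the paths \<open>Rs\<close> are admissible holes has exactly \<open>N\<close> vertices;
  for \<open>m \<ge> 8\<close> admissibility depends on the parity of \<open>m\<close> only.\<close>
definition only :: "nat \<Rightarrow> nat list list \<Rightarrow> bool" where
  "only N Rs \<longleftrightarrow> N < 8 \<and> (\<forall>m \<in> set [1..<10]. m = N \<or> (\<exists>R \<in> set Rs. \<not> okn (m + length R)))"

lemma onlyD:
  assumes "only N Rs" "1 \<le> m" "\<And>R. R \<in> set Rs \<Longrightarrow> R \<noteq> [] \<and> okn (m + length R)"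
  shows "m = N"
proof (rule ccontr)
  assume "m \<noteq> N"
  \<comment> \<open>8 and 9 represent the two parities of all lengths beyond the table; they differ
    from \<open>N\<close>, which is less than 8.\<close>
  define m' where "m' = (if m < 10 then m else if even m then 8 else 9)"
  have m': "m' \<in> set [1..<10]" "m' \<noteq> N" using assms(1,2) \<open>m \<noteq> N\<close> by (auto simp: only_def m'_def)
  then obtain R where R: "R \<in> set Rs" "\<not> okn (m' + length R)" using assms(1) unfolding only_def by blast
  then have "okn (m + length R)" "0 < length R" using assms(3)[OF R(1)] by auto
  then show False using R(2) by (auto simp: okn_def m'_def split: if_splits)
qed

section \<open>The two configurations on twelve vertices\<close>

lemma only_check:
  "only 2 (paths 12 E12b [] 1 10)" "only 2 (paths 12 E12b [] 2 11)" "only 2 (paths 12 E12b [] 6 9)"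
  "only 2 (paths 10 E344 [] 5 8)" "only 2 (paths 10 E344 [] 4 7)" "only 3 (paths 10 E344 [] 4 1)"
  by code_simp+

lemma sub_check:
  "ext_check 12 2 1 10 E12b (E12b @ [(1,12),(12,13),(13,10)])"
  "ext_check 12 2 2 11 E12b (E12b @ [(2,12),(12,13),(13,11)])"
  "ext_check 12 2 6 9 E12b (E12b @ [(6,12),(12,13),(13,9)])"
  by code_simp+

definition sub_emb :: "(nat \<times> nat) list \<Rightarrow> nat \<Rightarrow> (nat \<times> nat) list \<Rightarrow> nat list \<Rightarrow> bool" where
  "sub_emb es n es' is \<longleftrightarrow> distinct is \<and> list_all (\<lambda>i. i < n) is \<and>
    (\<forall>i \<in> set [0..<length is]. \<forall>j \<in> set [0..<length is]. adj es (is ! i) (is ! j) = adj es' i j)"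

lemma sub_embD:
  assumes "emb E n (adj es) f" "sub_emb es n es' is"
  shows "emb E (length is) (adj es') (\<lambda>i. f (is ! i))"
  using emb_sub[OF assms(1), of "is" "adj es'"] assms(2) by (auto simp: sub_emb_def list_all_iff)

text \<open>\<open>E12b\<close> with one more ear of two vertices contains \<open>E12\<close>: each
  of the first three lists drops the two inner vertices of one path of length 3 of
  \<open>E12b\<close>. The last two lists are reflections of \<open>E12b\<close> and
  \<open>E344\<close>.\<close>

lemma sub_emb_check:
  "sub_emb (E12b @ [(1,12),(12,13),(13,10)]) 14 E12 [1, 12, 13, 10, 4, 3, 2, 0, 7, 11, 9, 8]"
  "sub_emb (E12b @ [(2,12),(12,13),(13,11)]) 14 E12 [0, 6, 5, 4, 3, 2, 1, 7, 11, 10, 12, 13]"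
  "sub_emb (E12b @ [(6,12),(12,13),(13,9)]) 14 E12 [4, 10, 11, 7, 0, 6, 5, 3, 9, 8, 12, 13]"
  "sub_emb E12b 12 E12b [0,6,5,4,3,2,1,7,11,10,9,8]"
  "sub_emb E344 10 E344 [3,2,1,0,6,5,4,9,8,7]"
  by code_simp+

lemma exit_12b':
  "exit_check E12b 12 6 [0,5,6] [(0,1),(6,1),(6,9)]"
  "exit_check E12b 12 2 [1,2,3] [(3,9),(2,9),(2,11)]"
  by code_simp+

lemma bad_12b:
  "bad 2 (paths 12 E12b [6] 1 5)" "bad 2 (paths 12 E12b [6] 0 5)"
  by code_simp+

text \<open>
  \<open>noP3\<close> and \<open>noStar\<close> exclude cutsets \<open>{a, b, c}\<close> and \<open>{w} \<union> Y\<close> that separate the union of components,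
  respectively the component, \<open>K\<close>.  An induced path \<open>y # Q @ [z]\<close> has \<open>length Q + 1\<close> edges.
\<close>
locale heptag_cut = heptag +
  assumes deg: "v \<in> V \<Longrightarrow> \<exists>c. E v c \<and> c \<noteq> a \<and> c \<noteq> b"
    and noP3: "E a b \<Longrightarrow> E b c \<Longrightarrow> a \<noteq> c \<Longrightarrow> K \<noteq> {} \<Longrightarrow> K \<subseteq> V - {a, b, c} \<Longrightarrow>
      (\<And>x y. x \<in> K \<Longrightarrow> E x y \<Longrightarrow> y \<in> K \<union> {a, b, c}) \<Longrightarrow> K = V - {a, b, c}"
    and noStar: "w \<in> V \<Longrightarrow> w \<notin> K \<Longrightarrow> Y \<inter> K = {} \<Longrightarrow> conn E K \<Longrightarrow> K \<noteq> {} \<Longrightarrow> K \<subseteq> V \<Longrightarrow>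
      (\<And>y. y \<in> Y \<Longrightarrow> E w y) \<Longrightarrow> (\<And>x y. x \<in> K \<Longrightarrow> E x y \<Longrightarrow> y \<in> K \<or> y = w \<or> y \<in> Y) \<Longrightarrow>
      (\<And>y z Q. y \<in> Y \<Longrightarrow> z \<in> Y \<Longrightarrow> y \<noteq> z \<Longrightarrow> Q \<noteq> [] \<Longrightarrow> set Q \<subseteq> K \<Longrightarrow> ip E (y # Q @ [z]) \<Longrightarrow>
        odd (length Q)) \<Longrightarrow> V \<subseteq> K \<union> Y \<union> {w}"
begin

lemma inV2: "E x y \<Longrightarrow> y \<in> V"
  using inV sym by blast

lemma third:
  assumes "emb E n (adj es) f" "b < n" "a < n" "c < n" "adj es b a"
    and "\<And>l. l < n \<Longrightarrow> adj es b l \<Longrightarrow> l = a \<or> l = c"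
  obtains r where "E (f b) r" "r \<in> V - f ` {..<n}"
proof -
  have T: "\<And>i j. i < n \<Longrightarrow> j < n \<Longrightarrow> E (f i) (f j) \<longleftrightarrow> adj es i j"
    using assms(1) by (auto simp: emb_def)
  then have "f b \<in> V" using assms inV by blast
  then obtain r where r: "E (f b) r" "r \<noteq> f a" "r \<noteq> f c" using deg by blast
  have "r \<notin> f ` {..<n}"
  proof
    assume "r \<in> f ` {..<n}"
    then obtain l where "l < n" "r = f l" by auto
    then show False using r T[of b l] assms by auto
  qed
  then show thesis using that r inV2 by blast
qed

text \<open>The vertex \<open>x\<close> survives on the other side, so three attachments in a path
  would separate.\<close>

lemma no_P3_component:
  assumes "r \<in> V - S" "a \<in> S" "b \<in> S" "c \<in> S" "E a b" "E b c" "a \<noteq> c"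
    and "x \<in> S" "x \<in> V" "x \<notin> {a, b, c}"
    and "\<And>v s. v \<in> component E (V - S) r \<Longrightarrow> s \<in> S \<Longrightarrow> E v s \<Longrightarrow> s \<in> {a, b, c}"
  shows False
proof -
  let ?K = "component E (V - S) r"
  have sub: "?K \<subseteq> V - S" by (rule component_subset)
  have "y \<in> ?K \<union> {a, b, c}" if "v \<in> ?K" "E v y" for v y
    using that assms(11)[of v y] component_step[of v "V - S" r y] inV2[of v y] by blast
  moreover have "?K \<noteq> {}" using component_self[OF assms(1)] by blast
  moreover have "?K \<subseteq> V - {a, b, c}" using sub assms(2-4) by blast
  ultimately have "?K = V - {a, b, c}" using noP3[OF assms(5-7)] by blast
  then show False using sub assms(8-10) by blast
qed

lemma emb_V:
  assumes "emb E n (adj es) f" "i < n" "adj es i j" "j < n"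
  shows "f i \<in> V"
  using assms inV by (auto simp: emb_def)

lemma ear_only:
  assumes "emb E n (adj es) f" "wf_es es n" "ear E n f P {} z t" "only N (paths k es [] z t)" "z \<noteq> t"
  shows "length P = N"
proof (rule onlyD[OF assms(4)])
  have "P \<noteq> []" "z < n" using assms(3) by (auto simp: ear_def)
  then show "1 \<le> length P" by (simp add: Suc_le_eq)
  show "R \<noteq> [] \<and> okn (length P + length R)" if R: "R \<in> set (paths k es [] z t)" for R
  proof -
    have *: "ip (adj es) R" "R \<noteq> []" "hd R = z" "last R = t" "set R \<subseteq> {..<n}"
      using paths_sound[OF wf_irr[OF assms(2)] R] paths_bdd[OF assms(2) R \<open>z < n\<close>] by auto
    then have "1 < length R" using assms(5) by (cases R; cases "tl R") auto
    then have "okn (length P + length R)"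
      using * \<open>P \<noteq> []\<close> by (intro ear_hole[OF assms(1,3)]) (auto simp: Suc_le_eq neq_Nil_conv)
    then show ?thesis using * by blast
  qed
qed

lemma emb_eq: "emb E n T f \<Longrightarrow> i < n \<Longrightarrow> j < n \<Longrightarrow> f i = f j \<longleftrightarrow> i = j"
  by (auto simp: emb_def inj_on_def)

lemma component_exit:
  assumes "emb E n (adj es) f" "wf_es es n" "exit_check es n b ns A" "unique_att E n f"
    and "b \<in> set ns" "set ns \<subseteq> {..<n}" "f ` {..<n} \<subseteq> S" "r \<in> V - S" "E (f b) r"
    and "v \<in> component E (V - S) r" "E v (f t0)" "t0 < n" "t0 \<notin> set ns"
  obtains P z t where "(z, t) \<in> set A" "set P \<subseteq> component E (V - S) r" "ear E n f P {} z t"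
    "t < n" "t \<notin> set ns" "z \<in> set ns"
proof -
  have "component E (V - S) r \<inter> f ` {..<n} = {}"
    using component_subset[of "V - S" r] assms(7) by blast
  then show thesis
    by (rule exit_path[OF assms(1-4) conn_component _ assms(5,6) component_self[OF assms(8)] sym[OF assms(9)] assms(10-13)])
      (rule that)
qed

text \<open>\<open>E12\<close> is the subdivision of K4 in which two opposite edges become paths of
  length 3 and the other four become paths of length 2. It leaves no exit for a component at the
  inner vertex 1 of a long path, so the path 0, 1, 2 is a cutset.\<close>

lemma no_H12: "\<not> emb E 12 (adj E12) f"
proof
  assume e: "emb E 12 (adj E12) f"
  have a: "\<And>i j. i < 12 \<Longrightarrow> j < 12 \<Longrightarrow> E (f i) (f j) \<longleftrightarrow> adj E12 i j"
    using e by (auto simp: emb_def)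
  obtain r where r: "E (f 1) r" "r \<in> V - f ` {..<12}"
    by (rule third[OF e, of 1 0 2]) (auto simp: adj_def E12_def E344_def E7_def)
  show False
  proof (rule no_P3_component[OF r(2), of "f 0" "f 1" "f 2" "f 3"])
    show "f 0 \<noteq> f 2" "f 3 \<notin> {f 0, f 1, f 2}" by (simp_all add: emb_eq[OF e])
    show "f 3 \<in> V" by (rule emb_V[OF e, of _ 2]) (auto simp: adj_def E12_def E344_def E7_def)
    show "s \<in> {f 0, f 1, f 2}"
      if s: "v \<in> component E (V - f ` {..<12}) r" "s \<in> f ` {..<12}" "E v s" for v s
    proof (rule ccontr)
      assume n: "s \<notin> {f 0, f 1, f 2}"
      obtain t where t: "t < 12" "s = f t" using s by auto
      have "t \<notin> set [0, 1, 2]" using n t(2) by (cases "t = 0"; cases "t = 1"; cases "t = 2") auto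
      then show False
        using component_exit[OF e wf_E(4) exit_12 diam4_unique_att[OF e diam4_12 wf_E(4)] _ _ order_refl
            r(2,1) s(1) s(3)[unfolded t(2)] t(1)] by fastforce
    qed
  qed (use a in \<open>auto simp: adj_def E12_def E344_def E7_def\<close>)
qed

lemma no_H12_ear:
  assumes e: "emb E n (adj es) f" "wf_es es n" and P: "ear E n f P {} z t" "z \<noteq> t"
    and c: "only 2 (paths k es [] z t)" "ext_check n 2 z t es es'" "sub_emb es' N E12 is" "length is = 12" "N = n + 2"
  shows False
proof -
  have "length P = 2" by (rule ear_only[OF e P(1) c(1) P(2)])
  then have "emb E N (adj es') (\<lambda>i. if i < n then f i else P ! (i - n))"
    using emb_ear[OF e(1) P(1)] c(2,5) by simp
  from sub_embD[OF this c(3)] show False unfolding c(4) using no_H12 by blast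
qed

text \<open>The contacts along a shortest path from \<open>f 1\<close> to a forbidden vertex come in
  a forced order. The first one outside 0, 1, 2 is preceded by or equal to a contact with 6; after
  it only 0, 5, 6 are possible, so the forbidden vertex is 5. An ear to 5 that may touch 6 then
  fails by parity.\<close>

lemma H12b_att:
  assumes e: "emb E 12 (adj E12b) f" and r: "E (f 1) r" "r \<in> V - f ` {..<12}"
    and x: "x \<in> component E (V - f ` {..<12}) r" "E x (f t)" "t < 12"
  shows "t \<in> {0, 1, 2, 6}"
proof (rule ccontr)
  assume tn: "t \<notin> {0, 1, 2, 6}"
  let ?K = "component E (V - f ` {..<12}) r"
  have uqa: "unique_att E 12 f" by (rule diam4_unique_att[OF e diam4_12b wf_E(5)])
  note uq = unique_attD[OF uqa]
  have no: False if "ear E 12 f Q {} z s" "(z, s) = (1, 10) \<or> (z, s) = (2, 11) \<or> (z, s) = (6, 9)" for Q z s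
    using that(2)
  proof (elim disjE)
    assume "(z, s) = (1, 10)"
    then show False
      using no_H12_ear[OF e wf_E(5) _ _ only_check(1) sub_check(1) sub_emb_check(1)] that(1) by simp
  next
    assume "(z, s) = (2, 11)"
    then show False
      using no_H12_ear[OF e wf_E(5) _ _ only_check(2) sub_check(2) sub_emb_check(2)] that(1) by simp
  next
    assume "(z, s) = (6, 9)"
    then show False
      using no_H12_ear[OF e wf_E(5) _ _ only_check(3) sub_check(3) sub_emb_check(3)] that(1) by simp
  qed
  obtain P where P: "ip E P" "P \<noteq> []" "set P \<subseteq> ?K" "E (hd P) (f 1)" "E (last P) (f t)"
    and A1: "\<And>v. v \<in> set P \<Longrightarrow> E v (f 1) \<Longrightarrow> v = hd P" and B1: "\<And>v. v \<in> set P \<Longrightarrow> E v (f t) \<Longrightarrow> v = last P"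
    by (rule geodesic[OF conn_component component_self[OF r(2)], of "\<lambda>v. E v (f 1)" x "\<lambda>v. E v (f t)", OF sym[OF r(1)] x(1,2)])
      (rule that)
  have PF: "set P \<inter> f ` {..<12} = {}" using P(3) component_subset[of "V - f ` {..<12}" r] by blast
  have out: "P ! i \<notin> f ` {..<12}" if "i < length P" for i using that PF nth_mem by blast
  have hl: "hd P = P ! 0" "last P = P ! (length P - 1)" using P by (auto simp: hd_conv_nth last_conv_nth)
  have k0: "0 < length P" using P by simp
  have d: "distinct P" using P ip_distinct by blast
  have one: "i = 0" if "E (P ! i) (f 1)" "i < length P" for i
    using A1[of "P ! i"] that d k0 hl by (simp add: nth_eq_iff_index_eq)
  have tl: "i = length P - 1" if "E (P ! i) (f t)" "i < length P" for i
    using B1[of "P ! i"] that d k0 hl by (simp add: nth_eq_iff_index_eq)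
  let ?n = "length P - 1"
  have n0: "0 < ?n"
  proof (rule ccontr)
    assume "\<not> 0 < ?n"
    then have "hd P = last P" using hl by simp
    then show False using uq[of "hd P" 1 t] out[of 0] hl k0 P(4,5) x(3) tn by auto
  qed
  \<comment> \<open>Seen from 1, the surviving exits lead to 6 or form the ear from 1 to 10; the
    latter would create \<open>E12\<close>.\<close>
  have first6: "\<exists>j'. 0 < j' \<and> j' \<le> j \<and> E (P ! j') (f 6)"
    if j: "0 < j" "j < length P" "E (P ! j) (f s)" "s < 12" "s \<notin> {0, 1, 2}" for j s
  proof -
    obtain j' z t' Q where "0 < j'" "j' \<le> j" "E (P ! j') (f t')" "(z, t') \<in> set [(0,6),(1,6),(1,10)]"
      "ear E 12 f Q {} z t'"
      by (rule exit_from[OF e wf_E(5) exit_12b uqa _ _ P(1) PF j(1,2) _ j(3,4)])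
        (use P(4) hl j in auto)
    then show ?thesis using no[of Q z t'] by auto
  qed
  \<comment> \<open>Seen from 6, an exit to 1 would be a contact with \<open>f 1\<close> behind the
    first vertex of \<open>P\<close>, and the ear from 6 to 9 would create
    \<open>E12\<close>.\<close>
  have after6: "s \<in> {0, 5, 6}"
    if i: "i < j" "j < length P" "E (P ! i) (f 6)" "E (P ! j) (f s)" "s < 12" for i j s
  proof (rule ccontr)
    assume n: "s \<notin> {0, 5, 6}"
    obtain j' z t' Q where "i < j'" "j' \<le> j" "E (P ! j') (f t')" "(z, t') \<in> set [(0,1),(6,1),(6,9)]"
      "ear E 12 f Q {} z t'"
      by (rule exit_from[OF e wf_E(5) exit_12b'(1) uqa _ _ P(1) PF i(1,2,3,4,5)]) (use n in auto)
    then show False using no[of Q z t'] one[of j'] i by auto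
  qed
  obtain j where j: "0 < j" "j \<le> ?n" "E (P ! j) (f 6)"
    using first6[OF n0 _ _ x(3)] P(5) hl tn k0 by auto
  have "j \<noteq> ?n" using uq[OF out[of ?n], of t 6] j P(5) hl x(3) tn k0 by auto
  then have t5: "t = 5" using after6[OF _ _ j(3), of ?n t] j P(5) hl x(3) tn k0 by auto
  have att: "s \<in> {0, 1, 2, 5, 6}" if i: "i < length P" "E (P ! i) (f s)" "s < 12" for i s
  proof (rule ccontr)
    assume n: "s \<notin> {0, 1, 2, 5, 6}"
    have "0 < i"
    proof (rule gr0I)
      assume "i = 0"
      then show False using uq[OF out[of 0], of s 1] i n P(4) hl k0 by auto
    qed
    then obtain l where "0 < l" "l \<le> i" "E (P ! l) (f 6)" using first6[of i s] i n by auto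
    moreover have "l \<noteq> i" using calculation uq[OF out[OF i(1)], of s 6] i n by auto
    ultimately show False using after6[of l i s] i n by auto
  qed
  \<comment> \<open>From a contact with 2 the path still has to reach 5, and all surviving exits
    from 1, 2, 3 lead to 9 or 11, which \<open>att\<close> forbids.\<close>
  have no2: "\<not> E (P ! i) (f 2)" if i: "i < length P" for i
  proof
    assume 2: "E (P ! i) (f 2)"
    have "i \<noteq> ?n" using uq[OF out[OF i], of 2 5] 2 P(5) hl t5 by auto
    then have "i < ?n" using i by simp
    obtain j' z t' Q where "i < j'" "j' \<le> ?n" "E (P ! j') (f t')" "t' < 12"
      "(z, t') \<in> set [(3,9),(2,9),(2,11)]" "ear E 12 f Q {} z t'"
      by (rule exit_from[OF e wf_E(5) exit_12b'(2) uqa _ _ P(1) PF \<open>i < ?n\<close>, of 5])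
        (use i 2 P(5) hl t5 k0 in auto)
    moreover have "j' < length P" using \<open>j' \<le> ?n\<close> k0 by linarith
    ultimately show False using att[of j' t'] by auto
  qed
  let ?M = "\<lambda>i. i < length P \<and> (E (P ! i) (f 0) \<or> E (P ! i) (f 1))"
  define l where "l = (GREATEST i. ?M i)"
  have M0: "?M 0" using P(4) hl k0 by simp
  have l: "?M l" unfolding l_def by (rule GreatestI_nat[of ?M 0 "length P"]) (use M0 in auto)
  have lx: "i \<le> l" if "?M i" for i unfolding l_def by (rule Greatest_le_nat[of ?M _ "length P"]) (use that in auto)
  obtain u where u: "u = 0 \<or> u = 1" "E (P ! l) (f u)" using l by blast
  have ln: "l \<noteq> ?n" using uq[OF out[of l], of u 5] u l P(5) hl t5 by auto
  \<comment> \<open>Behind \<open>l\<close> there is no contact with 0 or 1, and 2 never occurs.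
    Only 6 remains free, and the paths of \<open>bad_12b\<close> avoid it.\<close>
  have Q: "ear E 12 f (drop l P) {6} u 5"
    unfolding ear_def
  proof (intro conjI ballI allI impI)
    show "ip E (drop l P)" by (rule ip_drop[OF P(1)])
    show "drop l P \<noteq> []" using l by simp
    show "set (drop l P) \<inter> f ` {..<12} = {}" using PF set_drop_subset[of l P] by blast
    show "u < 12" using u by auto
    show "E (hd (drop l P)) (f u)" using u l by (simp add: hd_drop_conv_nth)
    show "E (last (drop l P)) (f 5)" using P(5) t5 l by simp
    fix v s assume v: "v \<in> set (drop l P)" "s < 12" "E v (f s)"
    obtain i where i: "l \<le> i" "i < length P" "v = P ! i"
      using v(1) by (auto simp: in_set_conv_nth) (metis add.commute le_add1 less_diff_conv)
    consider "s = 6" | "s = 5" | "s = 0 \<or> s = 1" | "s = 2" using att[of i s] i v by auto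
    then show "s \<in> {6} \<or> v = hd (drop l P) \<and> s = u \<or> v = last (drop l P) \<and> s = 5"
    proof cases
      case 2
      then show ?thesis using tl[of i] t5 i v l hl by auto
    next
      case 3
      then have "i = l" using lx[of i] i v by auto
      then show ?thesis using uq[OF out[of l], of s u] u v i l by (auto simp: hd_drop_conv_nth)
    next
      case 4
      then show ?thesis using no2 i v by auto
    qed auto
  qed simp
  have bad: "bad 2 (paths 12 E12b [6] u 5)" using bad_12b u by auto
  obtain R where R: "R \<in> set (paths 12 E12b [6] u 5)" "\<not> okn (length (drop l P) + length R)"
    using badD[OF bad, of "length (drop l P)"] paths_sound[OF wf_irr[OF wf_E(5)]] l ln by fastforce
  have R': "ip (adj E12b) R" "R \<noteq> []" "hd R = u" "last R = 5" "set (tl R) \<inter> {6} = {}" "set R \<subseteq> {..<12}"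
    using paths_sound[OF wf_irr[OF wf_E(5)] R(1)] paths_bdd[OF wf_E(5) R(1)] u by auto
  then have "set R \<inter> {6} = {}" using u(1) by (cases R) auto
  moreover have "3 \<le> length (drop l P) + length R"
    using R' ln l by (cases R) auto
  ultimately have "okn (length (drop l P) + length R)"
    using R' by (intro ear_hole[OF e Q]) auto
  then show False using R by simp
qed

text \<open>\<open>E12b\<close> is the subdivision of K4 in which two opposite edges are kept and
  the other four become paths of length 3. The component at 1 touches at most 0, 1, 2, 6. Without a
  contact at 6 it hangs on the path 0, 1, 2; with one, a reflection shows that it hangs on 1, 0,
  6.\<close>

lemma no_H12b: "\<not> emb E 12 (adj E12b) f"
proof
  assume e: "emb E 12 (adj E12b) f"
  have a: "\<And>i j. i < 12 \<Longrightarrow> j < 12 \<Longrightarrow> E (f i) (f j) \<longleftrightarrow> adj E12b i j"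
    using e by (auto simp: emb_def)
  obtain r where r: "E (f 1) r" "r \<in> V - f ` {..<12}"
    by (rule third[OF e, of 1 0 2]) (auto simp: adj_def E12b_def E344_def E7_def)
  let ?K = "component E (V - f ` {..<12}) r"
  have att: "t \<in> {0, 1, 2, 6}" if "x \<in> ?K" "E x (f t)" "t < 12" for x t
    using H12b_att[OF e r that] .
  have 3: "f 3 \<in> V" by (rule emb_V[OF e, of _ 2]) (auto simp: adj_def E12b_def E344_def E7_def)
  show False
  proof (cases "\<exists>x \<in> ?K. E x (f 6)")
    case False
    show False
    proof (rule no_P3_component[OF r(2), of "f 0" "f 1" "f 2" "f 3"])
      show "f 0 \<noteq> f 2" "f 3 \<notin> {f 0, f 1, f 2}" by (simp_all add: emb_eq[OF e])
      show "s \<in> {f 0, f 1, f 2}" if "v \<in> ?K" "s \<in> f ` {..<12}" "E v s" for v s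
        using att[of v] that False by auto
    qed (use a 3 in \<open>auto simp: adj_def E12b_def E344_def E7_def\<close>)
  next
    case True
    then obtain r' where r': "r' \<in> ?K" "E r' (f 6)" by blast
    \<comment> \<open>The reflection that exchanges the paths 0, 1, 2, 3 and 0, 6, 5, 4. From 6 the
      attachments lie in 0, 6, 5, 1, and intersecting both bounds leaves 0, 1, 6.\<close>
    let ?f = "\<lambda>i. f ([0,6,5,4,3,2,1,7,11,10,9,8] ! i)"
    have e': "emb E 12 (adj E12b) ?f" using sub_embD[OF e sub_emb_check(4), unfolded list.size(3,4)] by (simp add: numeral_eq_Suc)
    have im: "?f ` {..<12} = f ` {..<12}"
      by (auto simp: lessThan_Suc numeral_eq_Suc)
    have "r' \<in> V - f ` {..<12}" using component_subset r'(1) by blast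
    have K': "?K \<subseteq> component E (V - f ` {..<12}) r'"
    proof
      fix v assume "v \<in> ?K"
      then obtain xs where "walk E ?K xs" "hd xs = r'" "last xs = v"
        using conn_component[of "V - f ` {..<12}" r] r'(1) unfolding conn_def by blast
      moreover from this(1) have "walk E (V - f ` {..<12}) xs"
        using component_subset[of "V - f ` {..<12}" r] unfolding walk_def by blast
      ultimately show "v \<in> component E (V - f ` {..<12}) r'"
        unfolding component_def by blast
    qed
    have att': "t \<in> {0, 1, 2, 6}" if "x \<in> ?K" "E x (?f t)" "t < 12" for x t
      using H12b_att[OF e', of r' x t] that K' r' \<open>r' \<in> V - f ` {..<12}\<close> sym im by auto
    show False
    proof (rule no_P3_component[OF r(2), of "f 1" "f 0" "f 6" "f 3"])
      show "f 1 \<noteq> f 6" "f 3 \<notin> {f 1, f 0, f 6}" by (simp_all add: emb_eq[OF e])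
      show "s \<in> {f 1, f 0, f 6}" if "v \<in> ?K" "s \<in> f ` {..<12}" "E v s" for v s
        using att[of v] att'[of v 5] that by auto
    qed (use a 3 in \<open>auto simp: adj_def E12b_def E344_def E7_def\<close>)
  qed
qed

end

text \<open>In \<open>E255\<close> the pairs 4, 8 and 5, 9 are the exceptions to distance at most 4,
  so uniqueness of attachments needs an extra argument there.\<close>

lemma only_check2:
  "only 3 (paths 10 E344 [] 6 2)" "only 2 (paths 10 E344 [] 6 9)" "only 4 (paths 11 E255 [] 6 1)"
  "ext_check 10 2 6 9 E344 (E344 @ [(6,10),(10,11),(11,9)])"
  "sub_emb (E344 @ [(6,10),(10,11),(11,9)]) 12 E12b [0, 1, 2, 3, 9, 8, 7, 6, 5, 4, 11, 10]"
  "\<forall>i \<in> set [0..<11]. \<forall>j \<in> set [0..<11]. i = j \<or> paths 5 E255 [] i j \<noteq> [] \<or>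
     (i, j) \<in> set [(4,8),(8,4),(5,9),(9,5)]"
  "\<forall>i \<in> set [0..<10]. \<exists>j \<in> set [0..<10]. adj E344 i j"
  "\<forall>i \<in> set [0..<11]. \<exists>j \<in> set [0..<11]. adj E255 i j"
  by code_simp+

section \<open>Stars whose leaves have short paths to a common vertex\<close>

context heptag
begin

lemma no3: "E a b \<Longrightarrow> E b c \<Longrightarrow> E c a \<Longrightarrow> False"
proof -
  assume *: "E a b" "E b c" "E c a"
  then have "distinct [a, b, c]" using irr by auto
  then have "7 \<le> length [a, b, c]" by (rule girth) (use * in auto)
  then show False by simp
qed

lemma no4: "E a b \<Longrightarrow> E b c \<Longrightarrow> E c d \<Longrightarrow> E d a \<Longrightarrow> a = c \<or> b = d"
proof (rule ccontr)
  assume *: "E a b" "E b c" "E c d" "E d a" "\<not> (a = c \<or> b = d)"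
  then have "distinct [a, b, c, d]" using irr by auto
  then have "7 \<le> length [a, b, c, d]" by (rule girth) (use * in auto)
  then show False by simp
qed

lemma no5: "E a b \<Longrightarrow> E b c \<Longrightarrow> E c d \<Longrightarrow> E d e \<Longrightarrow> E e a \<Longrightarrow> False"
proof -
  assume *: "E a b" "E b c" "E c d" "E d e" "E e a"
  have "a \<noteq> c" "a \<noteq> d" "b \<noteq> d" "b \<noteq> e" "c \<noteq> e" using no3 * by blast+
  then have "distinct [a, b, c, d, e]" using * irr by auto
  then have "7 \<le> length [a, b, c, d, e]" by (rule girth) (use * in auto)
  then show False by simp
qed

lemma no6: "E a b \<Longrightarrow> E b c \<Longrightarrow> E c d \<Longrightarrow> E d e \<Longrightarrow> E e g \<Longrightarrow> E g a \<Longrightarrow> \<not> distinct [a, b, c, d, e, g]"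
proof
  assume *: "E a b" "E b c" "E c d" "E d e" "E e g" "E g a" "distinct [a, b, c, d, e, g]"
  from *(7) have "7 \<le> length [a, b, c, d, e, g]" by (rule girth) (use * in auto)
  then show False by simp
qed

definition path4 :: "'a \<Rightarrow> 'a \<Rightarrow> 'a \<Rightarrow> 'a \<Rightarrow> 'a \<Rightarrow> bool" where
  "path4 w y m n s \<longleftrightarrow> distinct [w, y, m, n, s] \<and> E w y \<and> E y m \<and> E m n \<and> E n s"

definition path5 :: "'a \<Rightarrow> 'a \<Rightarrow> 'a \<Rightarrow> 'a \<Rightarrow> 'a \<Rightarrow> 'a \<Rightarrow> bool" where
  "path5 w y m n l s \<longleftrightarrow> distinct [w, y, m, n, l, s] \<and> E w y \<and> E y m \<and> E m n \<and> E n l \<and> E l s"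

text \<open>Go from \<open>y\<close> towards \<open>s\<close> and back to \<open>z\<close>, turning
  at the first common vertex \<open>n\<close> or \<open>s\<close>. Chords and other coincidences are
  excluded by the girth, if necessary with the help of \<open>w\<close>. The detour has 5 or 7
  vertices, hence an even number of edges.\<close>

lemma even_detour4:
  assumes "path4 w y m n s" "path4 w z m' n' s" "y \<noteq> z"
  obtains S where "ip E S" "S \<noteq> []" "hd S = y" "last S = z" "odd (length S)"
    "set S \<subseteq> {y, z, m, n, m', n', s}"
proof -
  have p: "E w y" "E y m" "E m n" "E n s" "w \<noteq> m" "w \<noteq> n" "w \<noteq> s" "y \<noteq> n" "y \<noteq> s" "m \<noteq> s"
    and q: "E w z" "E z m'" "E m' n'" "E n' s" "w \<noteq> m'" "w \<noteq> n'" "z \<noteq> n'" "z \<noteq> s" "m' \<noteq> s"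
    using assms by (auto simp: path4_def)
  note r = p(1-4)[THEN sym] q(1-4)[THEN sym]
  have ns: "\<not> E y n" "\<not> E y z" "\<not> E m s" "\<not> E n n'" "\<not> E s m'" "\<not> E z n'"
    using no3 p q r by blast+
  have n4: "\<not> E y s" "\<not> E s z" "\<not> E y m'" "\<not> E m z"
    using no4[of y m n s] no4[of z m' n' s] no4[of w y m' z] no4[of w y m z] p q r assms(3) sym by blast+
  have n5: "\<not> E y n'" "\<not> E m m'" "\<not> E n z"
    using no5[of w y n' m' z] no5[of w y m m' z] no5[of w y m n z] p q r sym by blast+
  have d: "y \<noteq> m'" "y \<noteq> n'" "m \<noteq> m'" "m \<noteq> z" "m \<noteq> n'" "n \<noteq> m'" "n \<noteq> z"
    using ns n4 n5 p q r no4[of w y m z] no3[of w z y] no3[of w y z] irr assms(3) sym by blast+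
  show thesis
  proof (cases "n = n'")
    case True
    have "ip E [y, m, n, m', z]" using p q r True ns n4 n5 d assms(3) irr sym by auto
    then show thesis using that[of "[y, m, n, m', z]"] by auto
  next
    case False
    have "\<not> E m n'" "\<not> E n m'" using no4[of m n s n'] no4[of n m' n' s] no4[of m' n s n'] False p q r sym by blast+
    then have "ip E [y, m, n, s, n', m', z]" using p q r False ns n4 n5 d assms(3) irr sym by auto
    then show thesis using that[of "[y, m, n, s, n', m', z]"] by auto
  qed
qed

text \<open>Now the turning point is \<open>n\<close>, \<open>l\<close> or \<open>s\<close>, and the
  detour has 5, 7 or 9 vertices. One edge more per path makes cycles of length 6 through
  \<open>w\<close> relevant.\<close>

lemma even_detour5:
  assumes "path5 w y m n l s" "path5 w z m' n' l' s" "y \<noteq> z"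
  obtains S where "ip E S" "S \<noteq> []" "hd S = y" "last S = z" "odd (length S)"
    "set S \<subseteq> {y, z, m, n, l, m', n', l', s}"
proof -
  have p: "E w y" "E y m" "E m n" "E n l" "E l s" "w \<noteq> m" "w \<noteq> n" "w \<noteq> l" "w \<noteq> s" "y \<noteq> n" "y \<noteq> l" "y \<noteq> s"
      "m \<noteq> l" "m \<noteq> s" "n \<noteq> s"
    and q: "E w z" "E z m'" "E m' n'" "E n' l'" "E l' s" "w \<noteq> m'" "w \<noteq> n'" "w \<noteq> l'" "z \<noteq> n'" "z \<noteq> l'" "z \<noteq> s"
      "m' \<noteq> l'" "m' \<noteq> s" "n' \<noteq> s"
    using assms by (auto simp: path5_def)
  note r = p(1-5)[THEN sym] q(1-5)[THEN sym]
  have n3: "\<not> E y n" "\<not> E y z" "\<not> E m l" "\<not> E n s" "\<not> E l l'" "\<not> E s n'" "\<not> E l' m'" "\<not> E n' z"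
    using no3 p q r sym by blast+
  have n4: "\<not> E y l" "\<not> E m s" "\<not> E s m'" "\<not> E l' z" "\<not> E y m'" "\<not> E m z"
    using no4[of y m n l] no4[of m n l s] no4[of m' n' l' s] no4[of z m' n' l'] no4[of w y m' z] no4[of w y m z]
      p q r assms(3) sym by blast+
  have n5: "\<not> E y s" "\<not> E s z" "\<not> E m l'" "\<not> E l m'" "\<not> E n n'" "\<not> E m m'" "\<not> E y n'" "\<not> E n z"
    using no5[of y m n l s] no5[of z m' n' l' s] no5[of m n l s l'] no5[of l s l' n' m'] no5[of n l s l' n']
      no5[of w y m m' z] no5[of w y n' m' z] no5[of w y m n z] p q r sym by blast+
  have "y \<noteq> m'" using no3[of w z y] p(1) q(1,2) sym by blast
  moreover have "y \<noteq> n'" using no4[of w z m' y] p(1) q(1-3,6) assms(3) sym by blast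
  moreover have "m \<noteq> m'" using no4[of w y m z] p(1,2,6) q(1,2) assms(3) sym by blast
  moreover have "m \<noteq> z" using n3(2) p(2) by blast
  moreover have "m \<noteq> n'" using n5(7) p(2) by blast
  moreover have "n \<noteq> m'" using n5(8) r(7) by blast
  moreover have "n \<noteq> z" using n4(6) p(3) by blast
  moreover have "y \<noteq> l'" using n5(7) r(9) by blast
  moreover have "l \<noteq> z" using n5(8) p(4) by blast
  moreover have "l \<noteq> m'" using n4(3) r(5) by blast
  moreover have "m \<noteq> l'" using n4(2) q(5) by blast
  moreover have "l \<noteq> n'" using n3(6) r(5) by blast
  moreover have "n \<noteq> l'" using n3(4) q(5) by blast
  ultimately have d0: "y \<noteq> m'" "y \<noteq> n'" "m \<noteq> m'" "m \<noteq> z" "m \<noteq> n'" "n \<noteq> m'" "n \<noteq> z" "y \<noteq> l'" "l \<noteq> z"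
    "l \<noteq> m'" "m \<noteq> l'" "l \<noteq> n'" "n \<noteq> l'" by auto
  have nirr: "w \<noteq> y" "w \<noteq> z" "y \<noteq> m" "m \<noteq> n" "n \<noteq> l" "l \<noteq> s" "z \<noteq> m'" "m' \<noteq> n'" "n' \<noteq> l'" "l' \<noteq> s"
    using p(1-5) q(1-5) irr by metis+
  have "distinct [w, y, l', n', m', z]" "distinct [w, y, m, n, l, z]" "distinct [w, y, m, n', m', z]"
    "distinct [w, y, m, n, m', z]"
    using p(6-) q(6-) d0 nirr assms(3) by simp_all
  then have n6: "\<not> E y l'" "\<not> E l z" "\<not> E m n'" "\<not> E n m'"
    using no6[of w y l' n' m' z] no6[of w y m n l z] no6[of w y m n' m' z] no6[of w y m n m' z] p q r by blast+
  show thesis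
  proof (cases "n = n'")
    case True
    have "ip E [y, m, n, m', z]" using p q r True n3 n4 n5 n6 d0 nirr assms(3) by simp
    then show thesis using that[of "[y, m, n, m', z]"] by auto
  next
    case nn: False
    show thesis
    proof (cases "l = l'")
      case True
      have "ip E [y, m, n, l, n', m', z]" using p q r nn True n3 n4 n5 n6 d0 nirr assms(3) by simp
      then show thesis using that[of "[y, m, n, l, n', m', z]"] by auto
    next
      case False
      have "\<not> E n l'" "\<not> E l n'" using no4[of n l s l'] no4[of n' l s l'] no4[of l n' l' s] False p q r sym by blast+
      then have "ip E [y, m, n, l, s, l', n', m', z]"
        using p q r nn False n3 n4 n5 n6 d0 nirr assms(3) by simp
      then show thesis using that[of "[y, m, n, l, s, l', n', m', z]"] by auto
    qed
  qed
qed

end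

context heptag_cut
begin

text \<open>If \<open>length Q\<close> were even, then \<open>Q\<close> and \<open>S\<close> would form an odd hole.  Its length would exceed 7,
  since \<open>y # Q @ [z]\<close> and \<open>S\<close> each close to a cycle of length at least 7 through \<open>w\<close>.\<close>
lemma star_cut:
  assumes w: "w \<notin> K" and Y: "Y \<inter> K = {}" "\<And>y. y \<in> Y \<Longrightarrow> E w y"
    and K: "conn E K" "K \<noteq> {}" "K \<subseteq> V" "\<And>x y. x \<in> K \<Longrightarrow> E x y \<Longrightarrow> y \<in> K \<or> y = w \<or> y \<in> Y"
    and s: "s \<in> V" "s \<notin> K" "\<not> E w s" "s \<noteq> w" "w \<in> V"
    and S: "\<And>y z. y \<in> Y \<Longrightarrow> z \<in> Y \<Longrightarrow> y \<noteq> z \<Longrightarrow> \<exists>S. ip E S \<and> S \<noteq> [] \<and> hd S = y \<and> last S = z \<and>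
      odd (length S) \<and> set S \<inter> K = {} \<and> w \<notin> set S \<and> set S \<inter> Y = {y, z}"
  shows False
proof -
  have "odd (length Q)" if Q: "y \<in> Y" "z \<in> Y" "y \<noteq> z" "Q \<noteq> []" "set Q \<subseteq> K" "ip E (y # Q @ [z])" for y z Q
  proof (rule ccontr)
    assume ev: "\<not> odd (length Q)"
    obtain S where S: "ip E S" "S \<noteq> []" "hd S = y" "last S = z" "odd (length S)"
      "set S \<inter> K = {}" "w \<notin> set S" "set S \<inter> Y = {y, z}" using assms(13)[OF Q(1-3)] by blast
    have ipQ: "ip E Q" using ip_take[OF ip_tl[OF Q(6)], of "length Q"] by simp
    have yz: "E y (hd Q)" "\<And>v. v \<in> set Q \<Longrightarrow> E y v \<Longrightarrow> v = hd Q" using Q(4,6) by (cases Q; auto)+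
    have "ip E (rev (y # Q @ [z]))" by (rule ip_rev[OF sym Q(6)])
    then have "ip E (z # rev Q @ [y])" by simp
    then have zz: "E z (last Q)" "\<And>v. v \<in> set Q \<Longrightarrow> E z v \<Longrightarrow> v = last Q"
      using Q(4) by (cases Q rule: rev_cases; auto)+
    have l1: "length S \<noteq> 1" using S(2-4) Q(3) by (cases S) auto
    have "okn (length Q + length S)"
    proof (rule okn_hole[OF ipQ S(1) Q(4) S(2)])
      show "3 \<le> length Q + length S" using Q(4) S(2) l1 by (cases Q; cases S) (auto simp: Suc_le_eq)
      show "set Q \<inter> set S = {}" using Q(5) S(6) by blast
      show "E (hd Q) (hd S)" "E (last Q) (last S)" using yz zz S sym by auto
      show "u = hd Q \<and> v = hd S \<or> u = last Q \<and> v = last S" if "u \<in> set Q" "v \<in> set S" "E u v" for u v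
      proof -
        have "v \<in> Y" using K(4)[of u v] that Q(5) S(6,7) by blast
        then have "v = y \<or> v = z" using S(8) that by blast
        then show ?thesis using yz(2)[of u] zz(2)[of u] that sym S(3,4) by blast
      qed
    qed
    then have "length Q + length S = 7" using ev S(5) by (auto simp: okn_def)
    moreover have "7 \<le> length (w # y # Q @ [z])"
    proof (rule girth)
      show "distinct (w # y # Q @ [z])"
        using ip_distinct[OF Q(6)] Q w irr Y(2) by auto
      show "successively E (w # y # Q @ [z])"
        using ip_successively[OF Q(6)] Y(2) Q(1) by (auto simp: successively_Cons)
    qed (use Y(2) Q sym in auto)
    moreover have "7 \<le> length (w # S)"
    proof (rule girth)
      show "distinct (w # S)" using ip_distinct[OF S(1)] S(7) by auto
      show "successively E (w # S)" using ip_successively[OF S(1)] S(3) Y(2) Q(1) by (auto simp: successively_Cons)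
      show "3 \<le> length (w # S)" using S(2) l1 by (cases S) (auto simp: Suc_le_eq)
    qed (use S Y(2) Q sym in auto)
    ultimately show False by simp
  qed
  then have "V \<subseteq> K \<union> Y \<union> {w}"
    using noStar[of w K Y] s(5) w Y K by blast
  then show False using s Y by blast
qed

text \<open>The detours avoid \<open>K\<close>. The neighbours of a vertex of \<open>K\<close> lie
  in \<open>K\<close>, in \<open>Y\<close> or equal \<open>w\<close>, whereas \<open>s\<close> is in
  none of these places; hence \<open>n\<close> is not in \<open>K\<close>, and then neither is
  \<open>m\<close>. The girth keeps both away from \<open>w\<close>, so they are not leaves.\<close>

lemma star_cut4:
  assumes w: "w \<notin> K" and Y: "Y = {y. \<exists>m n. path4 w y m n s}" "Y \<inter> K = {}"
    and K: "conn E K" "K \<noteq> {}" "K \<subseteq> V" "\<And>x y. x \<in> K \<Longrightarrow> E x y \<Longrightarrow> y \<in> K \<or> y = w \<or> y \<in> Y"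
    and s: "s \<in> V" "s \<notin> K" "\<not> E w s" "s \<noteq> w" "w \<in> V"
  shows False
proof (rule star_cut[OF w Y(2) _ K s])
  show "E w y" if "y \<in> Y" for y using that Y(1) by (auto simp: path4_def)
  fix y z assume yz: "y \<in> Y" "z \<in> Y" "y \<noteq> z"
  obtain m n where p: "path4 w y m n s" using yz Y(1) by blast
  obtain m' n' where q: "path4 w z m' n' s" using yz Y(1) by blast
  obtain S where S: "ip E S" "S \<noteq> []" "hd S = y" "last S = z" "odd (length S)"
    "set S \<subseteq> {y, z, m, n, m', n', s}" by (rule even_detour4[OF p q yz(3)])
  have *: "m \<notin> K \<and> n \<notin> K \<and> m \<notin> Y \<and> n \<notin> Y \<and> w \<noteq> m \<and> w \<noteq> n" if "path4 w y m n s" for y m n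
  proof -
    have e: "E w y" "E y m" "E m n" "E n s" "distinct [w, y, m, n, s]" using that by (auto simp: path4_def)
    have "\<not> E w m" "\<not> E w n" using no3[of w y m] no4[of w y m n] e sym by auto
    then have "m \<notin> Y" "n \<notin> Y" "s \<notin> Y" using Y(1) s(3) by (auto simp: path4_def)
    then show ?thesis using K(4)[of m n] K(4)[of n s] e s(2,4) by auto
  qed
  have "s \<notin> Y" using Y(1) s(3) by (auto simp: path4_def)
  moreover have "y \<noteq> w" "z \<noteq> w" using p q by (auto simp: path4_def)
  ultimately have "set S \<inter> K = {}" "w \<notin> set S" "set S \<inter> Y \<subseteq> {y, z}"
    using S(6) *[OF p] *[OF q] yz Y(2) s(2,4) by auto
  moreover have "{y, z} \<subseteq> set S" using S(2-4) hd_in_set last_in_set by blast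
  ultimately show "\<exists>S. ip E S \<and> S \<noteq> [] \<and> hd S = y \<and> last S = z \<and>
      odd (length S) \<and> set S \<inter> K = {} \<and> w \<notin> set S \<and> set S \<inter> Y = {y, z}"
    using S yz by blast
qed

lemma star_cut5:
  assumes w: "w \<notin> K" and Y: "Y = {y. \<exists>m n l. path5 w y m n l s}" "Y \<inter> K = {}"
    and K: "conn E K" "K \<noteq> {}" "K \<subseteq> V" "\<And>x y. x \<in> K \<Longrightarrow> E x y \<Longrightarrow> y \<in> K \<or> y = w \<or> y \<in> Y"
    and s: "s \<in> V" "s \<notin> K" "\<not> E w s" "s \<noteq> w" "w \<in> V"
  shows False
proof (rule star_cut[OF w Y(2) _ K s])
  show "E w y" if "y \<in> Y" for y using that Y(1) by (auto simp: path5_def)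
  fix y z assume yz: "y \<in> Y" "z \<in> Y" "y \<noteq> z"
  obtain m n l where p: "path5 w y m n l s" using yz Y(1) by blast
  obtain m' n' l' where q: "path5 w z m' n' l' s" using yz Y(1) by blast
  obtain S where S: "ip E S" "S \<noteq> []" "hd S = y" "last S = z" "odd (length S)"
    "set S \<subseteq> {y, z, m, n, l, m', n', l', s}" by (rule even_detour5[OF p q yz(3)])
  have *: "m \<notin> K \<and> n \<notin> K \<and> l \<notin> K \<and> m \<notin> Y \<and> n \<notin> Y \<and> l \<notin> Y \<and> w \<noteq> m \<and> w \<noteq> n \<and> w \<noteq> l"
    if "path5 w y m n l s" for y m n l
  proof -
    have e: "E w y" "E y m" "E m n" "E n l" "E l s" "distinct [w, y, m, n, l, s]" using that by (auto simp: path5_def)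
    have "\<not> E w m" "\<not> E w n" "\<not> E w l" using no3[of w y m] no4[of w y m n] no5[of w y m n l] e sym by auto
    then have "m \<notin> Y" "n \<notin> Y" "l \<notin> Y" "s \<notin> Y" using Y(1) s(3) by (auto simp: path5_def)
    then show ?thesis using K(4)[of m n] K(4)[of n l] K(4)[of l s] e s(2,4) by auto
  qed
  have "s \<notin> Y" using Y(1) s(3) by (auto simp: path5_def)
  moreover have "y \<noteq> w" "z \<noteq> w" using p q by (auto simp: path5_def)
  ultimately have "set S \<inter> K = {}" "w \<notin> set S" "set S \<inter> Y \<subseteq> {y, z}"
    using S(6) *[OF p] *[OF q] yz Y(2) s(2,4) by auto
  moreover have "{y, z} \<subseteq> set S" using S(2-4) hd_in_set last_in_set by blast
  ultimately show "\<exists>S. ip E S \<and> S \<noteq> [] \<and> hd S = y \<and> last S = z \<and>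
      odd (length S) \<and> set S \<inter> K = {} \<and> w \<notin> set S \<and> set S \<inter> Y = {y, z}"
    using S yz by blast
qed

lemma emb_component_att:
  assumes e: "emb E n (adj es) f" "wf_es es n" "unique_att E n f"
    and K: "conn E K" "K \<inter> f ` {..<n} = {}" and x: "x \<in> K" "E x (f i)" and y: "y \<in> K" "E y (f j)"
    and ij: "i < n" "j < n" "i \<noteq> j" and F: "\<And>v l. v \<in> K \<Longrightarrow> l < n \<Longrightarrow> E v (f l) \<Longrightarrow> l \<in> F \<union> {i, j}" "i \<notin> F" "j \<notin> F"
  obtains P where "ear E n f P F i j" "2 \<le> length P" "set P \<subseteq> K"
proof -
  obtain P where P: "ip E P" "P \<noteq> []" "set P \<subseteq> K" "E (hd P) (f i)" "E (last P) (f j)"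
    and A1: "\<And>v. v \<in> set P \<Longrightarrow> E v (f i) \<Longrightarrow> v = hd P" and B1: "\<And>v. v \<in> set P \<Longrightarrow> E v (f j) \<Longrightarrow> v = last P"
    by (rule geodesic[OF K(1) x(1), of "\<lambda>v. E v (f i)" y "\<lambda>v. E v (f j)", OF x(2) y]) (rule that)
  have "set P \<inter> f ` {..<n} = {}" using P(3) K(2) by blast
  moreover have "l \<in> F \<or> v = hd P \<and> l = i \<or> v = last P \<and> l = j" if "v \<in> set P" "l < n" "E v (f l)" for v l
    using F(1)[of v l] that P(3) A1[of v] B1[of v] by blast
  ultimately have "ear E n f P F i j" using P ij unfolding ear_def by blast
  moreover have "2 \<le> length P"
  proof (rule ccontr)
    assume "\<not> 2 \<le> length P"
    then have "hd P = last P" using P(2) by (cases P; cases "tl P") auto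
    moreover have "hd P \<notin> f ` {..<n}" using P(2,3) K(2) by (meson disjoint_iff hd_in_set subsetD)
    ultimately show False using unique_attD[OF e(3), of "hd P" i j] P(4,5) ij by simp
  qed
  ultimately show thesis using that P(3) by blast
qed

lemma ear_two_paths:
  assumes e: "emb E n T f" "ear E n f P F i j" "2 \<le> length P" and R: "ip T R" "set R \<subseteq> {..<n}" "hd R = i" "last R = j"
    "set R \<inter> F = {}" "R \<noteq> []"
  shows "okn (length P + length R)"
  using assms by (intro ear_hole[OF e(1,2)]) (auto simp: neq_Nil_conv)

lemma path4_emb:
  assumes "emb E n (adj es) f" "ip (adj es) [a, b, c, d, g]" "set [a, b, c, d, g] \<subseteq> {..<n}"
  shows "path4 (f a) (f b) (f c) (f d) (f g)"
proof -
  have "\<And>i j. i < n \<Longrightarrow> j < n \<Longrightarrow> E (f i) (f j) \<longleftrightarrow> adj es i j" and "inj_on f {..<n}"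
    using assms(1) by (auto simp: emb_def)
  moreover have "distinct [a, b, c, d, g]" by (rule ip_distinct[OF assms(2)])
  ultimately show ?thesis using assms(2,3) by (auto simp: path4_def inj_on_eq_iff)
qed

lemma path5_emb:
  assumes "emb E n (adj es) f" "ip (adj es) [a, b, c, d, g, h]" "set [a, b, c, d, g, h] \<subseteq> {..<n}"
  shows "path5 (f a) (f b) (f c) (f d) (f g) (f h)"
proof -
  have "\<And>i j. i < n \<Longrightarrow> j < n \<Longrightarrow> E (f i) (f j) \<longleftrightarrow> adj es i j" and "inj_on f {..<n}"
    using assms(1) by (auto simp: emb_def)
  moreover have "distinct [a, b, c, d, g, h]" by (rule ip_distinct[OF assms(2)])
  ultimately show ?thesis using assms(2,3) by (auto simp: path5_def inj_on_eq_iff)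
qed

end

subsection \<open>Thetas and pure ears\<close>

text \<open>\<open>R\<close> is the remainder of the path added to the heptagon, from the foot of an
  ear down to the neighbour of \<open>e\<close>. Appending it turns an ear of the theta into an ear
  of the heptagon.\<close>

definition prolong_ok :: "(nat \<times> nat) list \<Rightarrow> nat \<Rightarrow> nat list \<Rightarrow> nat \<Rightarrow> bool" where
  "prolong_ok es n R e \<longleftrightarrow> ip (adj es) R \<and> R \<noteq> [] \<and> list_all (\<lambda>i. 7 \<le> i \<and> i < n) R \<and>
    (\<forall>i \<in> set R. \<forall>l \<in> set [0..<7]. adj es i l \<longleftrightarrow> i = last R \<and> l = e)"

lemma prolong_check:
  "prolong_ok E255 11 [9, 10] 2" "prolong_ok E255 11 [8, 7] 0" "prolong_ok E255 11 [10] 2"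
  by code_simp+

context heptag_cut
begin

lemma short_att:
  assumes e: "emb E n (adj es) f" and w: "wf_es es n"
    and v: "v \<notin> f ` {..<n}" "i < n" "E v (f i)" "j < n" "E v (f j)" and R: "R \<in> set (paths 5 es [] i j)"
  shows "i = j"
proof (rule ccontr)
  assume ij: "i \<noteq> j"
  have *: "ip (adj es) R" "R \<noteq> []" "hd R = i" "last R = j" using paths_sound[OF wf_irr[OF w] R] by auto
  have rng: "set R \<subseteq> {..<n}" using paths_bdd[OF w R] v by blast
  have m: "ip E (map f R)"
    by (rule ip_map[OF *(1)]) (use e rng in \<open>auto simp: emb_def intro: inj_on_subset\<close>)
  have "2 \<le> length R" using * ij by (cases R; cases "tl R") auto
  moreover have "v \<notin> set (map f R)" using v(1) rng by auto
  ultimately have "7 \<le> length (v # map f R)"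
    using m * v ip_successively[OF m] ip_distinct[OF m] sym
    by (intro girth) (auto simp: successively_Cons hd_map last_map)
  then show False using paths_length[OF R] by simp
qed

text \<open>The component at 5, the middle of a path of length 4, cannot reach beyond 4, 5, 6: an
  ear from 4 to 1 or from 6 to 2 starts in a deleted leaf, and every other surviving ear completes
  \<open>E12\<close> or \<open>E12b\<close>. As it cannot touch the sides of both 4 and 6, one of
  the stars separates it from \<open>f 1\<close> or \<open>f 2\<close>.\<close>

lemma no_T344: "\<not> emb E 10 (adj E344) f"
proof
  assume e: "emb E 10 (adj E344) f"
  have T: "\<And>i j. i < 10 \<Longrightarrow> j < 10 \<Longrightarrow> E (f i) (f j) \<longleftrightarrow> adj E344 i j" using e by (auto simp: emb_def)
  note eq = emb_eq[OF e]
  have uqa: "unique_att E 10 f" by (rule diam4_unique_att[OF e diam4_344 wf_E(2)])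
  note uq = unique_attD[OF uqa]
  \<comment> \<open>\<open>Y\<close> and \<open>Y'\<close> are the possible first vertices of the
    surviving ears from 4 to 1 and from 6 to 2, together with \<open>f 5\<close>, which occupies the
    same position in the theta itself.\<close>
  define Y where "Y = {y. \<exists>m n. path4 (f 4) y m n (f 1)}"
  define Y' where "Y' = {y. \<exists>m n. path4 (f 6) y m n (f 2)}"
  define S where "S = f ` {..<10} \<union> Y \<union> Y'"
  have YE: "E (f 4) y" if "y \<in> Y" for y using that by (auto simp: Y_def path4_def)
  have YE': "E (f 6) y" if "y \<in> Y'" for y using that by (auto simp: Y'_def path4_def)
  have 5: "f 5 \<in> Y" "f 5 \<in> Y'"
  proof -
    have "path4 (f 4) (f 5) (f 6) (f 0) (f 1)"
      by (rule path4_emb[OF e]) (auto simp: adj_def E344_def E7_def)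
    moreover have "path4 (f 6) (f 5) (f 4) (f 3) (f 2)"
      by (rule path4_emb[OF e]) (auto simp: adj_def E344_def E7_def)
    ultimately show "f 5 \<in> Y" "f 5 \<in> Y'" unfolding Y_def Y'_def by blast+
  qed
  have E54: "E (f 5) (f 4)" "E (f 5) (f 6)" using T by (auto simp: adj_def E344_def E7_def)
  obtain r where r: "E (f 5) r" "r \<in> V - f ` {..<10}"
    by (rule third[OF e, of 5 4 6]) (auto simp: adj_def E344_def E7_def)
  have "r \<notin> Y" "r \<notin> Y'" using YE[of r] YE'[of r] no3[of "f 5" "f 4" r] no3[of "f 5" "f 6" r] E54 r(1) sym by blast+
  then have rS: "r \<in> V - S" using r by (auto simp: S_def)
  let ?K = "component E (V - S) r"
  have Ksub: "?K \<subseteq> V - S" by (rule component_subset)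
  have FS: "f ` {..<10} \<subseteq> S" by (auto simp: S_def)
  have KF: "?K \<inter> f ` {..<10} = {}" using Ksub FS by blast
  have rK: "r \<in> ?K" by (rule component_self[OF rS])
  have fV: "f i \<in> V" if i: "i < 10" for i
  proof -
    have "i \<in> set [0..<10]" using i by simp
    then obtain j where "j \<in> set [0..<10]" "adj E344 i j" using only_check2(7) by blast
    then show ?thesis using emb_V[OF e i, of j] by simp
  qed
  have first: "hd P \<in> Y" if P: "ear E 10 f P {} 4 1" "length P = 3" for P
  proof -
    obtain x y z where xyz: "P = [x, y, z]" using P(2) by (auto simp: length_Suc_conv numeral_eq_Suc)
    have "E x (f 4)" "E z (f 1)" "ip E P" "set P \<inter> f ` {..<10} = {}" using P(1) xyz by (auto simp: ear_def)
    then have "path4 (f 4) x y z (f 1)" using xyz eq[of 4 1] sym by (auto simp: path4_def)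
    then show ?thesis using xyz by (auto simp: Y_def)
  qed
  have first': "hd P \<in> Y'" if P: "ear E 10 f P {} 6 2" "length P = 3" for P
  proof -
    obtain x y z where xyz: "P = [x, y, z]" using P(2) by (auto simp: length_Suc_conv numeral_eq_Suc)
    have "E x (f 6)" "E z (f 2)" "ip E P" "set P \<inter> f ` {..<10} = {}" using P(1) xyz by (auto simp: ear_def)
    then have "path4 (f 6) x y z (f 2)" using xyz eq[of 6 2] sym by (auto simp: path4_def)
    then show ?thesis using xyz by (auto simp: Y'_def)
  qed
  have att: "t \<in> {4, 5, 6}" if x: "x \<in> ?K" "E x (f t)" "t < 10" for x t
  proof (rule ccontr)
    assume "t \<notin> {4, 5, 6}"
    then have tn: "t \<notin> set [4, 5, 6]" by simp
    obtain P z s where P: "(z, s) \<in> set [(4,1),(6,2),(5,8),(4,7),(6,9)]" "set P \<subseteq> ?K" "ear E 10 f P {} z s"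
      by (rule component_exit[OF e wf_E(2) exit_344 uqa _ _ FS rS r(1) x tn]) auto
    have hdK: "hd P \<in> ?K" using P(2,3) hd_in_set unfolding ear_def by blast
    consider "z = 4" "s = 1" | "z = 6" "s = 2" | "z = 5" "s = 8" | "z = 4" "s = 7" | "z = 6" "s = 9"
      using P(1) by auto
    then show False
    proof cases
      case 1
      then show False using first[of P] ear_only[OF e wf_E(2) P(3), of 3] only_check(6) P(3) hdK Ksub
        by (auto simp: S_def)
    next
      case 2
      then show False using first'[of P] ear_only[OF e wf_E(2) P(3), of 3] only_check2(1) P(3) hdK Ksub
        by (auto simp: S_def)
    next
      case 3
      then have "length P = 2" using ear_only[OF e wf_E(2) P(3), of 2] only_check(4) by auto
      then have "emb E 12 (adj E12) (\<lambda>i. if i < 10 then f i else P ! (i - 10))"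
        using emb_ear[OF e P(3)] ext_12 3 by simp
      then show False using no_H12 by blast
    next
      case 4
      then have "length P = 2" using ear_only[OF e wf_E(2) P(3), of 2] only_check(5) by auto
      then have "emb E 12 (adj E12b) (\<lambda>i. if i < 10 then f i else P ! (i - 10))"
        using emb_ear[OF e P(3)] ext_12b 4 by simp
      then show False using no_H12b by blast
    next
      case 5
      then have "length P = 2" using ear_only[OF e wf_E(2) P(3), of 2] only_check2(2) by auto
      then have "emb E 12 (adj (E344 @ [(6,10),(10,11),(11,9)])) (\<lambda>i. if i < 10 then f i else P ! (i - 10))"
        using emb_ear[OF e P(3)] only_check2(4) 5 by simp
      from sub_embD[OF this only_check2(5)]
      show False using no_H12b by (simp add: numeral_eq_Suc)
    qed
  qed
  have both: False if K': "conn E K'" "K' \<inter> f ` {..<10} = {}" "\<And>v l. v \<in> K' \<Longrightarrow> l < 10 \<Longrightarrow> E v (f l) \<Longrightarrow> l \<in> {4, 5, 6}"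
    and x: "x \<in> K'" "E x (f 6)" and y: "y \<in> K'" "E y (f 4)" for K' x y
  proof -
    obtain P where P: "ear E 10 f P {5} 6 4" "2 \<le> length P"
      by (rule emb_component_att[OF e wf_E(2) uqa K'(1,2) x y, of "{5}"]) (use K'(3) in auto)
    \<comment> \<open>The completions have 6 and 7 vertices. Both holes are longer than 7, so both
      totals would have to be even.\<close>
    have "okn (length P + length [6,0,1,2,3,4::nat])"
      by (rule ear_two_paths[OF e P]) (auto simp: adj_def E344_def E7_def)
    moreover have "okn (length P + length [6,0,7,8,9,3,4::nat])"
      by (rule ear_two_paths[OF e P]) (auto simp: adj_def E344_def E7_def)
    ultimately show False using P(2) by (auto simp: okn_def)
  qed
  have out: "y \<notin> f ` {..<10}" if y: "y \<in> Y" "y \<noteq> f 5" "u \<in> ?K" "E u y" for y u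
  proof
    assume "y \<in> f ` {..<10}"
    then obtain l where l: "l < 10" "y = f l" by auto
    then have "l = 3 \<or> l = 5" using YE[OF y(1)] T[of 4 l] by (auto simp: adj_def E344_def E7_def)
    then show False using att[of u l] y l by auto
  qed
  have out': "y \<notin> f ` {..<10}" if y: "y \<in> Y'" "y \<noteq> f 5" "u \<in> ?K" "E u y" for y u
  proof
    assume "y \<in> f ` {..<10}"
    then obtain l where l: "l < 10" "y = f l" by auto
    then have "l = 0 \<or> l = 5" using YE'[OF y(1)] T[of 6 l] by (auto simp: adj_def E344_def E7_def)
    then show False using att[of u l] y l by auto
  qed
  have yatt: "l = 4" if "y \<in> Y" "y \<notin> f ` {..<10}" "l < 10" "E y (f l)" for y l
    using uq[of y l 4] that YE[of y] sym by auto
  have yatt': "l = 6" if "y \<in> Y'" "y \<notin> f ` {..<10}" "l < 10" "E y (f l)" for y l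
    using uq[of y l 6] that YE'[of y] sym by auto
  have conn1: "conn E {y}" for y using conn_ip[of "[y]"] by simp
  \<comment> \<open>The component touches the side of 4 either directly or through a leaf other than
    \<open>f 5\<close>.\<close>
  let ?N4 = "(\<exists>u \<in> ?K. E u (f 4)) \<or> (\<exists>u \<in> ?K. \<exists>y \<in> Y. y \<noteq> f 5 \<and> E u y)"
  let ?N6 = "(\<exists>u \<in> ?K. E u (f 6)) \<or> (\<exists>u \<in> ?K. \<exists>y \<in> Y'. y \<noteq> f 5 \<and> E u y)"
  \<comment> \<open>Such a leaf can be added to the connected set: apart from its centre it has no
    contact with the theta.\<close>
  have grow4: "\<exists>K' y. conn E K' \<and> K \<subseteq> K' \<and> K' \<inter> f ` {..<10} = {} \<and>
      (\<forall>v \<in> K'. \<forall>l<10. E v (f l) \<longrightarrow> l \<in> {4, 5, 6}) \<and> y \<in> K' \<and> E y (f 4)"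
    if N: ?N4 and K: "conn E K" "?K \<subseteq> K" "K \<inter> f ` {..<10} = {}" "\<forall>v \<in> K. \<forall>l<10. E v (f l) \<longrightarrow> l \<in> {4, 5, 6}" for K
    using N
  proof
    assume "\<exists>u \<in> ?K. E u (f 4)"
    then show ?thesis using K by blast
  next
    assume "\<exists>u \<in> ?K. \<exists>y \<in> Y. y \<noteq> f 5 \<and> E u y"
    then obtain u y where u: "u \<in> ?K" "y \<in> Y" "y \<noteq> f 5" "E u y" by blast
    note o = out[OF u(2,3,1,4)]
    have "conn E (K \<union> {y})" using conn_Un[OF K(1) conn1, of u y y] u K(2) by blast
    moreover have "(K \<union> {y}) \<inter> f ` {..<10} = {}" using K(3) o by blast
    moreover have "\<forall>v \<in> K \<union> {y}. \<forall>l<10. E v (f l) \<longrightarrow> l \<in> {4, 5, 6}" using K(4) yatt[OF u(2) o] by blast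
    moreover have "E y (f 4)" using YE[OF u(2)] sym by blast
    ultimately show ?thesis by blast
  qed
  have grow6: "\<exists>K' x. conn E K' \<and> K \<subseteq> K' \<and> K' \<inter> f ` {..<10} = {} \<and>
      (\<forall>v \<in> K'. \<forall>l<10. E v (f l) \<longrightarrow> l \<in> {4, 5, 6}) \<and> x \<in> K' \<and> E x (f 6)"
    if N: ?N6 and K: "conn E K" "?K \<subseteq> K" "K \<inter> f ` {..<10} = {}" "\<forall>v \<in> K. \<forall>l<10. E v (f l) \<longrightarrow> l \<in> {4, 5, 6}" for K
    using N
  proof
    assume "\<exists>u \<in> ?K. E u (f 6)"
    then show ?thesis using K by blast
  next
    assume "\<exists>u \<in> ?K. \<exists>y \<in> Y'. y \<noteq> f 5 \<and> E u y"
    then obtain u y where u: "u \<in> ?K" "y \<in> Y'" "y \<noteq> f 5" "E u y" by blast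
    note o = out'[OF u(2,3,1,4)]
    have "conn E (K \<union> {y})" using conn_Un[OF K(1) conn1, of u y y] u K(2) by blast
    moreover have "(K \<union> {y}) \<inter> f ` {..<10} = {}" using K(3) o by blast
    moreover have "\<forall>v \<in> K \<union> {y}. \<forall>l<10. E v (f l) \<longrightarrow> l \<in> {4, 5, 6}" using K(4) yatt'[OF u(2) o] by blast
    moreover have "E y (f 6)" using YE'[OF u(2)] sym by blast
    ultimately show ?thesis by blast
  qed
  have "\<not> (?N4 \<and> ?N6)"
  proof
    assume N: "?N4 \<and> ?N6"
    have "\<forall>v \<in> ?K. \<forall>l<10. E v (f l) \<longrightarrow> l \<in> {4, 5, 6}" using att by blast
    then obtain K1 y where K1: "conn E K1" "?K \<subseteq> K1" "K1 \<inter> f ` {..<10} = {}"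
      "\<forall>v \<in> K1. \<forall>l<10. E v (f l) \<longrightarrow> l \<in> {4, 5, 6}" "y \<in> K1" "E y (f 4)"
      using grow4[of ?K] N conn_component KF by blast
    obtain K2 x where K2: "conn E K2" "K1 \<subseteq> K2" "K2 \<inter> f ` {..<10} = {}"
      "\<forall>v \<in> K2. \<forall>l<10. E v (f l) \<longrightarrow> l \<in> {4, 5, 6}" "x \<in> K2" "E x (f 6)"
      using grow6[OF conjunct2[OF N] K1(1-4)] by blast
    show False by (rule both[OF K2(1,3) _ K2(5,6), of y]) (use K1 K2 in blast)+
  qed
  moreover have step: "w \<in> ?K \<or> w \<in> S" if "u \<in> ?K" "E u w" for u w
    using component_step[of u "V - S" r w] that inV2 by blast
  moreover have False if "\<not> ?N6"
  proof (rule star_cut4[OF _ Y_def])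
    show "f 4 \<notin> ?K" "f 1 \<notin> ?K" "Y \<inter> ?K = {}" using Ksub FS by (auto simp: S_def)
    show "conn E ?K" "?K \<noteq> {}" "?K \<subseteq> V" using conn_component rK Ksub by blast+
    show "y \<in> ?K \<or> y = f 4 \<or> y \<in> Y" if u: "u \<in> ?K" "E u y" for u y
    proof -
      have "y \<in> f ` {..<10} \<Longrightarrow> y = f 5 \<or> y = f 4 \<or> y = f 6" using att[of u] u by auto
      then show ?thesis using step[OF u] u \<open>\<not> ?N6\<close> 5 by (auto simp: S_def)
    qed
  qed (use fV T eq in \<open>auto simp: adj_def E344_def E7_def\<close>)
  moreover have False if "\<not> ?N4"
  proof (rule star_cut4[OF _ Y'_def])
    show "f 6 \<notin> ?K" "f 2 \<notin> ?K" "Y' \<inter> ?K = {}" using Ksub FS by (auto simp: S_def)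
    show "conn E ?K" "?K \<noteq> {}" "?K \<subseteq> V" using conn_component rK Ksub by blast+
    show "y \<in> ?K \<or> y = f 6 \<or> y \<in> Y'" if u: "u \<in> ?K" "E u y" for u y
    proof -
      have "y \<in> f ` {..<10} \<Longrightarrow> y = f 5 \<or> y = f 4 \<or> y = f 6" using att[of u] u by auto
      then show ?thesis using step[OF u] u \<open>\<not> ?N4\<close> 5 by (auto simp: S_def)
    qed
  qed (use fV T eq in \<open>auto simp: adj_def E344_def E7_def\<close>)
  ultimately show False by blast
qed

lemma no_jump3: "\<not> jump3"
proof
  assume jump3
  then obtain f P where f: "hep f" "ear E 7 f P {} 0 3" unfolding jump3_def by blast
  have "2 \<le> length P"
  proof (rule ccontr)
    assume "\<not> 2 \<le> length P"
    moreover have "P \<noteq> []" using f(2) by (simp add: ear_def)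
    ultimately obtain x where x: "P = [x]" by (cases P; cases "tl P") auto
    have "okn (length P + length [0,1,2,3::nat])"
      by (rule ear_hole[OF f]) (auto simp: adj_def E7_def x)
    then show False using x by (simp add: okn_def)
  qed
  \<comment> \<open>Completions with 4 and 5 vertices: the odd total must be 7, and 2 + 5 is ruled
    out because 2 + 4 is below the girth. So \<open>P\<close> has 3 vertices.\<close>
  have "okn (length P + length [0,1,2,3::nat])" "okn (length P + length [0,6,5,4,3::nat])"
    by (rule ear_two_paths[OF f \<open>2 \<le> length P\<close>]; auto simp: adj_def E7_def)+
  then have "length P = 3" by (auto simp: okn_def)
  then have "emb E 10 (adj E344) (\<lambda>i. if i < 7 then f i else P ! (i - 7))"
    using emb_ear[OF f] ext_344 by simp
  then show False using no_T344 by blast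
qed

lemma ear_prolong:
  assumes e: "emb E n (adj es) f" and P: "ear E n f P {} z t" and n: "7 \<le> n" "z < 7" "e < 7"
    and ok: "prolong_ok es n R e" "hd R = t"
  shows "ear E 7 f (P @ map f R) {} z e"
proof -
  have R: "ip (adj es) R" "R \<noteq> []" "hd R = t" "set R \<subseteq> {7..<n}"
    and att: "\<And>i l. i \<in> set R \<Longrightarrow> l < 7 \<Longrightarrow> adj es i l \<longleftrightarrow> i = last R \<and> l = e"
    using ok by (auto simp: prolong_ok_def list_all_iff)
  have T: "\<And>i j. i < n \<Longrightarrow> j < n \<Longrightarrow> E (f i) (f j) \<longleftrightarrow> adj es i j" and inj: "inj_on f {..<n}"
    using e by (auto simp: emb_def)
  have sR: "set R \<subseteq> {..<n}" using R(4) by auto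
  have p: "ip E P" "P \<noteq> []" "set P \<inter> f ` {..<n} = {}" "E (hd P) (f z)" "E (last P) (f t)"
    and pa: "\<And>v l. v \<in> set P \<Longrightarrow> l < n \<Longrightarrow> E v (f l) \<Longrightarrow> v = hd P \<and> l = z \<or> v = last P \<and> l = t"
    using P unfolding ear_def by blast+
  have t7: "7 \<le> t" "t < n" using R hd_in_set by fastforce+
  have m: "ip E (map f R)"
    by (rule ip_map[OF R(1) inj_on_subset[OF inj sR]]) (use T sR in blast)
  have "ip E (P @ map f R)"
  proof (rule ip_append[OF sym p(1) m p(2)])
    show "map f R \<noteq> []" using R by simp
    show "set P \<inter> set (map f R) = {}" using p(3) sR by auto
    show "E x y = (x = last P \<and> y = hd (map f R))" if "x \<in> set P" "y \<in> set (map f R)" for x y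
    proof -
      obtain l where l: "l \<in> set R" "y = f l" using \<open>y \<in> set (map f R)\<close> by auto
      have "l < n" "7 \<le> l" using l(1) R(4) by auto
      have "hd (map f R) = f t" using R by (simp add: hd_map)
      moreover have "f l = f t \<longleftrightarrow> l = t" using inj \<open>l < n\<close> t7 by (auto simp: inj_on_def)
      ultimately show ?thesis using pa[OF that(1) \<open>l < n\<close>] l p(5) n \<open>7 \<le> l\<close> by auto
    qed
  qed
  moreover have "set (P @ map f R) \<inter> f ` {..<7} = {}"
  proof -
    have "set P \<inter> f ` {..<7} = {}" using p(3) n(1) by fastforce
    moreover have "f ` set R \<inter> f ` {..<7} = {}"
      using inj R(4) n(1) by (auto simp: inj_on_def) (metis atLeastLessThan_iff leD lessThan_iff less_le_trans subsetD)
    ultimately show ?thesis by auto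
  qed
  moreover have lr: "last (map f R) = f (last R)" "last R \<in> set R" using R by (auto simp: last_map)
  moreover have "E (f (last R)) (f e)"
    using T[of "last R" e] att[of "last R" e] lr(2) R(4) n by auto
  moreover have "v = hd (P @ map f R) \<and> l = z \<or> v = last (P @ map f R) \<and> l = e"
    if v: "v \<in> set (P @ map f R)" "l < 7" "E v (f l)" for v l
  proof (cases "v \<in> set P")
    case True
    then show ?thesis using pa[of v l] v n t7 p(2) by auto
  next
    case False
    then obtain i where i: "i \<in> set R" "v = f i" using v(1) by auto
    then have "adj es i l" using T[of i l] v R(4) n by auto
    then show ?thesis using att[OF i(1) v(2)] i lr R(2) by auto
  qed
  ultimately show ?thesis unfolding ear_def using p(2,4) n R(2) by auto
qed

lemma ear_restrict:
  assumes "ear E n f P {} z t" "7 \<le> n" "z < 7" "t < 7"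
  shows "ear E 7 f P {} z t"
proof -
  have "f ` {..<7} \<subseteq> f ` {..<n}" using assms(2) by auto
  then show ?thesis using assms unfolding ear_def by (meson disjoint_iff less_le_trans subsetD)
qed

text \<open>A path of length 5 has no middle vertex, so 4, 5, 6 lie asymmetrically and one star,
  centred at 6, is enough. If the component at 5 sees 4, it can see neither 6 nor a leaf other than
  \<open>f 5\<close> and hangs on the path 4, 5, 6; otherwise the star cuts it off. The remaining
  exits are pure ears of the heptagon between vertices at distance 3, some of them after
  prolongation.\<close>

lemma no_T255: "\<not> emb E 11 (adj E255) f"
proof
  assume e: "emb E 11 (adj E255) f"
  have T: "\<And>i j. i < 11 \<Longrightarrow> j < 11 \<Longrightarrow> E (f i) (f j) \<longleftrightarrow> adj E255 i j" using e by (auto simp: emb_def)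
  note eq = emb_eq[OF e]
  have hp: "hep f"
    using e by (auto simp: emb_def inj_on_def adj_def E255_def)
  have near: "near 3 5 2" "near 3 4 0" "near 3 6 2" "near 3 5 1" "near 3 4 1" by (auto simp: near_def)
  \<comment> \<open>For the two pairs at distance 5, \<open>v\<close> together with the way from 9
    or 8 down to the heptagon is a pure ear from 5 to 2 or from 4 to 0, both at distance 3.\<close>
  have single: False if v: "v \<notin> f ` {..<11}" "E v (f i)" "E v (f j)" "(i, j) \<in> {(5, 9), (4, 8)}" for v i j
  proof -
    have other: "l = i \<or> l = j" if l: "l < 11" "E v (f l)" for l
    proof (rule ccontr)
      assume n: "\<not> (l = i \<or> l = j)"
      have "\<exists>a b. (a = l \<and> (b = i \<or> b = j)) \<and> paths 5 E255 [] a b \<noteq> []"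
      proof -
        have "l \<in> set [0..<11]" "i \<in> set [0..<11]" "j \<in> set [0..<11]" using l v(4) by auto
        then have "paths 5 E255 [] l i \<noteq> [] \<or> paths 5 E255 [] l j \<noteq> []"
          using only_check2(6) n v(4) by fastforce
        then show ?thesis by blast
      qed
      then obtain b R where R: "R \<in> set (paths 5 E255 [] l b)" "b = i \<or> b = j"
        by (metis list.set_intros(1) neq_Nil_conv)
      then show False using short_att[OF e wf_E(3) v(1) l(1) l(2) _ _ R(1)] v n by auto
    qed
    show False
    proof (cases "i = 5")
      case True
      then have ij: "i = 5" "j = 9" using v(4) by auto
      have "ear E 11 f [v] {} 5 9" using v ij other by (auto simp: ear_def)
      from ear_prolong[OF e this _ _ _ prolong_check(1)] have "ear E 7 f ([v] @ map f [9, 10]) {} 5 2"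
        by simp
      then show False using jump3I[OF hp _ near(1)] no_jump3 by blast
    next
      case False
      then have ij: "i = 4" "j = 8" using v(4) by auto
      have "ear E 11 f [v] {} 4 8" using v ij other by (auto simp: ear_def)
      from ear_prolong[OF e this _ _ _ prolong_check(2)] have "ear E 7 f ([v] @ map f [8, 7]) {} 4 0"
        by simp
      then show False using jump3I[OF hp _ near(2)] no_jump3 by blast
    qed
  qed
  have uqa: "unique_att E 11 f"
    unfolding unique_att_def
  proof (intro allI impI, rule ccontr)
    fix v i j assume v: "v \<notin> f ` {..<11}" "i < 11" "j < 11" "E v (f i)" "E v (f j)" "i \<noteq> j"
    then have "i \<in> set [0..<11]" "j \<in> set [0..<11]" by auto
    then consider "paths 5 E255 [] i j \<noteq> []" | "(i, j) \<in> {(5, 9), (4, 8)}" | "(j, i) \<in> {(5, 9), (4, 8)}"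
      using only_check2(6) v(6) by fastforce
    then show False
    proof cases
      case 1
      then obtain R where R: "R \<in> set (paths 5 E255 [] i j)" by (metis list.set_intros(1) neq_Nil_conv)
      show False using short_att[OF e wf_E(3) v(1,2,4,3,5) R] v(6) by blast
    next
      case 2 then show False using single v by blast
    next
      case 3 then show False using single v by blast
    qed
  qed
  note uq = unique_attD[OF uqa]
  define Y where "Y = {y. \<exists>m n l. path5 (f 6) y m n l (f 1)}"
  define S where "S = f ` {..<11} \<union> Y"
  have YE: "E (f 6) y" if "y \<in> Y" for y using that by (auto simp: Y_def path5_def)
  have 5: "f 5 \<in> Y"
  proof -
    have "path5 (f 6) (f 5) (f 4) (f 3) (f 2) (f 1)"
      by (rule path5_emb[OF e]) (auto simp: adj_def E255_def E7_def)
    then show ?thesis unfolding Y_def by blast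
  qed
  have E56: "E (f 5) (f 6)" using T by (auto simp: adj_def E255_def E7_def)
  obtain r where r: "E (f 5) r" "r \<in> V - f ` {..<11}"
    by (rule third[OF e, of 5 4 6]) (auto simp: adj_def E255_def E7_def)
  have "r \<notin> Y" using YE[of r] no3[of "f 5" "f 6" r] E56 r(1) sym by blast
  then have rS: "r \<in> V - S" using r by (auto simp: S_def)
  let ?K = "component E (V - S) r"
  have Ksub: "?K \<subseteq> V - S" by (rule component_subset)
  have FS: "f ` {..<11} \<subseteq> S" by (auto simp: S_def)
  have KF: "?K \<inter> f ` {..<11} = {}" using Ksub FS by blast
  have rK: "r \<in> ?K" by (rule component_self[OF rS])
  have fV: "f i \<in> V" if i: "i < 11" for i
  proof -
    have "i \<in> set [0..<11]" using i by simp
    then obtain j where "j \<in> set [0..<11]" "adj E255 i j" using only_check2(8) by blast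
    then show ?thesis using emb_V[OF e i, of j] by simp
  qed
  have first: "hd P \<in> Y" if P: "ear E 11 f P {} 6 1" "length P = 4" for P
  proof -
    obtain x y z u where xyz: "P = [x, y, z, u]" using P(2) by (auto simp: length_Suc_conv numeral_eq_Suc)
    have "E x (f 6)" "E u (f 1)" "ip E P" "set P \<inter> f ` {..<11} = {}" using P(1) xyz by (auto simp: ear_def)
    then have "path5 (f 6) x y z u (f 1)" using xyz eq[of 6 1] sym by (auto simp: path5_def)
    then show ?thesis using xyz by (auto simp: Y_def)
  qed
  have att: "t \<in> {4, 5, 6}" if x: "x \<in> ?K" "E x (f t)" "t < 11" for x t
  proof (rule ccontr)
    assume "t \<notin> {4, 5, 6}"
    then have tn: "t \<notin> set [4, 5, 6]" by simp
    obtain P z s where P: "(z, s) \<in> set [(6,1),(6,2),(6,10),(5,1),(5,9),(4,1)]" "set P \<subseteq> ?K" "ear E 11 f P {} z s"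
      by (rule component_exit[OF e wf_E(3) exit_255 uqa _ _ FS rS r(1) x tn]) auto
    have hdK: "hd P \<in> ?K" using P(2,3) hd_in_set unfolding ear_def by blast
    consider "z = 6" "s = 1" | "near 3 z s" "z < 7" "s < 7" | "z = 6" "s = 10" | "z = 5" "s = 9"
      using P(1) near by auto
    then show False
    proof cases
      case 1
      then show False using first[of P] ear_only[OF e wf_E(3) P(3), of 4] only_check2(3) P(3) hdK Ksub
        by (auto simp: S_def)
    next
      case 2
      then show False using jump3I[OF hp ear_restrict[OF P(3)]] no_jump3 by auto
    next
      case 3
      then have "ear E 7 f (P @ map f [10]) {} 6 2"
        using ear_prolong[OF e P(3) _ _ _ prolong_check(3)] by simp
      then show False using jump3I[OF hp _ near(3)] no_jump3 by blast
    next
      case 4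
      then have "ear E 7 f (P @ map f [9, 10]) {} 5 2"
        using ear_prolong[OF e P(3) _ _ _ prolong_check(1)] by simp
      then show False using jump3I[OF hp _ near(1)] no_jump3 by blast
    qed
  qed
  have both: False if K': "conn E K'" "K' \<inter> f ` {..<11} = {}" "\<And>v l. v \<in> K' \<Longrightarrow> l < 11 \<Longrightarrow> E v (f l) \<Longrightarrow> l \<in> {4, 5, 6}"
    and x: "x \<in> K'" "E x (f 6)" and y: "y \<in> K'" "E y (f 4)" for K' x y
  proof -
    obtain P where P: "ear E 11 f P {5} 6 4" "2 \<le> length P"
      by (rule emb_component_att[OF e wf_E(3) uqa K'(1,2) x y, of "{5}"]) (use K'(3) in auto)
    have "okn (length P + length [6,0,1,2,3,4::nat])"
      by (rule ear_two_paths[OF e P]) (auto simp: adj_def E255_def E7_def)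
    moreover have "okn (length P + length [6,0,7,8,9,10,2,3,4::nat])"
      by (rule ear_two_paths[OF e P]) (auto simp: adj_def E255_def E7_def)
    ultimately show False using P(2) by (auto simp: okn_def)
  qed
  have step: "w \<in> ?K \<or> w \<in> S" if "u \<in> ?K" "E u w" for u w
    using component_step[of u "V - S" r w] that inV2 by blast
  show False
  proof (cases "\<exists>u \<in> ?K. E u (f 4)")
    case False
    show False
    proof (rule star_cut5[OF _ Y_def])
      show "f 6 \<notin> ?K" "f 1 \<notin> ?K" "Y \<inter> ?K = {}" using Ksub FS by (auto simp: S_def)
      show "conn E ?K" "?K \<noteq> {}" "?K \<subseteq> V" using conn_component rK Ksub by blast+
      show "y \<in> ?K \<or> y = f 6 \<or> y \<in> Y" if u: "u \<in> ?K" "E u y" for u y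
      proof -
        have "y \<in> f ` {..<11} \<Longrightarrow> y = f 5 \<or> y = f 4 \<or> y = f 6" using att[of u] u by auto
        then show ?thesis using step[OF u] u False 5 by (auto simp: S_def)
      qed
    qed (use fV T eq in \<open>auto simp: adj_def E255_def E7_def\<close>)
  next
    case True
    then obtain u4 where u4: "u4 \<in> ?K" "E u4 (f 4)" by blast
    have no6: "\<not> E u (f 6)" if "u \<in> ?K" for u
      using both[OF conn_component KF _ that _ u4] att by blast
    have noY: "y = f 5" if y: "y \<in> Y" "u \<in> ?K" "E u y" for y u
    proof (rule ccontr)
      assume n: "y \<noteq> f 5"
      have o: "y \<notin> f ` {..<11}"
      proof
        assume "y \<in> f ` {..<11}"
        then obtain l where l: "l < 11" "y = f l" by auto
        then have "l = 0 \<or> l = 5" using YE[OF y(1)] T[of 6 l] by (auto simp: adj_def E255_def E7_def)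
        then show False using att[of u l] y l n by auto
      qed
      have "conn E (?K \<union> {y})"
        using conn_Un[OF conn_component conn_ip[of "[y]"], of u _ _ y] y by auto
      moreover have "(?K \<union> {y}) \<inter> f ` {..<11} = {}" using KF o by blast
      moreover have "l \<in> {4, 5, 6}" if "v \<in> ?K \<union> {y}" "l < 11" "E v (f l)" for v l
        using att[of v l] uq[OF o, of l 6] that YE[OF y(1)] sym by auto
      moreover have "E y (f 6)" using YE[OF y(1)] sym by blast
      ultimately show False using both[of "?K \<union> {y}" y u4] u4 by blast
    qed
    show False
    proof (rule no_P3_component[OF rS, of "f 4" "f 5" "f 6" "f 3"])
      show "s \<in> {f 4, f 5, f 6}" if s: "v \<in> ?K" "s \<in> S" "E v s" for v s
      proof (cases "s \<in> Y")
        case True then show ?thesis using noY[OF True s(1,3)] by simp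
      next
        case False
        then obtain l where "l < 11" "s = f l" using s(2) by (auto simp: S_def)
        then show ?thesis using att[OF s(1)] s(3) by auto
      qed
    qed (use FS fV T eq in \<open>auto simp: adj_def E255_def E7_def\<close>)
  qed
qed

lemma no_jump2: "\<not> jump2"
proof
  assume jump2
  then obtain f P where f: "hep f" "ear E 7 f P {} 0 2" unfolding jump2_def by blast
  have "2 \<le> length P"
  proof (rule ccontr)
    assume "\<not> 2 \<le> length P"
    moreover have "P \<noteq> []" using f(2) by (simp add: ear_def)
    ultimately obtain x where x: "P = [x]" by (cases P; cases "tl P") auto
    have "okn (length P + length [0,1,2::nat])"
      by (rule ear_hole[OF f]) (auto simp: adj_def E7_def x)
    then show False using x by (simp add: okn_def)
  qed
  \<comment> \<open>Completions with 3 and 6 vertices: the odd total must be 7, and with at least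
    two vertices in \<open>P\<close> this means 4 + 3.\<close>
  have "okn (length P + length [0,1,2::nat])" "okn (length P + length [0,6,5,4,3,2::nat])"
    by (rule ear_two_paths[OF f \<open>2 \<le> length P\<close>]; auto simp: adj_def E7_def)+
  then have "length P = 4" using \<open>2 \<le> length P\<close> by (auto simp: okn_def)
  then have "emb E 11 (adj E255) (\<lambda>i. if i < 7 then f i else P ! (i - 7))"
    using emb_ear[OF f] ext_255 by simp
  then show False using no_T255 by blast
qed

end

subsection \<open>Two components attached to a heptagon\<close>

lemma dih_check2:
  "\<forall>is \<in> set dih. near 3 (is ! 0) (is ! 4) \<and> near 3 (is ! 6) (is ! 3) \<and> near 3 (is ! 2) (is ! 5) \<and>
     near 3 (is ! 5) (is ! 1)"
  "diam4 E7 7"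
  "[3,2,1,0,6,5,4] \<in> set dih" "[2,3,4,5,6,0,1] \<in> set dih" "[3,4,5,6,0,1,2] \<in> set dih"
  "\<forall>is \<in> set dih. 5 \<in> set (take 4 is) \<longrightarrow> take 4 is \<in> set [[2,3,4,5],[5,4,3,2],[3,4,5,6],[6,5,4,3],
     [4,5,6,0],[0,6,5,4],[5,6,0,1],[1,0,6,5]]"
  by code_simp+

context heptag
begin

lemma ear_rev: "ear E n f P F i j \<Longrightarrow> ear E n f (rev P) F j i"
  unfolding ear_def by (auto simp: hd_rev last_rev intro: ip_rev[OF sym])

lemma ear_seg:
  assumes P: "ear E n f P F i j" and ab: "a \<le> b" "b < length P" and l: "l < n" "m < n" "E (P ! a) (f l)" "E (P ! b) (f m)"
    and F: "\<And>x s. a \<le> x \<Longrightarrow> x \<le> b \<Longrightarrow> s < n \<Longrightarrow> E (P ! x) (f s) \<Longrightarrow> s \<in> F' \<or> x = a \<and> s = l \<or> x = b \<and> s = m"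
  shows "ear E n f (seg a b P) F' l m"
proof -
  have "set (seg a b P) \<subseteq> set P" using ab seg(4)[OF ab] by (auto intro!: nth_mem)
  then have "set (seg a b P) \<inter> f ` {..<n} = {}" using P unfolding ear_def by blast
  moreover have "ip E (seg a b P)" using P ip_seg unfolding ear_def by blast
  moreover have "seg a b P \<noteq> []" using seg(1)[OF ab] by auto
  moreover have "s \<in> F' \<or> v = hd (seg a b P) \<and> s = l \<or> v = last (seg a b P) \<and> s = m"
    if v: "v \<in> set (seg a b P)" "s < n" "E v (f s)" for v s
  proof -
    obtain x where x: "a \<le> x" "x \<le> b" "v = P ! x" using v(1) seg(4)[OF ab] by auto
    then show ?thesis using F[of x s] v seg(2,3)[OF ab] by auto
  qed
  ultimately show ?thesis using l seg(2,3)[OF ab] unfolding ear_def by simp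
qed

lemma ear_back:
  assumes "is \<in> set dih" "ear E 7 (\<lambda>i. f (is ! i)) P F a b"
  shows "ear E 7 f P ((!) is ` F) (is ! a) (is ! b)"
proof -
  have *: "length is = 7" "set is = set [0..<7]" using dih_check(1) assms(1) by blast+
  have lt: "is ! l < 7" if "l < 7" for l using that * nth_mem by fastforce
  note im = dih_image[OF assms(1), of f]
  have "l \<in> (!) is ` F \<or> v = hd P \<and> l = is ! a \<or> v = last P \<and> l = is ! b"
    if v: "v \<in> set P" "l < 7" "E v (f l)" for v l
  proof -
    have "l \<in> set is" using v(2) * by simp
    then obtain k where "k < 7" "l = is ! k" using * by (metis in_set_conv_nth)
    then show ?thesis using assms(2) v unfolding ear_def by blast
  qed
  moreover have "ip E P \<and> P \<noteq> [] \<and> set P \<inter> f ` {..<7} = {} \<and> a < 7 \<and> b < 7 \<and>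
      E (hd P) (f (is ! a)) \<and> E (last P) (f (is ! b))"
    using assms(2) unfolding ear_def im by (elim conjE) (intro conjI)
  ultimately show ?thesis using lt[of a] lt[of b] unfolding ear_def by simp
qed

lemma hep_unique: "hep f \<Longrightarrow> unique_att E 7 f"
  by (rule diam4_unique_att[OF _ dih_check2(2) wf_E(1)])

end

context heptag_cut
begin

lemma no_ear:
  assumes "hep f" "ear E 7 f P {} i j" "near 3 i j \<or> near 2 i j"
  shows False
  using assms jump3I jump2I no_jump3 no_jump2 by blast

lemma ear_out:
  assumes "ear E n f P F i j" "x < length P" shows "P ! x \<notin> f ` {..<n}"
  using assms nth_mem unfolding ear_def by blast

lemma ear_pure:
  assumes "ear E n f P F i j" "\<And>v l. v \<in> set P \<Longrightarrow> l \<in> F \<Longrightarrow> \<not> E v (f l)"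
  shows "ear E n f P {} i j"
proof -
  have "l \<in> {} \<or> v = hd P \<and> l = i \<or> v = last P \<and> l = j" if "v \<in> set P" "l < n" "E v (f l)" for v l
    using assms(2)[of v l] that assms(1) unfolding ear_def by blast
  then show ?thesis using assms(1) unfolding ear_def by simp
qed

lemma ear_ends:
  assumes P: "ear E 7 f P F i j" and f: "hep f"
  shows "0 < length P" "E (P ! 0) (f i)" "E (P ! (length P - 1)) (f j)" "i < 7" "j < 7" "ip E P"
    "set P \<inter> f ` {..<7} = {}"
    and "\<And>l. l < 7 \<Longrightarrow> E (P ! 0) (f l) \<Longrightarrow> l = i" "\<And>l. l < 7 \<Longrightarrow> E (P ! (length P - 1)) (f l) \<Longrightarrow> l = j"
    and "\<And>x l. x < length P \<Longrightarrow> l < 7 \<Longrightarrow> E (P ! x) (f l) \<Longrightarrow> l \<in> F \<or> x = 0 \<and> l = i \<or> x = length P - 1 \<and> l = j"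
proof -
  note uq = unique_attD[OF hep_unique[OF f]]
  note out = ear_out[OF P]
  have ip: "ip E P" "P \<noteq> []" and h: "E (hd P) (f i)" "E (last P) (f j)" "i < 7" "j < 7"
    and att: "\<And>v l. v \<in> set P \<Longrightarrow> l < 7 \<Longrightarrow> E v (f l) \<Longrightarrow> l \<in> F \<or> v = hd P \<and> l = i \<or> v = last P \<and> l = j"
    using P unfolding ear_def by blast+
  have hl: "hd P = P ! 0" "last P = P ! (length P - 1)" using ip by (auto simp: hd_conv_nth last_conv_nth)
  have d: "distinct P" using ip ip_distinct by blast
  show k0: "0 < length P" using ip by simp
  show E0: "E (P ! 0) (f i)" and Ek: "E (P ! (length P - 1)) (f j)" using h hl by auto
  show "i < 7" "j < 7" "ip E P" by fact+
  show "set P \<inter> f ` {..<7} = {}" using P unfolding ear_def by blast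
  show "l = i" if "l < 7" "E (P ! 0) (f l)" for l
    using uq[OF out[OF k0], of l i] that E0 h by auto
  show "l = j" if "l < 7" "E (P ! (length P - 1)) (f l)" for l
    using uq[OF out[of "length P - 1"], of l j] that Ek h k0 by auto
  show "l \<in> F \<or> x = 0 \<and> l = i \<or> x = length P - 1 \<and> l = j" if "x < length P" "l < 7" "E (P ! x) (f l)" for x l
    using att[of "P ! x" l] that d hl k0 by (auto simp: nth_eq_iff_index_eq)
qed

text \<open>Cutting an ear at its first contact with \<open>L\<close> removes \<open>L\<close> from
  the tolerated contacts. Repeated cuts lead to pure ears, which \<open>no_ear\<close>
  excludes.\<close>

lemma ear_first:
  assumes f: "hep f" and P: "ear E 7 f P F i j" and L: "i \<notin> L" "j \<notin> L" "L \<subseteq> {..<7}"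
    and x: "x < length P" "l0 \<in> L" "E (P ! x) (f l0)"
  obtains m l where "l \<in> L" "0 < m" "m < length P - 1" "m \<le> x" "E (P ! m) (f l)"
    "ear E 7 f (seg 0 m P) (F - L) i l"
proof -
  note p = ear_ends[OF P f]
  note uq = unique_attD[OF hep_unique[OF f]]
  let ?M = "\<lambda>x. x < length P \<and> (\<exists>l \<in> L. E (P ! x) (f l))"
  define m where "m = (LEAST x. ?M x)"
  have M0: "?M x" using x by blast
  have m: "?M m" unfolding m_def by (rule LeastI[of ?M, OF M0])
  have mx: "m \<le> x" if "?M x" for x unfolding m_def by (rule Least_le[of ?M, OF that])
  obtain l where l: "l \<in> L" "E (P ! m) (f l)" using m by blast
  have "l < 7" using l L by auto
  have "m \<noteq> 0" using p(8)[of l] l L by (intro notI) auto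
  moreover have "m \<noteq> length P - 1" using p(9)[of l] l L by (intro notI) auto
  ultimately have m2: "0 < m" "m < length P - 1" using m by linarith+
  have "ear E 7 f (seg 0 m P) (F - L) i l"
  proof (rule ear_seg[OF P _ _ p(4) \<open>l < 7\<close> p(2) l(2)])
    show "s \<in> F - L \<or> y = 0 \<and> s = i \<or> y = m \<and> s = l" if y: "0 \<le> y" "y \<le> m" "s < 7" "E (P ! y) (f s)" for y s
    proof (cases "s \<in> L")
      case True
      then have "m \<le> y" using mx[of y] y m by auto
      then have "y = m" using y by simp
      then show ?thesis using uq[OF ear_out[OF P], of m s l] m y l \<open>l < 7\<close> by auto
    next
      case False
      then show ?thesis using p(10)[of y s] y m2 by auto
    qed
  qed (use m2 in auto)
  then show thesis using that[OF l(1) m2 mx[OF M0] l(2)] by blast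
qed

lemma ear_last:
  assumes f: "hep f" and P: "ear E 7 f P F i j" and L: "i \<notin> L" "j \<notin> L" "L \<subseteq> {..<7}"
    and x: "x < length P" "l0 \<in> L" "E (P ! x) (f l0)"
  obtains m l where "l \<in> L" "0 < m" "m < length P - 1" "x \<le> m" "E (P ! m) (f l)"
    "ear E 7 f (seg m (length P - 1) P) (F - L) l j"
proof -
  note p = ear_ends[OF P f]
  note uq = unique_attD[OF hep_unique[OF f]]
  let ?M = "\<lambda>x. x < length P \<and> (\<exists>l \<in> L. E (P ! x) (f l))"
  define m where "m = (GREATEST x. ?M x)"
  have M0: "?M x" using x by blast
  have m: "?M m" unfolding m_def by (rule GreatestI_nat[of ?M x "length P"]) (use M0 in auto)
  have mx: "x \<le> m" if "?M x" for x
    unfolding m_def by (rule Greatest_le_nat[of ?M x "length P"]) (use that in auto)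
  obtain l where l: "l \<in> L" "E (P ! m) (f l)" using m by blast
  have "l < 7" using l L by auto
  have "m \<noteq> 0" using p(8)[of l] l L by (intro notI) auto
  moreover have "m \<noteq> length P - 1" using p(9)[of l] l L by (intro notI) auto
  ultimately have m2: "0 < m" "m < length P - 1" using m by linarith+
  have "ear E 7 f (seg m (length P - 1) P) (F - L) l j"
  proof (rule ear_seg[OF P _ _ \<open>l < 7\<close> p(5) l(2) p(3)])
    show "s \<in> F - L \<or> y = m \<and> s = l \<or> y = length P - 1 \<and> s = j"
      if y: "m \<le> y" "y \<le> length P - 1" "s < 7" "E (P ! y) (f s)" for y s
    proof (cases "s \<in> L")
      case True
      moreover have "y < length P" using y m2 by linarith
      ultimately have "y \<le> m" using mx[of y] y by blast
      then have "y = m" using y by simp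
      then show ?thesis using uq[OF ear_out[OF P], of m s l] m y l \<open>l < 7\<close> by auto
    next
      case False
      moreover have "y < length P" using y m2 by linarith
      ultimately show ?thesis using p(10)[of y s] y m2 by auto
    qed
  qed (use m2 in auto)
  then show thesis using that[OF l(1) m2 mx[OF M0] l(2)] by blast
qed

lemma ear_meets:
  assumes "hep f" "ear E 7 f P F i j" "near 3 i j \<or> near 2 i j"
  obtains x l where "x < length P" "l \<in> F" "E (P ! x) (f l)"
proof (rule ccontr)
  assume n: "\<not> thesis"
  note T = that
  have "\<not> E v (f l)" if v: "v \<in> set P" "l \<in> F" for v l
  proof -
    obtain x where "x < length P" "v = P ! x" using v(1) by (metis in_set_conv_nth)
    then show ?thesis using n T v(2) by blast
  qed
  then show False using no_ear[OF assms(1) ear_pure[OF assms(2)] assms(3)] by blast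
qed

lemma near_facts:
  "near 3 0 3" "near 3 0 4" "near 2 0 2" "near 2 1 3" "near 3 1 4" "near 2 2 4"
  "near 2 5 0" "near 3 5 1" "near 3 5 2" "near 2 5 3"
  by (simp_all add: near_def)

text \<open>By \<open>no_ear\<close> the ear is not pure. Its first contact with 1 or 2 is not 2,
  since that would cut off a pure ear from 0 to 2, so 1 is touched; from the other end, so is 2.
  Hence there are sub-ears from 0 to 2 and from 1 to 3, and completing them and \<open>P\<close>
  around the far side of the heptagon gives all parities.\<close>

lemma ejump_facts:
  assumes f: "hep f" and P: "ear E 7 f P {1, 2} 0 3"
  shows "odd (length P)" "3 \<le> length P"
    and "\<exists>j < length P - 1. ear E 7 f (seg 0 j P) {1} 0 2 \<and> odd j"
    and "\<exists>m < length P - 1. ear E 7 f (seg m (length P - 1) P) {2} 1 3 \<and> odd (length P - 1 - m)"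
proof -
  let ?k = "length P"
  have d: "{1, 2} - {1::nat} = {2}" "{1, 2} - {2::nat} = {1}" by auto
  obtain x l where xl: "x < ?k" "l \<in> {1, 2}" "E (P ! x) (f l)"
    by (rule ear_meets[OF f P]) (use near_facts in auto)
  obtain m1 where m1: "m1 < ?k" "E (P ! m1) (f 1)"
  proof (rule ear_first[OF f P _ _ _ xl])
    fix m l assume m: "l \<in> {1, 2::nat}" "m < ?k - 1" "E (P ! m) (f l)" "ear E 7 f (seg 0 m P) ({1, 2} - {1, 2}) 0 l"
    then have "l \<noteq> 2" using no_ear[OF f, of "seg 0 m P" 0 2] near_facts by auto
    then show thesis using that[of m] m by auto
  qed auto
  obtain m2 where m2: "m2 < ?k" "E (P ! m2) (f 2)"
  proof (rule ear_last[OF f P _ _ _ xl])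
    fix m l assume m: "l \<in> {1, 2::nat}" "m < ?k - 1" "E (P ! m) (f l)"
      "ear E 7 f (seg m (?k - 1) P) ({1, 2} - {1, 2}) l 3"
    then have "l \<noteq> 1" using no_ear[OF f, of "seg m (?k - 1) P" 1 3] near_facts by auto
    then show thesis using that[of m] m by auto
  qed auto
  obtain j where j: "0 < j" "j < ?k - 1" "ear E 7 f (seg 0 j P) {1} 0 2"
    by (rule ear_first[OF f P _ _ _ m2(1) _ m2(2), of "{2}"]) (auto simp: d[unfolded One_nat_def])
  have lj: "length (seg 0 j P) = Suc j" using seg(1)[of 0 j P] j by simp
  have "okn (length (seg 0 j P) + length [0,6,5,4,3,2::nat])"
    by (rule ear_two_paths[OF f j(3)]) (use lj j in \<open>auto simp: adj_def E7_def\<close>)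
  then have "odd j" using lj j by (auto simp: okn_def)
  then show "\<exists>j < ?k - 1. ear E 7 f (seg 0 j P) {1} 0 2 \<and> odd j" using j by blast
  obtain m where m: "0 < m" "m < ?k - 1" "ear E 7 f (seg m (?k - 1) P) {2} 1 3"
    by (rule ear_last[OF f P _ _ _ m1(1) _ m1(2), of "{1}"]) (auto simp: d[unfolded One_nat_def])
  have lm: "length (seg m (?k - 1) P) = Suc (?k - 1 - m)" using seg(1)[of m "?k - 1" P] m by simp
  have "okn (length (seg m (?k - 1) P) + length [1,0,6,5,4,3::nat])"
    by (rule ear_two_paths[OF f m(3)]) (use lm m in \<open>auto simp: adj_def E7_def\<close>)
  then have "odd (?k - 1 - m)" using lm m by (auto simp: okn_def)
  then show "\<exists>m < ?k - 1. ear E 7 f (seg m (?k - 1) P) {2} 1 3 \<and> odd (?k - 1 - m)" using m by blast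
  show "3 \<le> ?k" using m by linarith
  moreover have "okn (?k + length [0,6,5,4,3::nat])"
    by (rule ear_two_paths[OF f P]) (use m in \<open>auto simp: adj_def E7_def\<close>)
  ultimately show "odd ?k" by (auto simp: okn_def)
qed

text \<open>Two ears with feet \<open>a, b\<close> and \<open>c, d\<close>, joined along the heptagon by paths from \<open>b\<close> to \<open>c\<close>
  and from \<open>d\<close> back to \<open>a\<close>.\<close>

lemma two_ears:
  assumes f: "hep f" and P: "ear E 7 f P F a b" and Q: "ear E 7 f Q F' c d"
    and PQ: "set P \<inter> set Q = {}" "\<And>x y. x \<in> set P \<Longrightarrow> y \<in> set Q \<Longrightarrow> \<not> E x y"
    and S: "ip (adj E7) S" "S \<noteq> []" "hd S = b" "last S = c" "set S \<subseteq> {..<7}"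
    and R: "ip (adj E7) R" "R \<noteq> []" "hd R = a" "last R = d" "set R \<subseteq> {..<7}"
    and SR: "set S \<inter> set R = {}" "\<And>x y. x \<in> set S \<Longrightarrow> y \<in> set R \<Longrightarrow> \<not> adj E7 x y"
    and F: "F \<inter> (set S \<union> set R) = {}" "F' \<inter> (set S \<union> set R) = {}"
  shows "okn (length P + length S + length Q + length R)"
proof -
  have T: "\<And>i j. i < 7 \<Longrightarrow> j < 7 \<Longrightarrow> E (f i) (f j) \<longleftrightarrow> adj E7 i j" and inj: "inj_on f {..<7}"
    using f by (auto simp: emb_def)
  have p: "ip E P" "P \<noteq> []" "set P \<inter> f ` {..<7} = {}" "E (hd P) (f a)" "E (last P) (f b)"
    and pa: "\<And>v l. v \<in> set P \<Longrightarrow> l < 7 \<Longrightarrow> E v (f l) \<Longrightarrow> l \<in> F \<or> v = hd P \<and> l = a \<or> v = last P \<and> l = b"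
    using P unfolding ear_def by blast+
  have q: "ip E Q" "Q \<noteq> []" "set Q \<inter> f ` {..<7} = {}" "E (hd Q) (f c)" "E (last Q) (f d)"
    and qa: "\<And>v l. v \<in> set Q \<Longrightarrow> l < 7 \<Longrightarrow> E v (f l) \<Longrightarrow> l \<in> F' \<or> v = hd Q \<and> l = c \<or> v = last Q \<and> l = d"
    using Q unfolding ear_def by blast+
  have mS: "ip E (map f S)" by (rule ip_map[OF S(1) inj_on_subset[OF inj S(5)]]) (use T S(5) in blast)
  have mR: "ip E (map f R)" by (rule ip_map[OF R(1) inj_on_subset[OF inj R(5)]]) (use T R(5) in blast)
  have hS: "hd (map f S) = f b" "last (map f S) = f c" "hd (map f R) = f a" "last (map f R) = f d"
    using S R by (auto simp: hd_map last_map)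
  have bc: "b \<in> set S" "c \<in> set S" "a \<in> set R" "d \<in> set R" using S R hd_in_set last_in_set by blast+
  have PS: "E x y \<longleftrightarrow> x = last P \<and> y = f b" if v: "x \<in> set P" "y \<in> set (map f S)" for x y
  proof -
    obtain l where l: "l \<in> set S" "y = f l" using v(2) by auto
    then have "l < 7" "l \<notin> F" "l \<noteq> a" "b < 7" using S(5) F bc SR by auto
    then show ?thesis using pa[OF v(1)] p(5) l by auto
  qed
  have QS: "E x y \<longleftrightarrow> x = hd Q \<and> y = f c" if v: "x \<in> set Q" "y \<in> set (map f S)" for x y
  proof -
    obtain l where l: "l \<in> set S" "y = f l" using v(2) by auto
    then have "l < 7" "l \<notin> F'" "l \<noteq> d" using S(5) F bc SR by auto
    then show ?thesis using qa[OF v(1)] q(4) l by auto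
  qed
  have PR: "x = hd P \<and> y = f a" if v: "x \<in> set P" "y \<in> set (map f R)" "E x y" for x y
  proof -
    obtain l where l: "l \<in> set R" "y = f l" using v(2) by auto
    then have "l < 7" "l \<notin> F" "l \<noteq> b" using R(5) F bc SR by auto
    then show ?thesis using pa[OF v(1)] l v(3) by auto
  qed
  have QR: "x = last Q \<and> y = f d" if v: "x \<in> set Q" "y \<in> set (map f R)" "E x y" for x y
  proof -
    obtain l where l: "l \<in> set R" "y = f l" using v(2) by auto
    then have "l < 7" "l \<notin> F'" "l \<noteq> c" using R(5) F bc SR by auto
    then show ?thesis using qa[OF v(1)] l v(3) by auto
  qed
  have RS: "\<not> E x y" if v: "x \<in> set (map f S)" "y \<in> set (map f R)" for x y
  proof -
    obtain l m where "l \<in> set S" "x = f l" "m \<in> set R" "y = f m" using v by auto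
    then show ?thesis using SR(2)[of l m] T[of l m] S(5) R(5) by auto
  qed
  have sub: "set (map f S) \<subseteq> f ` {..<7}" "set (map f R) \<subseteq> f ` {..<7}" using S(5) R(5) by auto
  have ne: "map f S \<noteq> []" "map f R \<noteq> []" using S R by simp_all
  have D: "X \<inter> Y = {}" if "X \<inter> W = {}" "Y \<subseteq> W" for X Y W :: "'a set" using that by blast
  have dis: "set P \<inter> set (map f S) = {}" "set Q \<inter> set (map f S) = {}"
    "set P \<inter> set (map f R) = {}" "set Q \<inter> set (map f R) = {}"
    by (rule D[OF p(3) sub(1)] D[OF q(3) sub(1)] D[OF p(3) sub(2)] D[OF q(3) sub(2)])+
  have 1: "ip E (P @ map f S)"
    by (rule ip_append[OF sym p(1) mS p(2) ne(1) dis(1)]) (simp_all only: PS hS)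
  have 2: "ip E ((P @ map f S) @ Q)"
  proof (rule ip_append[OF sym 1 q(1) _ q(2)])
    show "(set (P @ map f S)) \<inter> set Q = {}"
      using PQ(1) dis(2) by (simp add: Int_Un_distrib2 Int_commute[of "f ` set S"])
    have l: "last (P @ map f S) = f c" using hS ne by simp
    have "f c \<notin> set P" using p(3) bc S(5) by fastforce
    then show "E x y = (x = last (P @ map f S) \<and> y = hd Q)" if "x \<in> set (P @ map f S)" "y \<in> set Q" for x y
      unfolding l using that PQ(2)[of x y] QS[of y x] sym[of x y] sym[of y x] by auto
  qed (use ne in auto)
  have dj: "f ` set S \<inter> f ` set R = {}"
    using inj S(5) R(5) SR(1) by (metis inj_on_image_Int image_empty)
  have "okn (length ((P @ map f S) @ Q) + length (map f R))"
  proof (rule okn_hole[OF 2 mR])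
    have e: "hd ((P @ map f S) @ Q) = hd P" "last ((P @ map f S) @ Q) = last Q" using p q by auto
    show "E (hd ((P @ map f S) @ Q)) (hd (map f R))" "E (last ((P @ map f S) @ Q)) (last (map f R))"
      unfolding e hS using p q by blast+
    show "x = hd ((P @ map f S) @ Q) \<and> y = hd (map f R) \<or> x = last ((P @ map f S) @ Q) \<and> y = last (map f R)"
      if "x \<in> set ((P @ map f S) @ Q)" "y \<in> set (map f R)" "E x y" for x y
      unfolding e hS using that PR[of x y] QR[of x y] RS[of x y] by auto
    show "set ((P @ map f S) @ Q) \<inter> set (map f R) = {}"
      using dis dj by (simp add: Int_Un_distrib2)
    show "3 \<le> length ((P @ map f S) @ Q) + length (map f R)"
      using p(2) q(2) S(2) by (simp add: Suc_le_eq neq_Nil_conv) (auto simp: neq_Nil_conv)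
  qed (use p ne in auto)
  then show ?thesis by (simp add: add.assoc)
qed

end

section \<open>How components attach to a heptagon\<close>

lemma spread_check:
  "\<forall>A \<in> set (subseqs [0..<7]). (\<forall>i \<in> set A. \<forall>j \<in> set A. \<not> near 3 i j) \<longrightarrow>
    (\<exists>i \<in> set [0..<7]. \<forall>l \<in> set A. l = i \<or> l = (i + 1) mod 7 \<or> l = (i + 2) mod 7)"
  "\<forall>i \<in> set [0..<7]. adj E7 i ((i + 1) mod 7) \<and> adj E7 ((i + 1) mod 7) ((i + 2) mod 7) \<and>
     distinct [i, (i + 1) mod 7, (i + 2) mod 7, (i + 3) mod 7]"
  by code_simp+

context heptag_cut
begin

lemma near_sym: "near d i j \<Longrightarrow> near d j i"
  by (auto simp: near_def)

text \<open>A set of indices without two at cyclic distance 3 lies within three consecutive ones. An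
  attachment of that kind would be a path on three vertices that cuts off the component.\<close>

lemma component_far:
  assumes f: "hep f" and r: "r \<in> V - f ` {..<7}"
  obtains i j x y where "near 3 i j" "x \<in> component E (V - f ` {..<7}) r" "E x (f i)"
    "y \<in> component E (V - f ` {..<7}) r" "E y (f j)"
proof (rule ccontr)
  assume n: "\<not> thesis"
  note T = that
  let ?K = "component E (V - f ` {..<7}) r"
  define B where "B = {i. i < 7 \<and> (\<exists>x \<in> ?K. E x (f i))}"
  \<comment> \<open>Representing the set as a subsequence of the seven indices makes the finite
    check applicable.\<close>
  have "B \<in> set ` set (subseqs [0..<7])" unfolding subseqs_powset B_def by auto
  then obtain A where A: "B = set A" "A \<in> set (subseqs [0..<7])" by (rule imageE)
  have "\<forall>i \<in> set A. \<forall>j \<in> set A. \<not> near 3 i j" using n T unfolding A(1)[symmetric] B_def by blast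
  then obtain i where i: "i \<in> set [0..<7]" "\<forall>l \<in> set A. l = i \<or> l = (i + 1) mod 7 \<or> l = (i + 2) mod 7"
    using spread_check(1) A(2) by blast
  let ?b = "(i + 1) mod 7" and ?c = "(i + 2) mod 7" and ?d = "(i + 3) mod 7"
  have lt: "i < 7" "?b < 7" "?c < 7" "?d < 7" using i by auto
  have ad: "adj E7 i ?b" "adj E7 ?b ?c" "distinct [i, ?b, ?c, ?d]" using spread_check(2) i(1) by blast+
  then have ne: "i \<noteq> ?c" "?d \<notin> {i, ?b, ?c}" by auto
  show False
  proof (rule no_P3_component[OF r, of "f i" "f ?b" "f ?c" "f ?d"])
    show "f i \<in> f ` {..<7}" "f ?b \<in> f ` {..<7}" "f ?c \<in> f ` {..<7}" "f ?d \<in> f ` {..<7}"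
      using lt by blast+
    show "E (f i) (f ?b)" "E (f ?b) (f ?c)" using f ad lt by (auto simp: emb_def)
    show "f i \<noteq> f ?c" "f ?d \<notin> {f i, f ?b, f ?c}" using ne emb_eq[OF f] lt by auto
    show "f ?d \<in> V"
    proof -
      have "?d \<in> set [0..<7]" using lt by simp
      then have "adj E7 ?d ((?d + 1) mod 7)" using spread_check(2) by blast
      then show ?thesis using emb_V[OF f lt(4), of "(?d + 1) mod 7"] by simp
    qed
    show "s \<in> {f i, f ?b, f ?c}" if v: "v \<in> ?K" "s \<in> f ` {..<7}" "E v s" for v s
    proof -
      obtain l where "l < 7" "s = f l" using v(2) by auto
      then have "l \<in> set A" unfolding A(1)[symmetric] B_def using v by blast
      then have "l = i \<or> l = ?b \<or> l = ?c" using i(2) by blast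
      then show ?thesis unfolding \<open>s = f l\<close> by (elim disjE) simp_all
    qed
  qed
qed

lemma ejump:
  assumes f: "hep f" and r: "r \<in> V - f ` {..<7}"
  obtains "is" P where "is \<in> set dih" "set P \<subseteq> component E (V - f ` {..<7}) r"
    "ear E 7 (\<lambda>i. f (is ! i)) P {1, 2} 0 3"
proof -
  let ?K = "component E (V - f ` {..<7}) r"
  have KS: "?K \<inter> f ` {..<7} = {}" using component_subset[of "V - f ` {..<7}" r] by blast
  \<comment> \<open>The minimum is taken over the pair of feet as well as over the walk, so that any
    other pair at distance 3 touched by the path costs at least as much.\<close>
  let ?w = "\<lambda>(i, j, Q). near 3 i j \<and> walk E ?K Q \<and> E (hd Q) (f i) \<and> E (last Q) (f j)"
  obtain i0 j0 x y where xy: "near 3 i0 j0" "x \<in> ?K" "E x (f i0)" "y \<in> ?K" "E y (f j0)"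
    by (rule component_far[OF f r])
  obtain Q0 where Q0: "walk E ?K Q0" "hd Q0 = x" "last Q0 = y"
    using conn_component xy(2,4) unfolding conn_def by blast
  have "?w (i0, j0, Q0)" using xy Q0 by simp
  note am = arg_min_nat_lemma[of ?w, OF this, of "\<lambda>q. length (snd (snd q))"]
  define q where "q = arg_min (\<lambda>q. length (snd (snd q))) ?w"
  have q: "?w q" "\<And>q'. ?w q' \<Longrightarrow> length (snd (snd q)) \<le> length (snd (snd q'))"
    unfolding q_def by (rule conjunct1[OF am], rule mp[OF spec[OF conjunct2[OF am]]])
  obtain i j Q where qq: "q = (i, j, Q)" by (cases q)
  have Q: "near 3 i j" "walk E ?K Q" "E (hd Q) (f i)" "E (last Q) (f j)" using q(1) qq by auto
  have min: "length Q \<le> length Q'" if "near 3 i' j'" "walk E ?K Q'" "E (hd Q') (f i')" "E (last Q') (f j')" for i' j' Q'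
    using q(2)[of "(i', j', Q')"] that qq by simp
  have "i \<in> set [0..<7]" "j \<in> set [0..<7]" using Q(1) by (auto simp: near_def)
  then obtain "is" where "is": "is \<in> set dih" "is ! 0 = i" "is ! 3 = j"
    using dih_check(2) Q(1) by blast
  define g where "g = (\<lambda>l. f (is ! l))"
  have g: "hep g" unfolding g_def by (rule hep_dih[OF f "is"(1)])
  have gS: "g ` {..<7} = f ` {..<7}" unfolding g_def by (rule dih_image[OF "is"(1)])
  have ends: "walk E ?K Q" "E (hd Q) (g 0)" "E (last Q) (g 3)" using Q "is" by (auto simp: g_def)
  have hlQ: "hd Q \<in> ?K" "last Q \<in> ?K" using Q(2) hd_in_set last_in_set unfolding walk_def by blast+
  obtain P where P: "ip E P" "P \<noteq> []" "set P \<subseteq> ?K" "E (hd P) (g 0)" "E (last P) (g 3)"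
    and A1: "\<And>v. v \<in> set P \<Longrightarrow> E v (g 0) \<Longrightarrow> v = hd P" and B1: "\<And>v. v \<in> set P \<Longrightarrow> E v (g 3) \<Longrightarrow> v = last P"
    and mP: "\<And>Q. walk E ?K Q \<Longrightarrow> E (hd Q) (g 0) \<Longrightarrow> E (last Q) (g 3) \<Longrightarrow> length P \<le> length Q"
    by (rule geodesic[OF conn_component hlQ(1), of "\<lambda>v. E v (g 0)" "last Q" "\<lambda>v. E v (g 3)", OF ends(2) hlQ(2) ends(3)])
      (rule that)
  have Pmin: "length P \<le> length Q'"
    if "near 3 (is ! a) (is ! b)" "walk E ?K Q'" "E (hd Q') (g a)" "E (last Q') (g b)" for a b Q'
    using min[OF that(1,2)] that(3,4) mP[OF ends] unfolding g_def by linarith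
  let ?k = "length P"
  have out: "set P \<inter> g ` {..<7} = {}" using P(3) KS gS by blast
  \<comment> \<open>A segment between contacts at distance 3 is itself a candidate, so it is the
    whole path. As the end vertices are attached to 0 and 3 only, this rules out contacts with 4 and
    6, and contacts with 5 combined with 1 or 2.\<close>
  have far: "a = 0 \<and> b = ?k - 1"
    if ab: "a \<le> b" "b < ?k" "near 3 (is ! l) (is ! m)" "E (P ! a) (g l)" "E (P ! b) (g m)" for a b l m
  proof -
    note s = seg[OF ab(1,2)]
    have "set (seg a b P) \<subseteq> ?K" using s(4) P(3) ab by (auto intro!: subsetD[OF P(3)] nth_mem)
    moreover have "successively E (seg a b P)" using ip_successively[OF ip_seg[OF P(1)]] .
    moreover have "seg a b P \<noteq> []" using s(1) by auto
    ultimately have "?k \<le> Suc (b - a)"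
      using Pmin[OF ab(3), of "seg a b P"] s ab by (simp add: walk_def)
    then show ?thesis using ab by linarith
  qed
  have "ear E 7 g P ({..<7} - {0, 3}) 0 3"
    unfolding ear_def using P out A1 B1 by auto
  note e = ear_ends[OF this g]
  have nr: "near 3 (is ! 0) (is ! 4)" "near 3 (is ! 6) (is ! 3)" "near 3 (is ! 2) (is ! 5)" "near 3 (is ! 5) (is ! 1)"
    using dih_check2(1) "is"(1) by blast+
  have no25: False if "x < ?k" "E (P ! x) (g 5)" "y < ?k" "E (P ! y) (g l)" "l \<in> {1, 2}" for x y l
  proof -
    have "near 3 (is ! l) (is ! 5)" "near 3 (is ! 5) (is ! l)" using nr that near_sym by auto
    then have "x = 0 \<or> x = ?k - 1" using far[of x y 5 l] far[of y x l 5] that by (cases "x \<le> y") auto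
    then show False using e(8)[of 5] e(9)[of 5] that by auto
  qed
  have no4: "\<not> E (P ! x) (g 4)" if "x < ?k" for x
  proof
    assume "E (P ! x) (g 4)"
    then have "x = ?k - 1" using far[OF _ that nr(1), of 0] e(2) by simp
    then show False using e(9)[of 4] \<open>E (P ! x) (g 4)\<close> by auto
  qed
  have no6: "\<not> E (P ! x) (g 6)" if "x < ?k" for x
  proof
    assume "E (P ! x) (g 6)"
    then have "x = 0" using far[OF _ _ nr(2), of x "?k - 1"] e(3) that by simp
    then show False using e(8)[of 6] \<open>E (P ! x) (g 6)\<close> by auto
  qed
  have l7: "l \<in> {0, 1, 2, 3, 4, 5, 6}" if "l < 7" for l :: nat using that by auto
  have ear5: "ear E 7 g P {1, 2, 5} 0 3"
  proof -
    have "l \<in> {1, 2, 5} \<or> v = hd P \<and> l = 0 \<or> v = last P \<and> l = 3" if v: "v \<in> set P" "l < 7" "E v (g l)" for v l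
    proof -
      obtain x where x: "x < ?k" "v = P ! x" using v(1) by (metis in_set_conv_nth)
      then show ?thesis using l7[OF v(2)] no4[OF x(1)] no6[OF x(1)] v A1[OF v(1)] B1[OF v(1)] by auto
    qed
    then show ?thesis using P out unfolding ear_def by simp
  qed
  \<comment> \<open>With 5 touched, 1 and 2 are not, so the first contact with 5 would cut off a
    pure ear from 0 to 5, at distance 2.\<close>
  have n5: "\<not> E (P ! x) (g 5)" if x: "x < ?k" for x
  proof
    assume x5: "E (P ! x) (g 5)"
    obtain m where "m < ?k - 1" "ear E 7 g (seg 0 m P) ({1, 2, 5} - {5}) 0 5"
      by (rule ear_first[OF g ear5 _ _ _ x _ x5, of "{5}"]) auto
    moreover have "\<not> E v (g l)" if v: "v \<in> set (seg 0 m P)" "l \<in> {1, 2, 5} - {5}" for v l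
    proof -
      have mk: "m < ?k" using calculation by linarith
      then have "v \<in> (!) P ` {0..m}" using v(1) seg(4)[of 0 m P] by simp
      then obtain y where "y \<le> m" "v = P ! y" by auto
      then have "y < ?k" "v = P ! y" using mk by linarith+
      then show ?thesis using no25[OF x x5, of y l] v by auto
    qed
    ultimately have "ear E 7 g (seg 0 m P) {} 0 5" using ear_pure by blast
    then show False using no_ear[OF g] near_facts(7) near_sym by blast
  qed
  have "l \<in> {1, 2} \<or> v = hd P \<and> l = 0 \<or> v = last P \<and> l = 3" if v: "v \<in> set P" "l < 7" "E v (g l)" for v l
  proof -
    obtain x where "x < ?k" "v = P ! x" using v(1) by (metis in_set_conv_nth)
    then have "l \<noteq> 5" using n5 v(3) by blast
    then show ?thesis using ear5 v unfolding ear_def by blast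
  qed
  then have "ear E 7 g P {1, 2} 0 3" using P out unfolding ear_def by simp
  then show thesis using that "is"(1) P(3) unfolding g_def by blast
qed

text \<open>Such an ear contains a first part from 0 to 2 and a last part from 2 to 4, both with an
  even number of vertices. Parity of the whole keeps the two parts apart, and joining them through 2
  and through 4, 5, 6, 0 gives an odd hole.\<close>

lemma no_long:
  assumes g: "hep g" and P: "ear E 7 g P {1, 2, 3} 0 4"
  shows False
proof -
  let ?k = "length P"
  note e = ear_ends[OF P g]
  have d: "{1, 2, 3} - {1, 2, 3 :: nat} = {}" "{1, 2, 3} - {2, 3 :: nat} = {1}" "{1, 2, 3} - {1, 2 :: nat} = {3}"
    "{1} - {1 :: nat} = {}" "{3} - {3 :: nat} = {}" by auto
  obtain x l where xl: "x < ?k" "l \<in> {1, 2, 3}" "E (P ! x) (g l)"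
    by (rule ear_meets[OF g P]) (use near_facts in auto)
  obtain m1 where m1: "0 < m1" "m1 < ?k - 1" "E (P ! m1) (g 1)"
  proof (rule ear_first[OF g P _ _ _ xl])
    fix m l assume m: "l \<in> {1, 2, 3::nat}" "0 < m" "m < ?k - 1" "E (P ! m) (g l)"
      "ear E 7 g (seg 0 m P) ({1, 2, 3} - {1, 2, 3}) 0 l"
    then have "l \<noteq> 2" "l \<noteq> 3" using no_ear[OF g m(5)[unfolded d]] near_facts by auto
    then show thesis using that[of m] m by auto
  qed auto
  obtain m3 where m3: "0 < m3" "m3 < ?k - 1" "E (P ! m3) (g 3)"
  proof (rule ear_last[OF g P _ _ _ xl])
    fix m l assume m: "l \<in> {1, 2, 3::nat}" "0 < m" "m < ?k - 1" "E (P ! m) (g l)"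
      "ear E 7 g (seg m (?k - 1) P) ({1, 2, 3} - {1, 2, 3}) l 4"
    then have "l \<noteq> 1" "l \<noteq> 2" using no_ear[OF g m(5)[unfolded d]] near_facts by auto
    then show thesis using that[of m] m by auto
  qed auto
  have out: "P ! x \<notin> g ` {..<7}" if "x < ?k" for x using ear_out[OF P that] .
  note uq = unique_attD[OF hep_unique[OF g]]
  have "m1 < ?k" using m1 by linarith
  from uq[OF out[OF this], of 1 3] have "m1 \<noteq> m3" using m1 m3 by auto
  then have k4: "4 \<le> ?k" using m1 m3 by linarith
  have "okn (?k + length [0,6,5,4::nat])"
    by (rule ear_two_paths[OF g P]) (use k4 in \<open>auto simp: adj_def E7_def\<close>)
  then have ek: "even ?k" using k4 by (auto simp: okn_def)
  \<comment> \<open>If 3 came before 2, the piece up to 3 would contain a pure ear from 1 to 3. The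
    mirrored argument determines \<open>j2\<close>.\<close>
  obtain j where j: "0 < j" "j < ?k - 1" "E (P ! j) (g 2)" "ear E 7 g (seg 0 j P) {1} 0 2"
  proof (rule ear_first[OF g P _ _ _ _ _ m3(3), of "{2, 3}"])
    fix m l assume m: "l \<in> {2, 3::nat}" "0 < m" "m < ?k - 1" "E (P ! m) (g l)"
      "ear E 7 g (seg 0 m P) ({1, 2, 3} - {2, 3}) 0 l"
    have "l \<noteq> 3"
    proof
      assume "l = 3"
      then have s: "ear E 7 g (seg 0 m P) {1} 0 3" using m(5) d by simp
      obtain y l' where y: "y < length (seg 0 m P)" "l' \<in> {1}" "E (seg 0 m P ! y) (g l')"
        by (rule ear_meets[OF g s]) (use near_facts in auto)
      obtain m' where "ear E 7 g (seg m' (length (seg 0 m P) - 1) (seg 0 m P)) ({1} - {1}) 1 3"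
        by (rule ear_last[OF g s _ _ _ y]) auto
      from no_ear[OF g this[unfolded d]] show False using near_facts by blast
    qed
    then show thesis using that[of m] m d by auto
  qed (use m3 in auto)
  obtain j2 where j2: "j \<le> j2" "j2 < ?k - 1" "E (P ! j2) (g 2)" "ear E 7 g (seg j2 (?k - 1) P) {3} 2 4"
  proof (rule ear_last[OF g P _ _ _ _ _ j(3), of "{1, 2}"])
    fix m l assume m: "l \<in> {1, 2::nat}" "j \<le> m" "m < ?k - 1" "E (P ! m) (g l)"
      "ear E 7 g (seg m (?k - 1) P) ({1, 2, 3} - {1, 2}) l 4"
    have "l \<noteq> 1"
    proof
      assume "l = 1"
      then have s: "ear E 7 g (seg m (?k - 1) P) {3} 1 4" using m(5) d by simp
      obtain y l' where y: "y < length (seg m (?k - 1) P)" "l' \<in> {3}" "E (seg m (?k - 1) P ! y) (g l')"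
        by (rule ear_meets[OF g s]) (use near_facts in auto)
      obtain m' where "ear E 7 g (seg 0 m' (seg m (?k - 1) P)) ({3} - {3}) 1 3"
        by (rule ear_first[OF g s _ _ _ y]) auto
      from no_ear[OF g this[unfolded d]] show False using near_facts by blast
    qed
    then show thesis using that[of m] m d by auto
  qed (use j in auto)
  have l1: "length (seg 0 j P) = Suc j" using seg(1)[of 0 j P] j by simp
  have l2: "length (seg j2 (?k - 1) P) = ?k - j2" using seg(1)[of j2 "?k - 1" P] j2 by simp
  have "okn (length (seg 0 j P) + length [0,6,5,4,3,2::nat])"
    by (rule ear_two_paths[OF g j(4)]) (use l1 j in \<open>auto simp: adj_def E7_def\<close>)
  then have oj: "odd j" using l1 j by (auto simp: okn_def)
  have "okn (length (seg j2 (?k - 1) P) + length [2,1,0,6,5,4::nat])"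
    by (rule ear_two_paths[OF g j2(4)]) (use l2 j2 in \<open>auto simp: adj_def E7_def\<close>)
  then have ekj: "even (?k - j2)" using l2 j2 by (auto simp: okn_def)
  moreover have "j2 < ?k" using j2(2) by linarith
  ultimately have "even j2" using ek by simp
  then have "j \<noteq> j2" using oj by auto
  have adj: "E (P ! x) (P ! y) \<longleftrightarrow> y = Suc x \<or> x = Suc y" if "x < ?k" "y < ?k" for x y
    using ip_adj[OF e(6) that] .
  \<comment> \<open>Consecutive positions would form a triangle with \<open>g 2\<close>.\<close>
  have "j2 \<noteq> Suc j" using no3[of "P ! j" "P ! j2" "g 2"] adj[of j j2] j j2 sym by auto
  then have gap: "Suc j < j2" using j2 \<open>j \<noteq> j2\<close> by linarith
  have dist: "P ! x = P ! y \<longleftrightarrow> x = y" if "x < ?k" "y < ?k" for x y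
    using ip_distinct[OF e(6)] that by (simp add: nth_eq_iff_index_eq)
  have s1: "set (seg 0 j P) = (!) P ` {0..j}" using seg(4)[of 0 j P] j by simp
  have s2: "set (seg j2 (?k - 1) P) = (!) P ` {j2..?k - 1}" using seg(4)[of j2 "?k - 1" P] j2 by simp
  have idx: "x < ?k \<and> y < ?k \<and> Suc x < y" if "x \<in> {0..j}" "y \<in> {j2..?k - 1}" for x y
    using that gap j2 by auto
  \<comment> \<open>Even + 1 + even + 4 vertices, at least 9 in total.\<close>
  have "okn (length (seg 0 j P) + length [2::nat] + length (seg j2 (?k - 1) P) + length [0,6,5,4::nat])"
  proof (rule two_ears[OF g j(4) j2(4)])
    show "set (seg 0 j P) \<inter> set (seg j2 (?k - 1) P) = {}"
      unfolding s1 s2 using idx dist by fastforce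
    show "\<not> E x y" if "x \<in> set (seg 0 j P)" "y \<in> set (seg j2 (?k - 1) P)" for x y
      using that unfolding s1 s2 using idx adj by fastforce
  qed (auto simp: adj_def E7_def)
  then show False using l1 l2 oj ekj j j2 gap by (auto simp: okn_def)
qed

text \<open>Connect the additional contact to \<open>P\<close> by a shortest path, so that besides
  0, 1, 2, 3 a single vertex \<open>t\<close> is touched. For \<open>t = 4\<close> there is an ear
  as in \<open>no_long\<close>, and \<open>t = 6\<close> is its mirror image. The vertex 5 is at
  distance 2 or 3 from each of 0, 1, 2, 3, so \<open>t = 5\<close> yields a pure ear of a forbidden
  kind.\<close>

lemma no_wide:
  assumes g: "hep g" and K: "conn E K" "K \<inter> g ` {..<7} = {}" and P: "ear E 7 g P {1, 2} 0 3" "set P \<subseteq> K"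
    and x: "x \<in> K" "t0 \<in> {4, 5, 6}" "E x (g t0)"
  shows False
proof -
  note e = ear_ends[OF P(1) g]
  have k3: "3 \<le> length P" by (rule ejump_facts(2)[OF g P(1)])
  have uqa: "unique_att E 7 g" by (rule hep_unique[OF g])
  have P01: "P ! 0 \<in> set P" "P ! 1 \<in> set P" "E (P ! 0) (P ! 1)" using k3 e(1) ip_adj[OF e(6), of 0 1] by simp_all
  have Patt: "l \<in> {0, 1, 2, 3}" if "v \<in> set P" "l < 7" "E v (g l)" for v l
    using that P(1) unfolding ear_def by blast
  obtain R where R: "ip E R" "R \<noteq> []" "set R \<subseteq> K" "\<exists>t \<in> {4, 5, 6}. E (hd R) (g t)" "\<exists>p \<in> set P. E (last R) p"
    and A1: "\<And>v. v \<in> set R \<Longrightarrow> \<exists>t \<in> {4, 5, 6}. E v (g t) \<Longrightarrow> v = hd R"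
  proof (rule geodesic[OF K(1) x(1), of "\<lambda>v. \<exists>t \<in> {4, 5, 6}. E v (g t)" "P ! 0" "\<lambda>v. \<exists>p \<in> set P. E v p"])
    show "\<exists>t \<in> {4, 5, 6}. E x (g t)" using x by blast
    show "P ! 0 \<in> K" "\<exists>p \<in> set P. E (P ! 0) p" using P01 P(2) by blast+
  qed (rule that)
  obtain t where t: "t \<in> {4, 5, 6}" "E (hd R) (g t)" using R(4) by blast
  obtain p where p: "p \<in> set P" "E (last R) p" using R(5) by blast
  define L where "L = set R \<union> set P"
  have L: "conn E L" unfolding L_def
    by (rule conn_Un[OF conn_ip[OF R(1)] conn_ip[OF e(6)] last_in_set[OF R(2)] p])
  have "L \<subseteq> K" unfolding L_def using R(3) P(2) by blast
  then have Lg: "L \<inter> g ` {..<7} = {}" using K(2) by blast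
  have t7: "t < 7" using t by auto
  have Latt: "l \<in> {0, 1, 2, 3, t}" if v: "v \<in> L" "l < 7" "E v (g l)" for v l
  proof (cases "v \<in> set P")
    case True
    then show ?thesis using Patt[OF True v(2,3)] by blast
  next
    case False
    then have vR: "v \<in> set R" using v(1) by (simp add: L_def)
    show ?thesis
    proof (cases "l \<in> {4, 5, 6}")
      case True
      then have "v = hd R" using A1[OF vR] v(3) by blast
      moreover have "v \<notin> g ` {..<7}" using Lg v(1) by blast
      ultimately show ?thesis using unique_attD[OF uqa _ v(2) t7 v(3)] t(2) by simp
    next
      case False
      then have "l = 0 \<or> l = 1 \<or> l = 2 \<or> l = 3" using v(2) by auto
      then show ?thesis by blast
    qed
  qed
  have hR: "hd R \<in> L" "P ! 0 \<in> L" "P ! (length P - 1) \<in> L" using R(2) e(1) by (auto simp: L_def)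
  consider "t = 4" | "t = 5" | "t = 6" using t(1) by blast
  then show False
  proof cases
    case 1
    obtain Q where "ear E 7 g Q {1, 2, 3} 0 4"
      by (rule emb_component_att[OF g wf_E(1) uqa L Lg hR(2) e(2) hR(1) t(2), of "{1, 2, 3}"]) (use Latt 1 in auto)
    then show False by (rule no_long[OF g])
  next
    case 2
    obtain Q where Q: "ip E Q" "Q \<noteq> []" "set Q \<subseteq> L" "E (hd Q) (g 5)" "\<exists>s \<in> {0, 1, 2, 3}. E (last Q) (g s)"
      and A: "\<And>v. v \<in> set Q \<Longrightarrow> E v (g 5) \<Longrightarrow> v = hd Q"
      and B: "\<And>v. v \<in> set Q \<Longrightarrow> \<exists>s \<in> {0, 1, 2, 3}. E v (g s) \<Longrightarrow> v = last Q"
    proof (rule geodesic[OF L hR(1), of "\<lambda>v. E v (g 5)" "P ! 0" "\<lambda>v. \<exists>s \<in> {0, 1, 2, 3}. E v (g s)"])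
      show "E (hd R) (g 5)" using t(2) 2 by simp
      show "P ! 0 \<in> L" "\<exists>s \<in> {0, 1, 2, 3}. E (P ! 0) (g s)" using hR e(2) by blast+
    qed (rule that)
    obtain s where s: "s \<in> {0, 1, 2, 3}" "E (last Q) (g s)" using Q(5) by blast
    have s7: "s < 7" using s(1) by auto
    have Qg: "set Q \<inter> g ` {..<7} = {}" using Q(3) Lg by blast
    have "v = hd Q \<and> l = 5 \<or> v = last Q \<and> l = s" if v: "v \<in> set Q" "l < 7" "E v (g l)" for v l
    proof (cases "l = 5")
      case True
      then show ?thesis using A[OF v(1)] v(3) by simp
    next
      case False
      then have "l \<in> {0, 1, 2, 3}" using Latt[of v l] v Q(3) 2 by auto
      then have "v = last Q" using B[OF v(1)] v(3) by blast
      moreover have "v \<notin> g ` {..<7}" using Qg v(1) by blast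
      ultimately show ?thesis using unique_attD[OF uqa _ v(2) s7 v(3)] s(2) by simp
    qed
    then have "ear E 7 g Q {} 5 s" using Q(1,2,4) Qg s(2) s7 unfolding ear_def by simp
    moreover have "near 3 5 s \<or> near 2 5 s" using s(1) near_facts by auto
    ultimately show False using no_ear[OF g] by blast
  next
    case 3
    let ?is = "[3, 2, 1, 0, 6, 5, 4]"
    define h where "h = (\<lambda>l. g (?is ! l))"
    have h: "hep h" unfolding h_def by (rule hep_dih[OF g dih_check2(3)])
    have "h ` {..<7} \<subseteq> g ` {..<7}"
    proof -
      have "?is ! l < (7::nat)" if "l < 7" for l
        using that by (auto simp: less_Suc_eq numeral_eq_Suc)
      then show ?thesis unfolding h_def by blast
    qed
    then have Lh: "L \<inter> h ` {..<7} = {}" using Lg by blast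
    have h0: "h 0 = g 3" "h 4 = g 6" "h 1 = g 2" "h 2 = g 1" "h 3 = g 0" "h 5 = g 5" "h 6 = g 4"
      by (simp_all add: h_def)
    have "l \<in> {1, 2, 3} \<union> {0, 4}" if v: "v \<in> L" "l < 7" "E v (h l)" for v l
    proof -
      have "l = 0 \<or> l = 1 \<or> l = 2 \<or> l = 3 \<or> l = 4 \<or> l = 5 \<or> l = 6" using v(2) by auto
      moreover have "\<not> E v (g 5)" "\<not> E v (g 4)" using Latt[of v 5] Latt[of v 4] v 3 by auto
      ultimately show ?thesis using v(3) h0 by auto
    qed
    then obtain Q where "ear E 7 h Q {1, 2, 3} 0 4"
      using emb_component_att[OF h wf_E(1) hep_unique[OF h] L Lh hR(3) _ hR(1), of 0 4 "{1, 2, 3}" thesis]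
        e(3) t(2) 3 h0 by auto
    then show False by (rule no_long[OF h])
  qed
qed

lemma ear_mirror:
  assumes "ear E 7 g P F i j" "a < 7" "b < 7" "[3, 2, 1, 0, 6, 5, 4] ! a = i" "[3, 2, 1, 0, 6, 5, 4] ! b = j"
    and "\<And>l. l < 7 \<Longrightarrow> [3, 2, 1, 0, 6, 5, 4] ! l \<in> F \<Longrightarrow> l \<in> F'"
  shows "ear E 7 (\<lambda>l. g ([3, 2, 1, 0, 6, 5, 4] ! l)) P F' a b"
  by (rule ear_dih[OF assms(1) dih_check2(3) assms(4,5,2,3,6)])

text \<open>With feet 3, 6 the ears meet at 3, and odd + 1 + odd + 2 is odd. With feet 2, 5 the full
  ears overlap, so they are shortened to the sub-ears from 0 to 2 and from 3 to 5. These have even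
  numbers of vertices and are joined by 2, 3 and by 5, 6, 0, so the total is again odd. In both
  cases it is at least 9.\<close>

lemma no_two_ejumps:
  assumes g: "hep g" and P: "ear E 7 g P {1, 2} 0 3"
    and Q: "ear E 7 g Q {3, 4} 2 5 \<or> ear E 7 g Q {4, 5} 3 6"
    and PQ: "set P \<inter> set Q = {}" "\<And>x y. x \<in> set P \<Longrightarrow> y \<in> set Q \<Longrightarrow> \<not> E x y"
  shows False
  using Q
proof
  note Pf = ejump_facts[OF g P]
  assume Q: "ear E 7 g Q {4, 5} 3 6"
  have "ear E 7 (\<lambda>l. g ([3,4,5,6,0,1,2] ! l)) Q {1, 2} 0 3"
    by (rule ear_dih[OF Q dih_check2(5)]) (auto simp: less_Suc_eq numeral_eq_Suc)
  note Qf = ejump_facts[OF hep_dih[OF g dih_check2(5)] this]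
  have "okn (length P + length [3::nat] + length Q + length [0, 6::nat])"
    by (rule two_ears[OF g P Q PQ]) (auto simp: adj_def E7_def)
  then show False using Pf(1,2) Qf(1,2) by (auto simp: okn_def)
next
  assume Q: "ear E 7 g Q {3, 4} 2 5"
  let ?is = "[2, 3, 4, 5, 6, 0, 1]"
  have "ear E 7 (\<lambda>l. g (?is ! l)) Q {1, 2} 0 3"
    by (rule ear_dih[OF Q dih_check2(4)]) (auto simp: less_Suc_eq numeral_eq_Suc)
  then obtain m where m: "m < length Q - 1" "ear E 7 (\<lambda>l. g (?is ! l)) (seg m (length Q - 1) Q) {2} 1 3"
      "odd (length Q - 1 - m)"
    using ejump_facts(4)[OF hep_dih[OF g dih_check2(4)]] by blast
  have Q': "ear E 7 g (seg m (length Q - 1) Q) {4} 3 5" using ear_back[OF dih_check2(4) m(2)] by simp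
  obtain j where j: "j < length P - 1" "ear E 7 g (seg 0 j P) {1} 0 2" "odd j"
    using ejump_facts(3)[OF g P] by blast
  have l: "length (seg 0 j P) = Suc j" "length (seg m (length Q - 1) Q) = Suc (length Q - 1 - m)"
    using seg(1)[of 0 j P] seg(1)[of m "length Q - 1" Q] j m by simp_all
  have sub: "set (seg a b X) \<subseteq> set X" for a b and X :: "'a list"
    unfolding seg_def by (meson in_set_dropD in_set_takeD subsetI)
  have "okn (length (seg 0 j P) + length [2, 3::nat] + length (seg m (length Q - 1) Q) + length [0, 6, 5::nat])"
  proof (rule two_ears[OF g j(2) Q'])
    show "set (seg 0 j P) \<inter> set (seg m (length Q - 1) Q) = {}" using sub PQ(1) by blast
    show "\<not> E x y" if "x \<in> set (seg 0 j P)" "y \<in> set (seg m (length Q - 1) Q)" for x y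
      using sub PQ(2) that by blast
  qed (auto simp: adj_def E7_def)
  then show False using l j m by (auto simp: okn_def)
qed

lemma component_disjoint:
  assumes "r' \<in> W" "r' \<notin> component E W r"
  shows "component E W r \<inter> component E W r' = {}"
    and "\<And>x y. x \<in> component E W r \<Longrightarrow> y \<in> component E W r' \<Longrightarrow> \<not> E x y"
proof -
  show dj: "component E W r \<inter> component E W r' = {}"
  proof (rule ccontr)
    assume "component E W r \<inter> component E W r' \<noteq> {}"
    then obtain v xs ys where v: "walk E W xs" "hd xs = r" "last xs = v" "walk E W ys" "hd ys = r'" "last ys = v"
      by (auto simp: component_def)
    have "last xs = hd (rev ys)" using v by (simp add: hd_rev)
    from walk_join[OF v(1) walk_rev[OF v(4)] this] obtain zs
      where "walk E W zs" "hd zs = hd xs" "last zs = last (rev ys)" .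
    then show False using assms(2) v by (auto simp: component_def last_rev)
  qed
  show "\<not> E x y" if xy: "x \<in> component E W r" "y \<in> component E W r'" for x y
  proof
    assume "E x y"
    then have "y \<in> component E W r" using component_step[OF xy(1)] component_subset xy(2) by blast
    then show False using dj xy(2) by blast
  qed
qed

lemma no_hep: "\<not> hep f"
proof
  assume f: "hep f"
  obtain r0 where "r0 \<in> V - f ` {..<7}"
    by (rule third[OF f, of 0 1 6]) (auto simp: adj_def E7_def)
  then obtain is0 P where P0: "is0 \<in> set dih" "set P \<subseteq> component E (V - f ` {..<7}) r0"
      "ear E 7 (\<lambda>i. f (is0 ! i)) P {1, 2} 0 3"
    by (rule ejump[OF f])
  define g where "g = (\<lambda>i. f (is0 ! i))"
  define W where "W = V - g ` {..<7}"
  define K where "K = component E W r0"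
  have gW: "W = V - f ` {..<7}" unfolding W_def g_def dih_image[OF P0(1)] ..
  have g: "hep g" unfolding g_def by (rule hep_dih[OF f P0(1)])
  have P: "ear E 7 g P {1, 2} 0 3" "set P \<subseteq> K" using P0(2,3) unfolding g_def K_def gW by auto
  have WS: "component E W r \<inter> g ` {..<7} = {}" for r using component_subset[of W r] unfolding W_def by blast
  \<comment> \<open>Vertex 5 is opposite to the middle edge of the path 0, 1, 2, 3. By
    \<open>no_wide\<close> its third neighbour lies in another component, whose own four attachment
    vertices include 5.\<close>
  obtain r where r: "E (g 5) r" "r \<in> V - g ` {..<7}"
    by (rule third[OF g, of 5 4 6]) (auto simp: adj_def E7_def)
  have rK: "r \<notin> K"
  proof
    assume "r \<in> K"
    then show False
      using no_wide[OF g conn_component[of W r0] WS P(1) P(2)[unfolded K_def], of r 5] sym[OF r(1)]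
      unfolding K_def by simp
  qed
  define K' where "K' = component E W r"
  have rW: "r \<in> W" using r(2) unfolding W_def .
  note dj = component_disjoint[OF rW rK[unfolded K_def]]
  obtain "is" Q where Q: "is \<in> set dih" "set Q \<subseteq> K'" "ear E 7 (\<lambda>i. g (is ! i)) Q {1, 2} 0 3"
    using ejump[OF g r(2)] unfolding K'_def W_def by blast
  have PQ: "set P \<inter> set Q = {}" "\<And>x y. x \<in> set P \<Longrightarrow> y \<in> set Q \<Longrightarrow> \<not> E x y"
    using dj P(2) Q(2) unfolding K_def K'_def by blast+
  have "length is = 7" "set is = set [0..<7]" using dih_check(1) Q(1) by blast+
  then have "5 \<in> set is" by simp
  then obtain t where "t < length is" "is ! t = 5" unfolding in_set_conv_nth by blast
  then have t: "t < 7" "is ! t = 5" using \<open>length is = 7\<close> by simp_all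
  have "t \<notin> {4, 5, 6}"
  proof
    assume t4: "t \<in> {4, 5, 6}"
    have "E r (g (is ! t))" using r(1) t sym by simp
    then show False
      using no_wide[OF hep_dih[OF g Q(1)] conn_component[of W r] _ Q(3) Q(2)[unfolded K'_def] component_self[OF rW] t4]
        WS[of r] dih_image[OF Q(1), of g] by simp
  qed
  then have "t < 4" using t(1) by auto
  then have "5 \<in> set (take 4 is)" using t(2) \<open>length is = 7\<close> by (auto simp: in_set_conv_nth intro!: exI[of _ t])
  then have cs: "take 4 is \<in> set [[2,3,4,5],[5,4,3,2],[3,4,5,6],[6,5,4,3],[4,5,6,0],[0,6,5,4],[5,6,0,1],[1,0,6,5]]"
    using dih_check2(6) Q(1) by blast
  have b: "ear E 7 g Q {is ! 1, is ! 2} (is ! 0) (is ! 3)" using ear_back[OF Q(1,3)] by simp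
  have tk: "is ! 0 = take 4 is ! 0" "is ! 1 = take 4 is ! 1" "is ! 2 = take 4 is ! 2" "is ! 3 = take 4 is ! 3"
    by simp_all
  \<comment> \<open>The reflection that fixes 5 and reverses 0, 1, 2, 3. Of the four arcs on four
    vertices through 5 it maps 4, 5, 6, 0 and 5, 6, 0, 1 to the two treated in
    \<open>no_two_ejumps\<close>.\<close>
  let ?m = "[3, 2, 1, 0, 6, 5, 4]"
  let ?g = "\<lambda>l. g (?m ! l)"
  have low: False if "ear E 7 g X {3, 4} 2 5 \<or> ear E 7 g X {4, 5} 3 6" "set X = set Q" for X
    by (rule no_two_ejumps[OF g P(1) that(1)]) (use PQ that(2) in simp_all)
  have P': "ear E 7 ?g (rev P) {1, 2} 0 3"
    by (rule ear_rev, rule ear_mirror[OF P(1)]) (auto simp: less_Suc_eq numeral_eq_Suc)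
  have high: False if "ear E 7 ?g X {3, 4} 2 5 \<or> ear E 7 ?g X {4, 5} 3 6" "set X = set Q" for X
    by (rule no_two_ejumps[OF hep_dih[OF g dih_check2(3)] P' that(1)]) (use PQ that(2) in simp_all)
  have m1: "ear E 7 ?g X {4, 5} 6 3" if "ear E 7 g X {5, 6} 4 0" for X
    by (rule ear_mirror[OF that]) (auto simp: less_Suc_eq numeral_eq_Suc)
  have m2: "ear E 7 ?g X {3, 4} 5 2" if "ear E 7 g X {6, 0} 5 1" for X
    by (rule ear_mirror[OF that]) (auto simp: less_Suc_eq numeral_eq_Suc)
  have b': "ear E 7 g (rev Q) {is ! 2, is ! 1} (is ! 3) (is ! 0)" using ear_rev[OF b] by (simp add: insert_commute)
  consider "take 4 is = [2,3,4,5]" | "take 4 is = [5,4,3,2]" | "take 4 is = [3,4,5,6]" | "take 4 is = [6,5,4,3]"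
    | "take 4 is = [4,5,6,0]" | "take 4 is = [0,6,5,4]" | "take 4 is = [5,6,0,1]" | "take 4 is = [1,0,6,5]"
    using cs by auto
  then show False
  proof cases
    case 1 then show ?thesis using low[of Q] b unfolding tk by simp
  next
    case 2 then show ?thesis using low[of "rev Q"] b' unfolding tk by simp
  next
    case 3 then show ?thesis using low[of Q] b unfolding tk by simp
  next
    case 4 then show ?thesis using low[of "rev Q"] b' unfolding tk by simp
  next
    case 5 then show ?thesis using high[of "rev Q"] ear_rev[OF m1[of Q]] b unfolding tk by simp
  next
    case 6 then show ?thesis using high[of Q] ear_rev[OF m1[of "rev Q"]] b' unfolding tk by simp
  next
    case 7 then show ?thesis using high[of "rev Q"] ear_rev[OF m2[of Q]] b unfolding tk by simp
  next
    case 8 then show ?thesis using high[of Q] ear_rev[OF m2[of "rev Q"]] b' unfolding tk by simp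
  qed
qed

end

subsection \<open>Shortest odd closed walks\<close>

context heptag
begin

definition odd_closed :: "'a list \<Rightarrow> bool" where
  "odd_closed xs \<longleftrightarrow> odd (length xs) \<and> successively E xs \<and> E (last xs) (hd xs)"

text \<open>A repeated vertex splits the closed walk into two whose lengths sum to its own; a chord
  is counted in both parts, so their lengths sum to its own plus 2. In either case exactly one part
  is odd, and it is shorter.\<close>

lemma odd_closed_split:
  assumes "odd_closed xs" "i < j" "j < length xs" and c: "xs ! i = xs ! j \<or> E (xs ! i) (xs ! j)"
    and ij: "j \<noteq> Suc i" "\<not> (i = 0 \<and> j = length xs - 1)"
  shows "\<exists>ys. odd_closed ys \<and> length ys < length xs"
proof -
  let ?n = "length xs"
  have o: "odd ?n" and s: "successively E xs" and l: "E (last xs) (hd xs)"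
    using assms(1) by (auto simp: odd_closed_def)
  have ne: "xs \<noteq> []" using assms by auto
  have sd: "successively E (drop a xs)" and st: "successively E (take a xs)" for a
    using s by (metis append_take_drop_id successively_append_iff)+
  have adj: "E (xs ! a) (xs ! Suc a)" if "Suc a < ?n" for a
    using s that by (simp add: successively_conv_nth)
  have le: "E (xs ! (?n - 1)) (xs ! 0)" using l ne by (simp add: hd_conv_nth last_conv_nth)
  have A: "odd_closed (take (b - a) (drop a xs))"
    if "a < b" "b \<le> ?n" "odd (b - a)" "E (xs ! (b - 1)) (xs ! a)" for a b
  proof -
    have "successively E (take (b - a) (drop a xs))"
      using sd[of a] by (metis append_take_drop_id successively_append_iff)
    then show ?thesis using that by (simp add: odd_closed_def hd_drop_conv_nth last_conv_nth)
  qed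
  have B: "odd_closed (take a xs @ drop b xs)"
    if "0 < a" "a \<le> b" "b < ?n" "odd (a + (?n - b))" "E (xs ! (a - 1)) (xs ! b)" for a b
  proof -
    have "successively E (take a xs @ drop b xs)"
      using sd[of b] st[of a] that ne
      by (auto simp: successively_append_iff last_conv_nth hd_drop_conv_nth min_def)
    then show ?thesis using that l ne by (simp add: odd_closed_def)
  qed
  show ?thesis
  proof (cases "E (xs ! i) (xs ! j)")
    case True
    then have e: "E (xs ! j) (xs ! i)" by (rule sym)
    show ?thesis
    proof (cases "even (j - i)")
      case True
      then show ?thesis using A[of i "Suc j"] assms(2,3) e ij by (intro exI conjI) (auto simp: Suc_diff_le)
    next
      case False
      then show ?thesis using B[of "Suc i" j] assms(2,3) True ij o by (intro exI conjI) auto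
    qed
  next
    case False
    then have e: "xs ! i = xs ! j" using c by blast
    show ?thesis
    proof (cases "odd (j - i)")
      case True
      have "E (xs ! (j - 1)) (xs ! i)" using adj[of "j - 1"] e assms(2,3) by simp
      then show ?thesis using A[of i j] assms(2,3) True by (intro exI conjI) auto
    next
      case odd: False
      show ?thesis
      proof (cases "i = 0")
        case True
        have "E (xs ! (?n - 1)) (xs ! j)" using le e True by simp
        then show ?thesis using A[of j ?n] assms(2,3) o odd True by (intro exI conjI) auto
      next
        case False
        have "E (xs ! (i - 1)) (xs ! j)" using adj[of "i - 1"] e assms(2,3) False by simp
        then show ?thesis using B[of i j] assms(2,3) o odd False by (intro exI conjI) auto
      qed
    qed
  qed
qed

text \<open>A shortest odd closed walk has neither repetitions nor chords. It is therefore an odd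
  hole, and the only admissible length is 7.\<close>

lemma odd_closed_hep:
  assumes "odd_closed xs" shows "\<exists>f. hep f"
proof -
  have "\<exists>ys. odd_closed ys \<and> (\<forall>zs. odd_closed zs \<longrightarrow> length ys \<le> length zs)"
    using arg_min_nat_lemma[of odd_closed xs length, OF assms] by blast
  then obtain ys where ys: "odd_closed ys" and m: "\<And>zs. odd_closed zs \<Longrightarrow> length ys \<le> length zs" by blast
  let ?n = "length ys"
  have o: "odd ?n" and s: "successively E ys" and l: "E (last ys) (hd ys)"
    using ys by (auto simp: odd_closed_def)
  have ne: "ys \<noteq> []" using o by auto
  have sp: "j = Suc i \<or> i = 0 \<and> j = ?n - 1" if "i < j" "j < ?n" "ys ! i = ys ! j \<or> E (ys ! i) (ys ! j)" for i j
    using odd_closed_split[OF ys that] m by (meson leD)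
  have adj: "E (ys ! a) (ys ! Suc a)" if "Suc a < ?n" for a
    using s that by (simp add: successively_conv_nth)
  have le: "E (ys ! (?n - 1)) (ys ! 0)" using l ne by (simp add: hd_conv_nth last_conv_nth)
  have n1: "?n \<noteq> 1" using le irr by auto
  have d: "distinct ys"
    unfolding distinct_conv_nth
  proof (intro allI impI)
    have *: "ys ! i \<noteq> ys ! j" if "i < j" "j < ?n" for i j
      using sp[OF that] adj[of i] le irr that by metis
    show "ys ! i \<noteq> ys ! j" if "i < ?n" "j < ?n" "i \<noteq> j" for i j
      using *[of i j] *[of j i] that by (metis linorder_neqE_nat)
  qed
  have n3: "3 \<le> ?n" using o n1 by presburger
  have n7: "7 \<le> ?n" by (rule girth[OF d n3 s l])
  have *: "E (ys ! i) (ys ! j) \<longleftrightarrow> j = Suc i mod ?n \<or> i = Suc j mod ?n" if "i < j" "j < ?n" for i j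
  proof -
    have "j = Suc i mod ?n \<longleftrightarrow> j = Suc i" using that by auto
    moreover have "i = Suc j mod ?n \<longleftrightarrow> i = 0 \<and> j = ?n - 1"
      using that by (cases "Suc j = ?n") auto
    ultimately show ?thesis using sp[OF that] adj[of i] le sym that by metis
  qed
  have cyc: "E (ys ! i) (ys ! j) \<longleftrightarrow> j = Suc i mod ?n \<or> i = Suc j mod ?n" if ij: "i < ?n" "j < ?n" for i j
  proof (cases i j rule: linorder_cases)
    case less then show ?thesis using * ij by blast
  next
    case greater
    then have "E (ys ! j) (ys ! i) \<longleftrightarrow> i = Suc j mod ?n \<or> j = Suc i mod ?n" using * ij by blast
    then show ?thesis using sym by blast
  next
    case equal
    have "i \<noteq> Suc i mod ?n" using ij n7 by (cases "Suc i = ?n") auto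
    then show ?thesis using equal irr by simp
  qed
  have n: "?n = 7" using odd_hole[OF d n7 cyc] o by blast
  have E7: "adj E7 i j \<longleftrightarrow> j = Suc i mod 7 \<or> i = Suc j mod 7" if "i < 7" "j < 7" for i j
  proof -
    have "\<forall>i \<in> set [0..<7]. \<forall>j \<in> set [0..<7]. adj E7 i j \<longleftrightarrow> j = Suc i mod 7 \<or> i = Suc j mod 7" by code_simp
    then show ?thesis using that by simp
  qed
  have "hep (\<lambda>i. ys ! i)"
    unfolding emb_def using cyc E7 n d by (auto simp: inj_on_def nth_eq_iff_index_eq)
  then show ?thesis by blast
qed

end

context heptag_cut
begin

text \<open>Were \<open>w\<close> in another component, \<open>{w}\<close> alone would be a star
  cutset whose parity condition is vacuous. What has to remain beyond \<open>w\<close> is one of its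
  neighbours.\<close>

lemma connected: 
  assumes "v \<in> V" "w \<in> V" shows "w \<in> component E V v"
proof (rule ccontr)
  assume w: "w \<notin> component E V v"
  have "V \<subseteq> component E V v \<union> {} \<union> {w}"
  proof (rule noStar[OF assms(2) w])
    show "component E V v \<noteq> {}" using component_self[OF assms(1)] by blast
    show "y \<in> component E V v \<or> y = w \<or> y \<in> {}" if "x \<in> component E V v" "E x y" for x y
      using component_step[OF that] inV2[OF that(2)] by blast
  qed (use component_subset conn_component in auto)
  moreover obtain c where c: "E w c" using deg[OF assms(2)] by blast
  moreover have "c \<noteq> w" using c irr by blast
  ultimately have "c \<in> component E V v" using inV2 by blast
  then show False using component_step[of c V v w] sym[OF c] assms(2) w by blast
qed

text \<open>Colour by the parity of walks from a root. A conflict on an edge closes two walks of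
  equal parity to an odd closed walk, which yields a heptagon.\<close>

lemma two_colouring: "\<exists>U. \<forall>u v. E u v \<longrightarrow> (u \<in> U \<longleftrightarrow> v \<notin> U)"
proof (cases "V = {}")
  case True
  then show ?thesis using inV by blast
next
  case False
  then obtain r where r: "r \<in> V" by blast
  let ?w = "\<lambda>v xs. walk E V xs \<and> hd xs = r \<and> last xs = v"
  define U where "U = {v. \<exists>xs. ?w v xs \<and> odd (length xs)}"
  have ex: "\<exists>xs. ?w v xs" if "v \<in> V" for v using connected[OF r that] by (simp add: component_def)
  have par: False if E: "E u v" and x: "?w u xs" and y: "?w v ys" and p: "odd (length xs) \<longleftrightarrow> odd (length ys)" for u v xs ys
  proof -
    \<comment> \<open>\<open>tl\<close> drops the root, which already heads \<open>xs\<close>; so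
      the length is one less than a sum of two numbers of equal parity.\<close>
    have "odd_closed (xs @ rev (tl ys))"
    proof (cases "tl ys")
      case Nil
      then have "length ys = 1" "v = r" using y by (cases ys; simp add: walk_def)+
      then show ?thesis using Nil E x p by (auto simp: odd_closed_def walk_def)
    next
      case (Cons z zs)
      then have ys: "ys = r # z # zs" using y by (cases ys) (auto simp: walk_def)
      then have "E r z" "successively E (z # zs)" "last (z # zs) = v" using y by (auto simp: walk_def)
      moreover from this have "successively E (rev (z # zs))"
        unfolding successively_rev using sym by (metis successively_mono)
      moreover have "hd (rev (z # zs)) = v" "last (rev (z # zs)) = z"
        using calculation(3) by (metis hd_rev, metis last_rev list.sel(1))
      ultimately show ?thesis
        using ys x p E sym by (auto simp: odd_closed_def walk_def successively_append_iff simp del: rev.simps)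
    qed
    then show False using odd_closed_hep no_hep by blast
  qed
  have "u \<in> U \<longleftrightarrow> v \<notin> U" if E: "E u v" for u v
  proof -
    obtain xs ys where xy: "?w u xs" "?w v ys" using ex[OF inV[OF E]] ex[OF inV2[OF E]] by blast
    then have "odd (length xs) \<longleftrightarrow> even (length ys)" using par[OF E] by blast
    moreover have "odd (length xs') \<longleftrightarrow> odd (length xs)" if "?w u xs'" for xs'
      using par[OF E that xy(2)] par[OF E xy] by blast
    moreover have "odd (length ys') \<longleftrightarrow> odd (length ys)" if "?w v ys'" for ys'
      using par[OF E xy(1) that] par[OF E xy] by blast
    ultimately show ?thesis using xy unfolding U_def by blast
  qed
  then show ?thesis by blast
qed

end

subsection \<open>Arc walks from lists of vertices\<close>

context wf_digraph
begin

lemma dominates_induce: "u \<rightarrow>\<^bsub>G \<restriction> S\<^esub> v \<longleftrightarrow> u \<rightarrow>\<^bsub>G\<^esub> v \<and> u \<in> S \<and> v \<in> S"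
  by (auto simp: arcs_ends_conv)

lemma induce_induce: "S \<subseteq> W \<Longrightarrow> (G \<restriction> W) \<restriction> S = G \<restriction> S"
  by (auto simp: induce_subgraph_def)

text \<open>The lists of tails and heads determine the ends of each arc by position, which the
  proofs of chordlessness rely on.\<close>

lemma awalk_of_verts:
  assumes "xs \<noteq> []" "set xs \<subseteq> verts G" "successively (\<lambda>u v. u \<rightarrow>\<^bsub>G\<^esub> v) xs"
  shows "\<exists>p. awalk (hd xs) p (last xs) \<and> awalk_verts (hd xs) p = xs \<and>
    map (tail G) p = butlast xs \<and> map (head G) p = tl xs"
  using assms
proof (induction xs)
  case (Cons x xs)
  show ?case
  proof (cases xs)
    case Nil
    then show ?thesis using Cons.prems by (intro exI[of _ "[]"]) (auto simp: awalk_Nil_iff)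
  next
    case (Cons y ys)
    then obtain p where p: "awalk y p (last xs)" "awalk_verts y p = xs"
        "map (tail G) p = butlast xs" "map (head G) p = ys"
      using Cons.IH Cons.prems by auto
    have "x \<rightarrow>\<^bsub>G\<^esub> y" using Cons.prems Cons by simp
    then obtain e where "e \<in> arcs G" "tail G e = x" "head G e = y" by blast
    then show ?thesis using p Cons by (intro exI[of _ "e # p"]) (auto simp: awalk_Cons_iff)
  qed
qed simp

lemma arc_nth:
  assumes "map (tail G) p = butlast xs" "map (head G) p = tl xs" "xs \<noteq> []" "Suc i < length xs"
  shows "i < length p" "tail G (p ! i) = xs ! i" "head G (p ! i) = xs ! Suc i"
proof -
  have "length p = length xs - 1" using assms(1) by (metis length_butlast length_map)
  then show i: "i < length p" using assms(4) by simp
  have "map (tail G) p ! i = butlast xs ! i" "map (head G) p ! i = tl xs ! i" using assms by simp_all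
  then show "tail G (p ! i) = xs ! i" "head G (p ! i) = xs ! Suc i"
    using i assms(3,4) by (simp_all add: nth_butlast nth_tl)
qed

end

context graph
begin

lemma adj_sym: "u \<rightarrow>\<^bsub>G\<^esub> v \<Longrightarrow> v \<rightarrow>\<^bsub>G\<^esub> u"
  using graph_symmetric .

lemma cycle_of_verts:
  assumes "distinct xs" "3 \<le> length xs" "successively (\<lambda>u v. u \<rightarrow>\<^bsub>G\<^esub> v) xs" "last xs \<rightarrow>\<^bsub>G\<^esub> hd xs"
  shows "\<exists>p. is_cycle G p \<and> length p = length xs \<and>
    map (tail G) p = butlast (xs @ [hd xs]) \<and> map (head G) p = tl (xs @ [hd xs])"
proof -
  let ?ys = "xs @ [hd xs]"
  have ne: "xs \<noteq> []" using assms(2) by auto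
  have s: "successively (\<lambda>u v. u \<rightarrow>\<^bsub>G\<^esub> v) ?ys" using assms ne by (simp add: successively_append_iff)
  have "set xs \<subseteq> verts G"
  proof
    fix x assume "x \<in> set xs"
    then obtain i where i: "i < length xs" "x = xs ! i" by (metis in_set_conv_nth)
    have "?ys ! i \<rightarrow>\<^bsub>G\<^esub> ?ys ! Suc i" using s i by (simp add: successively_conv_nth)
    then show "x \<in> verts G" using i adj_in_verts(1) by (simp add: nth_append)
  qed
  then have sub: "set ?ys \<subseteq> verts G" using ne by auto
  obtain p where p: "awalk (hd xs) p (hd xs)" "awalk_verts (hd xs) p = ?ys"
      "map (tail G) p = butlast ?ys" "map (head G) p = tl ?ys"
    using awalk_of_verts[OF _ sub s] ne by auto
  have l: "length p = length xs" using length_awalk_verts[of "hd xs" p] p(2) by simp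
  have "distinct (tl ?ys)" using assms(1) ne by (cases xs) auto
  then have "is_cycle G p" unfolding is_cycle_def cycle_def using p l assms(2) by fastforce
  then show ?thesis using p l by blast
qed

lemma hole_of_verts:
  assumes "distinct xs" "4 \<le> length xs" and
    E: "\<And>i j. i < length xs \<Longrightarrow> j < length xs \<Longrightarrow>
      xs ! i \<rightarrow>\<^bsub>G\<^esub> xs ! j \<longleftrightarrow> j = Suc i mod length xs \<or> i = Suc j mod length xs"
  shows "\<exists>p. hole G p \<and> length p = length xs"
proof -
  let ?ys = "xs @ [hd xs]" and ?n = "length xs"
  have ne: "xs \<noteq> []" using assms(2) by auto
  have "successively (\<lambda>u v. u \<rightarrow>\<^bsub>G\<^esub> v) xs"
    unfolding successively_conv_nth using E by simp
  moreover have "last xs \<rightarrow>\<^bsub>G\<^esub> hd xs"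
    using E[of "?n - 1" 0] ne by (simp add: last_conv_nth hd_conv_nth)
  ultimately obtain p where p: "is_cycle G p" "length p = ?n"
      "map (tail G) p = butlast ?ys" "map (head G) p = tl ?ys"
    using cycle_of_verts[OF assms(1)] assms(2) by auto
  have pn: "tail G (p ! i) = xs ! i" "head G (p ! i) = xs ! (Suc i mod ?n)" "p ! i \<in> set p" if i: "i < ?n" for i
  proof -
    have "?ys ! Suc i = xs ! (Suc i mod ?n)" using i ne by (cases "Suc i = ?n") (auto simp: nth_append hd_conv_nth)
    then show "tail G (p ! i) = xs ! i" "head G (p ! i) = xs ! (Suc i mod ?n)"
      using arc_nth[OF p(3,4), of i] i by (simp_all add: nth_append)
    show "p ! i \<in> set p" using i p(2) by simp
  qed
  have "chordless G p"
    unfolding chordless_def Let_def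
  proof (intro ballI impI)
    fix e assume e: "e \<in> arcs G"
      "tail G e \<in> tail G ` set p \<union> head G ` set p \<and> head G e \<in> tail G ` set p \<union> head G ` set p"
    have "tail G ` set p = set xs" using arg_cong[OF p(3), of set] by simp
    moreover have "head G ` set p = set xs" using arg_cong[OF p(4), of set] ne by (cases xs) auto
    ultimately have "tail G e \<in> set xs" "head G e \<in> set xs" using e by auto
    then obtain i j where ij: "i < ?n" "j < ?n" "tail G e = xs ! i" "head G e = xs ! j"
      by (metis in_set_conv_nth)
    have "xs ! i \<rightarrow>\<^bsub>G\<^esub> xs ! j" using in_arcs_imp_in_arcs_ends[OF e(1)] ij by simp
    then have "j = Suc i mod ?n \<or> i = Suc j mod ?n" using E ij by blast
    then show "\<exists>f \<in> set p. {tail G f, head G f} = {tail G e, head G e}"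
    proof
      assume "j = Suc i mod ?n"
      then show ?thesis using pn[OF ij(1)] ij by (intro bexI[of _ "p ! i"]) auto
    next
      assume "i = Suc j mod ?n"
      then show ?thesis using pn[OF ij(2)] ij by (intro bexI[of _ "p ! j"]) auto
    qed
  qed
  then show ?thesis using p(1,2) assms(2) unfolding hole_def by auto
qed

lemma induced_path_of_verts:
  assumes ip: "ip (\<lambda>u v. u \<rightarrow>\<^bsub>G\<^esub> v) xs" and "2 \<le> length xs" "set xs \<subseteq> verts G"
  shows "\<exists>p. induced_path G (hd xs) p (last xs) \<and> length p = length xs - 1 \<and>
    awalk_verts (hd xs) p = xs \<and> inner_verts p = tl (butlast xs)"
proof -
  let ?E = "\<lambda>u v. u \<rightarrow>\<^bsub>G\<^esub> v"
  have ne: "xs \<noteq> []" using assms(2) by auto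
  have nth: "distinct xs" "\<And>i j. i < length xs \<Longrightarrow> j < length xs \<Longrightarrow> i < j \<Longrightarrow> xs ! i \<rightarrow>\<^bsub>G\<^esub> xs ! j \<longleftrightarrow> j = Suc i"
    using ip ip_nth[of ?E xs] adj_sym by blast+
  have s: "successively ?E xs" unfolding successively_conv_nth using nth(2) by auto
  obtain p where p: "awalk (hd xs) p (last xs)" "awalk_verts (hd xs) p = xs"
      "map (tail G) p = butlast xs" "map (head G) p = tl xs"
    using awalk_of_verts[OF ne assms(3) s] by blast
  have l: "length p = length xs - 1" using length_awalk_verts[of "hd xs" p] p(2) by simp
  have step: "\<exists>f \<in> set p. {tail G f, head G f} = {xs ! i, xs ! j}" if "i < length xs" "j < length xs" "i < j" "xs ! i \<rightarrow>\<^bsub>G\<^esub> xs ! j" for i j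
  proof -
    have "j = Suc i" using nth that by blast
    then show ?thesis using arc_nth[OF p(3,4) ne, of i] that by (intro bexI[of _ "p ! i"]) auto
  qed
  have "chordless G p"
    unfolding chordless_def Let_def
  proof (intro ballI impI)
    fix e assume e: "e \<in> arcs G"
      "tail G e \<in> tail G ` set p \<union> head G ` set p \<and> head G e \<in> tail G ` set p \<union> head G ` set p"
    have "tail G ` set p \<subseteq> set xs" using arg_cong[OF p(3), of set] by (auto dest: in_set_butlastD)
    moreover have "head G ` set p \<subseteq> set xs" using arg_cong[OF p(4), of set] by (auto dest: list.set_sel(2)[OF ne])
    ultimately have "tail G e \<in> set xs" "head G e \<in> set xs" using e by auto
    then obtain i j where ij: "i < length xs" "j < length xs" "tail G e = xs ! i" "head G e = xs ! j"
      by (metis in_set_conv_nth)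
    have d: "xs ! i \<rightarrow>\<^bsub>G\<^esub> xs ! j" using in_arcs_imp_in_arcs_ends[OF e(1)] ij by simp
    then have "i \<noteq> j" using adj_not_same by blast
    then have "i < j \<or> j < i" by auto
    then show "\<exists>f \<in> set p. {tail G f, head G f} = {tail G e, head G e}"
      using step[of i j] step[of j i] d adj_sym[OF d] ij by (metis insert_commute)
  qed
  then show ?thesis
    using p l nth(1) unfolding induced_path_def apath_def inner_verts_def by auto
qed

text \<open>After the deletion of \<open>X\<close> no arc leaves \<open>K\<close>, so nothing
  outside \<open>K\<close> is reachable from it. By symmetry, connectedness amounts to strong
  connectedness, which this contradicts.\<close>

lemma cutsetI:
  assumes X: "X \<subseteq> verts G" and K: "K \<subseteq> verts G - X" "K \<noteq> {}" "K \<noteq> verts G - X"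
    and cl: "\<And>x y. x \<in> K \<Longrightarrow> x \<rightarrow>\<^bsub>G\<^esub> y \<Longrightarrow> y \<in> K \<union> X"
  shows "cutset G X"
proof -
  let ?H = "delete_verts G X"
  interpret H: wf_digraph ?H unfolding delete_verts_def by (rule wellformed_induce_subgraph)
  have v: "verts ?H = verts G - X" by (simp add: delete_verts_def)
  have sy: "symmetric ?H" unfolding delete_verts_def
    by (rule induced_graph_imp_symmetric[OF sym_arcs induced_induce]) auto
  have "\<not> Digraph_Component.connected ?H"
  proof
    assume "Digraph_Component.connected ?H"
    then have sc: "strongly_connected ?H" by (rule H.symmetric_connected_imp_strongly_connected[OF sy])
    obtain u w where uw: "u \<in> K" "w \<in> verts G - X" "w \<notin> K" using K by blast
    then have "u \<rightarrow>\<^sup>*\<^bsub>?H\<^esub> w" using sc v K(1) unfolding strongly_connected_def by blast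
    then have "w \<in> K"
    proof (induction rule: H.reachable_induct)
      case (step x y)
      then show ?case using cl[of x y] dominates_induce[where S = "verts G - X"] unfolding delete_verts_def by blast
    qed (use uw in simp)
    then show False using uw by blast
  qed
  then show ?thesis using X K v unfolding cutset_def by blast
qed

text \<open>Connectivity of \<open>K\<close> gives strong connectedness, and closure under arcs
  within \<open>W\<close> gives maximality: a larger strongly connected subgraph would be reachable
  from \<open>K\<close>.\<close>

lemma component_in_sccs:
  assumes K: "K \<subseteq> W" "K \<noteq> {}" "W \<subseteq> verts G" and c: "conn (\<lambda>u v. u \<rightarrow>\<^bsub>G\<^esub> v) K"
    and cl: "\<And>x y. x \<in> K \<Longrightarrow> x \<rightarrow>\<^bsub>G\<^esub> y \<Longrightarrow> y \<in> W \<Longrightarrow> y \<in> K"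
  shows "G \<restriction> K \<in> pre_digraph.sccs (G \<restriction> W)"
proof -
  interpret H: wf_digraph "G \<restriction> W" by (rule wellformed_induce_subgraph)
  interpret L: wf_digraph "G \<restriction> K" by (rule wellformed_induce_subgraph)
  have re: "hd xs \<rightarrow>\<^sup>*\<^bsub>G \<restriction> K\<^esub> last xs" if "walk (\<lambda>u v. u \<rightarrow>\<^bsub>G\<^esub> v) K xs" for xs
    using that
  proof (induction xs)
    case (Cons x xs)
    show ?case
    proof (cases xs)
      case Nil
      then show ?thesis using Cons.prems by (auto simp: walk_def intro: L.reachable_refl)
    next
      case (Cons y ys)
      then have "y \<rightarrow>\<^sup>*\<^bsub>G \<restriction> K\<^esub> last xs" "x \<rightarrow>\<^bsub>G \<restriction> K\<^esub> y"
        using Cons.IH Cons.prems by (auto simp: walk_def dominates_induce)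
      then show ?thesis using L.adj_reachable_trans Cons by auto
    qed
  qed (simp add: walk_def)
  show ?thesis
  proof (rule H.in_sccsI)
    show "induced_subgraph (G \<restriction> K) (G \<restriction> W)"
      using H.induced_induce[of K] induce_induce[OF K(1)] K(1) by simp
    show "strongly_connected (G \<restriction> K)"
    proof (rule strongly_connectedI)
      show "u \<rightarrow>\<^sup>*\<^bsub>G \<restriction> K\<^esub> v" if uv: "u \<in> verts (G \<restriction> K)" "v \<in> verts (G \<restriction> K)" for u v
      proof -
        obtain xs where "walk (\<lambda>u v. u \<rightarrow>\<^bsub>G\<^esub> v) K xs" "hd xs = u" "last xs = v"
          using c uv unfolding conn_def by auto
        then show ?thesis using re by blast
      qed
    qed (use K in simp)
    show "\<not> (\<exists>c'. induced_subgraph c' (G \<restriction> W) \<and> strongly_connected c' \<and> verts (G \<restriction> K) \<subset> verts c')"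
    proof
      assume "\<exists>c'. induced_subgraph c' (G \<restriction> W) \<and> strongly_connected c' \<and> verts (G \<restriction> K) \<subset> verts c'"
      then obtain C where C: "induced_subgraph C (G \<restriction> W)" "strongly_connected C" "K \<subset> verts C" by auto
      then obtain u w where uw: "u \<in> K" "w \<in> verts C" "w \<notin> K" using K(2) by blast
      then have "u \<rightarrow>\<^sup>*\<^bsub>C\<^esub> w" using C unfolding strongly_connected_def by blast
      then have "u \<rightarrow>\<^sup>*\<^bsub>G \<restriction> W\<^esub> w" using C(1) by (meson H.reachable_mono induced_imp_subgraph)
      then have "w \<in> K"
      proof (induction rule: H.reachable_induct)
        case (step x y)
        then show ?case using cl[of x y] dominates_induce[where S = W] by blast
      qed (use uw in simp)
      then show False using uw by blast
    qed
  qed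
qed

lemma min_degree_neighbour:
  assumes "3 \<le> min_degree G" "v \<in> verts G"
  shows "\<exists>c. v \<rightarrow>\<^bsub>G\<^esub> c \<and> c \<noteq> a \<and> c \<noteq> b"
proof (rule ccontr)
  assume n: "\<not> ?thesis"
  have "min_degree G \<le> out_degree G v"
    unfolding min_degree_def using assms(2) by (intro Min_le) auto
  then have c: "3 \<le> card (out_arcs G v)" using assms(1) by (simp add: out_degree_def)
  \<comment> \<open>Without parallel arcs, different arcs out of \<open>v\<close> have different
    heads, so the out-degree counts neighbours.\<close>
  have inj: "inj_on (head G) (out_arcs G v)"
    by (rule inj_onI) (auto intro!: no_multi_arcs simp: arc_to_ends_def)
  have "head G ` out_arcs G v \<subseteq> {a, b}"
  proof
    fix x assume "x \<in> head G ` out_arcs G v"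
    then have "v \<rightarrow>\<^bsub>G\<^esub> x" using in_arcs_imp_in_arcs_ends by auto
    then show "x \<in> {a, b}" using n by blast
  qed
  then have "card (out_arcs G v) \<le> card {a, b}" using inj by (metis card_image card_mono finite.emptyI finite_insert)
  also have "\<dots> \<le> 2" by (simp add: card_insert_if)
  finally show False using c by simp
qed

end

section \<open>Heptagraphs as instances of the abstract setting\<close>

lemma heptagraph_heptag:
  assumes "heptagraph G"
  shows "heptag (verts G) (\<lambda>u v. u \<rightarrow>\<^bsub>G\<^esub> v)"
proof -
  interpret graph G using assms by (simp add: heptagraph_def)
  show ?thesis
  proof
    show "7 \<le> length xs"
      if "distinct xs" "3 \<le> length xs" "successively (\<lambda>u v. u \<rightarrow>\<^bsub>G\<^esub> v) xs" "last xs \<rightarrow>\<^bsub>G\<^esub> hd xs" for xs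
      using cycle_of_verts[OF that] assms unfolding heptagraph_def by (metis not_le)
    show "even (length xs) \<or> length xs = 7"
      if xs: "distinct xs" "7 \<le> length xs" and cyc: "\<And>i j. i < length xs \<Longrightarrow> j < length xs \<Longrightarrow>
        (xs ! i \<rightarrow>\<^bsub>G\<^esub> xs ! j) = (j = Suc i mod length xs \<or> i = Suc j mod length xs)" for xs
    proof (rule ccontr)
      assume n: "\<not> ?thesis"
      obtain p where "hole G p" "length p = length xs"
        using hole_of_verts[OF xs(1) _ cyc] xs(2) by auto
      moreover have "odd (length xs)" "9 \<le> length xs" using n xs(2) by presburger+
      ultimately show False using assms unfolding heptagraph_def by metis
    qed
  qed (use adj_sym adj_not_same adj_in_verts in auto)
qed

theorem theorem1p4:
  fixes G :: "('a,'b) pre_digraph"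
  assumes "heptagraph G"
    and "min_degree G \<ge> 3"
  shows "bipartite G \<or> has_P3_cutset G \<or> (\<exists>X. parity_star_cutset G X)"
proof (rule ccontr)
  assume n: "\<not> ?thesis"
  let ?V = "verts G" and ?E = "\<lambda>u v. u \<rightarrow>\<^bsub>G\<^esub> v"
  interpret graph G using assms(1) by (simp add: heptagraph_def)
  interpret H: heptag ?V ?E by (rule heptagraph_heptag[OF assms(1)])
  interpret heptag_cut ?V ?E
  proof
    show "\<exists>c. v \<rightarrow>\<^bsub>G\<^esub> c \<and> c \<noteq> a \<and> c \<noteq> b" if "v \<in> ?V" for v a b
      by (rule min_degree_neighbour[OF assms(2) that])
    show "K = ?V - {a, b, c}"
      if abc: "?E a b" "?E b c" "a \<noteq> c" and K: "K \<noteq> {}" "K \<subseteq> ?V - {a, b, c}"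
        and cl: "\<And>x y. x \<in> K \<Longrightarrow> ?E x y \<Longrightarrow> y \<in> K \<union> {a, b, c}" for a b c K
    proof (rule ccontr)
      assume ne: "K \<noteq> ?V - {a, b, c}"
      have V: "{a, b, c} \<subseteq> ?V" using abc adj_in_verts by blast
      have "\<not> ?E a c" using H.no3 abc adj_sym by blast
      then have "ip ?E [a, b, c]" using abc H.irr by auto
      then obtain p where "induced_path G a p c" "length p = 2" "awalk_verts a p = [a, b, c]"
        using induced_path_of_verts[of "[a, b, c]"] V by auto
      moreover have "cutset G (set [a, b, c])"
        by (rule cutsetI[of _ K]) (use V K cl ne in auto)
      ultimately have "has_P3_cutset G" unfolding has_P3_cutset_def by metis
      then show False using n by blast
    qed
    show "?V \<subseteq> K \<union> Y \<union> {w}"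
      if w: "w \<in> ?V" "w \<notin> K" and YK: "Y \<inter> K = {}" and K: "conn ?E K" "K \<noteq> {}" "K \<subseteq> ?V"
        and wY: "\<And>y. y \<in> Y \<Longrightarrow> ?E w y" and cl: "\<And>x y. x \<in> K \<Longrightarrow> ?E x y \<Longrightarrow> y \<in> K \<or> y = w \<or> y \<in> Y"
        and par: "\<And>y z Q. y \<in> Y \<Longrightarrow> z \<in> Y \<Longrightarrow> y \<noteq> z \<Longrightarrow> Q \<noteq> [] \<Longrightarrow> set Q \<subseteq> K \<Longrightarrow> ip ?E (y # Q @ [z]) \<Longrightarrow> odd (length Q)"
      for w K Y
    proof (rule ccontr)
      assume nV: "\<not> ?V \<subseteq> K \<union> Y \<union> {w}"
      \<comment> \<open>Only leaves with a neighbour in \<open>K\<close> are kept, since any two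
        leaves have to be joined by a path through \<open>K\<close>.\<close>
      define Y' where "Y' = {y \<in> Y. \<exists>x \<in> K. ?E x y}"
      define X where "X = insert w Y'"
      have Y': "Y' \<subseteq> Y" unfolding Y'_def by blast
      have XV: "X \<subseteq> ?V" using w Y' wY adj_in_verts unfolding X_def by blast
      have KX: "K \<subseteq> ?V - X" using K(3) w(2) YK Y' unfolding X_def by blast
      have clX: "y \<in> K \<union> X" if "x \<in> K" "?E x y" for x y
        using cl[OF that] that unfolding X_def Y'_def by blast
      have "cutset G X"
        by (rule cutsetI[OF XV KX K(2) _ clX]) (use nV Y' in \<open>auto simp: X_def\<close>)
      moreover have "G \<restriction> K \<in> pre_digraph.sccs (delete_verts G X)"
        unfolding delete_verts_def by (rule component_in_sccs[OF KX K(2) _ K(1)]) (use clX in auto)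
      moreover have "?E w y" if "y \<in> X - {w}" for y using that wY Y' unfolding X_def by blast
      moreover have "\<exists>p. induced_path G y p z \<and> even (length p) \<and> set (inner_verts p) \<subseteq> verts (G \<restriction> K)"
        if yz: "y \<in> X - {w}" "z \<in> X - {w}" "y \<noteq> z" for y z
      proof -
        obtain u v where uv: "y \<in> Y" "u \<in> K" "?E u y" "z \<in> Y" "v \<in> K" "?E v z"
          using yz unfolding X_def Y'_def by blast
        obtain Q where Q: "ip ?E Q" "Q \<noteq> []" "set Q \<subseteq> K" "?E (hd Q) y" "?E (last Q) z"
          and A: "\<And>x. x \<in> set Q \<Longrightarrow> ?E x y \<Longrightarrow> x = hd Q" and B: "\<And>x. x \<in> set Q \<Longrightarrow> ?E x z \<Longrightarrow> x = last Q"
          \<comment> \<open>A shortest path between the neighbourhoods of \<open>y\<close> and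
            \<open>z\<close> in \<open>K\<close> touches each of them once, so adding both ends
            keeps it induced. Its \<open>length Q + 1\<close> edges are even in number, as
            \<open>par\<close> makes \<open>length Q\<close> odd.\<close>
          by (rule H.geodesic[OF K(1) uv(2), of "\<lambda>x. ?E x y" v "\<lambda>x. ?E x z", OF uv(3,5,6)]) (rule that)
        have out: "y \<notin> set Q" "z \<notin> set Q" using uv Q(3) YK by blast+
        have nyz: "\<not> ?E y z" using H.no3 wY uv(1,4) adj_sym by blast
        have 1: "ip ?E ([y] @ Q)"
          by (rule ip_append[OF adj_sym]) (use Q out A adj_sym in auto)
        have "ip ?E (([y] @ Q) @ [z])"
          by (rule ip_append[OF adj_sym 1]) (use Q out B yz(3) nyz adj_sym in auto)
        then have ip: "ip ?E (y # Q @ [z])" by simp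
        have "set (y # Q @ [z]) \<subseteq> ?V" using Q(3) K(3) uv adj_in_verts by auto
        then obtain p where p: "induced_path G y p z" "length p = length Q + 1"
            "inner_verts p = tl (butlast (y # Q @ [z]))"
          using induced_path_of_verts[OF ip] by auto
        have "inner_verts p = Q" using p(3) by (simp add: butlast_append)
        moreover have "odd (length Q)" by (rule par[OF uv(1,4) yz(3) Q(2,3) ip])
        ultimately show ?thesis using p Q(3) by auto
      qed
      ultimately have "parity_star_cutset G X" unfolding parity_star_cutset_def X_def by blast
      then show False using n by blast
    qed
  qed
  obtain U where U: "\<And>u v. ?E u v \<Longrightarrow> u \<in> U \<longleftrightarrow> v \<notin> U" using two_colouring by blast
  have "bipartite G"
    unfolding bipartite_def
  proof (intro exI conjI ballI)
    show "?V = (?V \<inter> U) \<union> (?V - U)" "(?V \<inter> U) \<inter> (?V - U) = {}" by auto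
    show "tail G e \<in> ?V \<inter> U \<and> head G e \<in> ?V - U \<or> tail G e \<in> ?V - U \<and> head G e \<in> ?V \<inter> U" if "e \<in> arcs G" for e
      using U[OF in_arcs_imp_in_arcs_ends[OF that]] that by auto
  qed
  then show False using n by blast
qed

end
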